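(* Let $n,m\ge1$ be integers and let $\Omega=\Omega_1\times\Omega_2\subset\mathbb{R}^n\times\mathbb{T}^m$, where $\Omega_1\subset\mathbb{R}^n$ is nonempty, open and $2\pi\mathbb{Z}^n$-invariant, and $\Omega_2\subset\mathbb{T}^m$ is nonempty and open. For every $T>0$ there exists a constant $C=C(T,\Omega)$ such that for all $u_0\in L^2(\mathbb{R}^n\times\mathbb{T}^m)$, $$\|u_0\|^2_{L^2(\mathbb{R}^n\times\mathbb{T}^m)}\le C\int_0^T\|e^{it\Delta_{x,y}}u_0\|^2_{L^2(\Omega)}\,dt.$$
   Context: $\mathbb{T}=\mathbb{R}/2\pi\mathbb{Z}$; points of $\mathbb{R}^n\times\mathbb{T}^m$ are written $(x,y)$ and $\Delta_{x,y}$ is the flat Laplacian. $e^{it\Delta_{x,y}}$ is the Schrödinger propagator, i.e. the Fourier multiplier $e^{-it|\xi|^2}$, $\xi\in\mathbb{R}^n\times\mathbb{Z}^m$. $2\pi\mathbb{Z}^n$-invariant means $\Omega_1+2\pi k=\Omega_1$ for all $k\in\mathbb{Z}^n$. *)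

theory Defs
  imports "HOL-Analysis.Analysis"
begin

text \<open>
  The torus \<open>\<real>\<^sup>m / 2\<pi>\<int>\<^sup>m\<close> is handled through its universal cover: a subset of the torus is a
  \<open>2\<pi>\<int>\<^sup>m\<close>-invariant subset of \<open>\<real>\<^sup>m\<close> (open in the quotient iff open in \<open>\<real>\<^sup>m\<close>), and the torus as
  a measure space is the fundamental cell \<open>[0, 2\<pi>)\<^sup>m\<close>.
\<close>

definition int_vec :: "int ^ 'm \<Rightarrow> real ^ 'm" where
  "int_vec k = (\<chi> i. real_of_int (k $ i))"

definition two_pi_invariant :: "(real ^ 'm) set \<Rightarrow> bool" where
  "two_pi_invariant S \<longleftrightarrow> (\<forall>k :: int ^ 'm. (\<lambda>x. x + (2 * pi) *\<^sub>R int_vec k) ` S = S)"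

definition torus_cell :: "(real ^ 'm) set" where
  "torus_cell = {y. \<forall>i. 0 \<le> y $ i \<and> y $ i < 2 * pi}"

text \<open>
  The measure on \<open>\<real>\<^sup>n \<times> \<T>\<^sup>m\<close>. The values of a function at points \<open>(x, y)\<close> with \<open>y\<close> outside
  the cell are irrelevant, so no periodicity has to be imposed.
\<close>

definition cyl_measure :: "((real ^ 'n) \<times> (real ^ 'm)) measure" where
  "cyl_measure = lborel \<Otimes>\<^sub>M restrict_space lborel torus_cell"

definition freq_measure :: "((real ^ 'n) \<times> (int ^ 'm)) measure" where
  "freq_measure = lborel \<Otimes>\<^sub>M count_space UNIV"

definition freq_vec :: "(real ^ 'n) \<times> (int ^ 'm) \<Rightarrow> (real ^ 'n) \<times> (real ^ 'm)" where
  "freq_vec \<zeta> = (fst \<zeta>, int_vec (snd \<zeta>))"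

text \<open>Elements of \<open>L\<^sup>2\<close> are represented by functions, not by almost-everywhere classes.\<close>

definition L2 :: "'a measure \<Rightarrow> ('a \<Rightarrow> complex) set" where
  "L2 M = {f \<in> borel_measurable M. integrable M (\<lambda>z. (cmod (f z))\<^sup>2)}"

definition L2_norm :: "'a measure \<Rightarrow> ('a \<Rightarrow> complex) \<Rightarrow> real" where
  "L2_norm M f = sqrt (\<integral>z. (cmod (f z))\<^sup>2 \<partial>M)"

text \<open>
  A representative of the \<open>L\<^sup>2\<close>-limit of \<open>f R\<close> as \<open>R \<rightarrow> \<infinity>\<close>. Convergence is phrased with the
  nonnegative integral because \<^const>\<open>L2_norm\<close> is \<open>0\<close> on functions that are not square-integrable.
\<close>

definition L2_lim :: "'a measure \<Rightarrow> (real \<Rightarrow> 'a \<Rightarrow> complex) \<Rightarrow> 'a \<Rightarrow> complex" where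
  "L2_lim M f = (SOME g. g \<in> L2 M \<and>
     ((\<lambda>R. \<integral>\<^sup>+z. ennreal ((cmod (f R z - g z))\<^sup>2) \<partial>M) \<longlongrightarrow> 0) at_top)"

text \<open>
  The unitary Fourier transform \<open>L\<^sup>2(\<real>\<^sup>n \<times> \<T>\<^sup>m) \<rightarrow> L\<^sup>2(\<real>\<^sup>n \<times> \<int>\<^sup>m)\<close> and its inverse. The integrals
  need not converge on all of \<open>L\<^sup>2\<close>, hence the truncation to bounded sets and the \<open>L\<^sup>2\<close>-limit.
\<close>

definition fourier ::
    "((real ^ 'n) \<times> (real ^ 'm) \<Rightarrow> complex) \<Rightarrow> (real ^ 'n) \<times> (int ^ 'm) \<Rightarrow> complex" where
  "fourier u = L2_lim freq_measure (\<lambda>R \<zeta>.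
     complex_of_real ((1 / sqrt (2 * pi)) ^ (CARD('n) + CARD('m))) *
     (LINT z:{z. norm (fst z) \<le> R}|cyl_measure. cis (- (z \<bullet> freq_vec \<zeta>)) * u z))"

definition inv_fourier ::
    "((real ^ 'n) \<times> (int ^ 'm) \<Rightarrow> complex) \<Rightarrow> (real ^ 'n) \<times> (real ^ 'm) \<Rightarrow> complex" where
  "inv_fourier g = L2_lim cyl_measure (\<lambda>R z.
     complex_of_real ((1 / sqrt (2 * pi)) ^ (CARD('n) + CARD('m))) *
     (LINT \<zeta>:{\<zeta>. norm (freq_vec \<zeta>) \<le> R}|freq_measure. cis (z \<bullet> freq_vec \<zeta>) * g \<zeta>))"

definition schroedinger ::
    "real \<Rightarrow> ((real ^ 'n) \<times> (real ^ 'm) \<Rightarrow> complex) \<Rightarrow> (real ^ 'n) \<times> (real ^ 'm) \<Rightarrow> complex" where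
  "schroedinger t u =
     inv_fourier (\<lambda>\<zeta>. cis (- t * (norm (freq_vec \<zeta>))\<^sup>2) * fourier u \<zeta>)"

end

theory Submission
  imports Defs
begin

text \<open>
  Writing frequencies in \<open>\<real>\<^sup>n\<close> as \<open>\<xi> = \<theta> + j\<close> with \<open>\<theta> \<in> [0,1)\<^sup>n\<close> and \<open>j \<in> \<int>\<^sup>n\<close> decomposes a solution into
  solutions on the torus \<open>\<T>\<^sup>n\<^sup>+\<^sup>m\<close> with frequencies \<open>k + (\<theta>, 0)\<close>, \<open>k \<in> \<int>\<^sup>n\<^sup>+\<^sup>m\<close>. As \<open>\<Omega>\<^sub>1\<close> is periodic, Parseval's
  identity in \<open>\<theta>\<close> turns the integral over \<open>\<Omega>\<^sub>1\<close> into one over a cell of \<open>\<Omega>\<^sub>1\<close> and over \<open>\<theta>\<close>, so the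
  estimate reduces to observability on the torus from a small box, uniformly in \<open>\<theta>\<close>.

  For this, the space-time frequencies are the points \<open>(k, |k|\<^sup>2 + a \<cdot> k)\<close> of a paraboloid. A lower bound
  for exponential sums that holds for all pieces of the frequency set in windows of a large size \<open>M\<close>
  extends to the whole set (Kahane). A window around \<open>k\<^sub>0\<close> only contains \<open>k\<close> for which \<open>k - k\<^sub>0\<close> and
  \<open>(2 k\<^sub>0 + a) \<cdot> (k - k\<^sub>0)\<close> are bounded. If such \<open>k\<close> span the whole affine space, then \<open>2 k\<^sub>0 + a\<close> is bounded, so
  this happens for a number of \<open>k\<^sub>0\<close> that is bounded independently of \<open>a\<close>. The other windows have
  smaller affine dimension and are handled by induction; the exceptional frequencies are put back
  one by one (Haraux).
\<close>

section \<open>Exponential sums on cells\<close>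

text \<open>Uniformity in \<open>a\<close> rests on a cancellation. If \<open>k0\<close> and
  \<open>k1\<close> are both exceptional, then \<open>2 k0 + a\<close> and \<open>2 k1 + a\<close>
  pair with \<open>k1 - k0\<close> to at most a constant times \<open>|k1 - k0|\<close>, while the
  two pairings differ by \<open>2 |k1 - k0|^2\<close>. So the exceptional points lie in a ball of
  fixed radius, whose centre may move with \<open>a\<close>, and only their number enters when they
  are put back. No compactness in \<theta> is used. When the frequency set spans a proper affine
  subspace, only the component of \<open>2 k0 + a\<close> along it is controlled, and the same
  cancellation suffices. Each localization or insertion enlarges the observation cube, but by an
  arbitrarily small amount; this is why small boxes and short times are allowed. The constants do
  not depend on the finite frequency set, so bounded frequencies come first and general data follow
  by \<open>L2\<close> limits. Since the transforms are chosen representatives of such limits, crude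
  factors such as 2 replace exact unitarity there.\<close>

definition int_lattice :: "'e::euclidean_space set" where
  "int_lattice = {k. \<forall>b\<in>Basis. k \<bullet> b \<in> \<int>}"

definition prod_cell :: "real set \<Rightarrow> 'e::euclidean_space set" where
  "prod_cell I = {x. \<forall>b\<in>Basis. x \<bullet> b \<in> I}"

lemma int_lattice_add: "k \<in> int_lattice \<Longrightarrow> l \<in> int_lattice \<Longrightarrow> k + l \<in> int_lattice"
  and int_lattice_diff: "k \<in> int_lattice \<Longrightarrow> l \<in> int_lattice \<Longrightarrow> k - l \<in> int_lattice"
  and int_lattice_uminus: "k \<in> int_lattice \<Longrightarrow> - k \<in> int_lattice"
  and int_lattice_0: "0 \<in> int_lattice"
  by (auto simp: int_lattice_def inner_add_left inner_diff_left)

lemma int_lattice_inner: "k \<in> int_lattice \<Longrightarrow> l \<in> int_lattice \<Longrightarrow> k \<bullet> l \<in> \<int>"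
  unfolding int_lattice_def by (subst euclidean_inner) (auto intro!: Ints_sum Ints_mult)

lemma int_lattice_eqI:
  assumes "k \<in> int_lattice" "l \<in> int_lattice" "\<And>b. b \<in> Basis \<Longrightarrow> \<bar>(k - l) \<bullet> b\<bar> < 1"
  shows "k = l"
proof (rule euclidean_eqI)
  fix b :: 'a assume b: "b \<in> Basis"
  have "(k - l) \<bullet> b \<in> \<int>" using int_lattice_diff[OF assms(1,2)] b by (auto simp: int_lattice_def)
  with assms(3)[OF b] have "(k - l) \<bullet> b = 0" by (metis Ints_nonzero_abs_ge1 not_less)
  then show "k \<bullet> b = l \<bullet> b" by (simp add: inner_diff_left)
qed

lemma finite_int_lattice_bounded: "finite {k \<in> int_lattice. norm k \<le> r}"
proof -
  let ?I = "real_of_int ` {-\<lceil>r\<rceil>..\<lceil>r\<rceil>}"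
  have "{k \<in> int_lattice. norm k \<le> r} \<subseteq> (\<lambda>f. \<Sum>b\<in>Basis. f b *\<^sub>R b) ` PiE (Basis::'a set) (\<lambda>_. ?I)"
  proof
    fix k :: 'a assume k: "k \<in> {k \<in> int_lattice. norm k \<le> r}"
    have "k \<bullet> b \<in> ?I" if b: "b \<in> Basis" for b
    proof -
      obtain n where n: "k \<bullet> b = of_int n" using k b by (auto simp: int_lattice_def elim: Ints_cases)
      have "\<bar>real_of_int n\<bar> \<le> r" using Basis_le_norm[OF b, of k] k n by auto
      then have "n \<in> {-\<lceil>r\<rceil>..\<lceil>r\<rceil>}" by (auto simp: abs_le_iff) linarith+
      then show ?thesis using n by auto
    qed
    then have "restrict (\<lambda>b. k \<bullet> b) Basis \<in> PiE Basis (\<lambda>_. ?I)" by auto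
    moreover have "k = (\<Sum>b\<in>Basis. restrict (\<lambda>b. k \<bullet> b) Basis b *\<^sub>R b)"
      by (simp add: euclidean_representation)
    ultimately show "k \<in> (\<lambda>f. \<Sum>b\<in>Basis. f b *\<^sub>R b) ` PiE (Basis::'a set) (\<lambda>_. ?I)" by blast
  qed
  then show ?thesis by (rule finite_subset) (intro finite_imageI finite_PiE, auto)
qed

lemma countable_int_lattice: "countable (int_lattice :: 'e::euclidean_space set)"
proof -
  have "(int_lattice :: 'e set) = (\<Union>n::nat. {k \<in> int_lattice. norm k \<le> real n})"
    using real_arch_simple by auto
  moreover have "countable \<dots>"
    by (rule countable_UN[OF _ countable_finite[OF finite_int_lattice_bounded]]) simp
  ultimately show ?thesis by simp
qed

lemma sets_prod_cell [measurable]: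
  assumes I [measurable]: "I \<in> sets borel"
  shows "(prod_cell I :: 'e::euclidean_space set) \<in> sets borel"
proof -
  have "(\<lambda>x::'e. x \<bullet> b) -` I \<in> sets borel" for b
    using measurable_sets_borel[OF borel_measurable_inner[OF measurable_ident_sets[OF refl] borel_measurable_const], of I b] I
    by simp
  then have "(\<Inter>b\<in>Basis. (\<lambda>x::'e. x \<bullet> b) -` I) \<in> sets borel"
    by (intro sets.finite_INT) auto
  also have "(\<Inter>b\<in>Basis. (\<lambda>x::'e. x \<bullet> b) -` I) = prod_cell I"
    by (auto simp: prod_cell_def)
  finally show ?thesis .
qed

lemma borel_measurable_cis [measurable (raw)]:
  "f \<in> borel_measurable M \<Longrightarrow> (\<lambda>x. cis (f x)) \<in> borel_measurable M"
  by (rule borel_measurable_continuous_on[where f = cis]) (intro continuous_intros)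

section \<open>Orthogonality of characters on product cells\<close>

lemma integral_lborel_prod:
  fixes f :: "'e::euclidean_space \<Rightarrow> real \<Rightarrow> complex"
  assumes f: "\<And>b. b \<in> Basis \<Longrightarrow> integrable lborel (f b)"
  shows "(LINT x|lborel. (\<Prod>b\<in>Basis. f b (x \<bullet> b))) = (\<Prod>b\<in>Basis. (LINT s|lborel. f b s))"
proof -
  interpret product_sigma_finite "\<lambda>_::'e. lborel :: real measure" ..
  have [measurable]: "f b \<in> borel_measurable borel" if "b \<in> Basis" for b
    using f[OF that] by auto
  have "(LINT x|lborel. (\<Prod>b\<in>Basis. f b (x \<bullet> b))) =
      (LINT y|(\<Pi>\<^sub>M b\<in>(Basis::'e set). lborel). (\<Prod>b\<in>Basis. f b ((\<Sum>b\<in>Basis. y b *\<^sub>R b) \<bullet> b)))"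
    by (subst lborel_eq, rule integral_distr) auto
  also have "\<dots> = (LINT y|(\<Pi>\<^sub>M b\<in>(Basis::'e set). lborel). (\<Prod>b\<in>Basis. f b (y b)))"
    by (intro Bochner_Integration.integral_cong prod.cong) auto
  also have "\<dots> = (\<Prod>b\<in>Basis. (LINT s|lborel. f b s))"
    by (rule product_integral_prod) (auto simp: f)
  finally show ?thesis .
qed

lemma prod_cis: "finite B \<Longrightarrow> (\<Prod>b\<in>B. cis (f b)) = cis (\<Sum>b\<in>B. f b)"
  by (induction B rule: finite_induct) (auto simp: cis_mult)

text \<open>The character factors over the coordinates. One-dimensional orthogonality is a
  hypothesis so that closed and half-open intervals and both scalings, \<open>\<tau> = 1\<close> and
  \<open>\<tau> = 2 * pi\<close>, are served at once.\<close>

lemma integral_prod_cell_cis: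
  fixes k :: "'e::euclidean_space"
  assumes k: "k \<in> int_lattice" and [measurable]: "I \<in> sets borel" and I: "emeasure lborel I < \<infinity>"
    and ortho: "\<And>n::int. (LINT s:I|lborel. cis (\<tau> * of_int n * s)) = (if n = 0 then of_real L else 0)"
  shows "(LINT x:prod_cell I|lborel. cis (\<tau> * (k \<bullet> x))) = (if k = 0 then of_real L ^ DIM('e) else 0)"
proof -
  have int: "integrable lborel (\<lambda>s. indicator I s *\<^sub>R cis (\<tau> * (k \<bullet> b) * s))" for b
    using I by (intro integrableI_bounded_set_indicator[where B=1]) auto
  have "(LINT x:prod_cell I|lborel. cis (\<tau> * (k \<bullet> x))) =
     (LINT x|lborel. (\<Prod>b\<in>Basis. indicator I (x \<bullet> b) *\<^sub>R cis (\<tau> * (k \<bullet> b) * (x \<bullet> b))))"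
    unfolding set_lebesgue_integral_def
  proof (intro Bochner_Integration.integral_cong refl)
    fix x :: 'e
    have "(\<Prod>b\<in>Basis. cis (\<tau> * (k \<bullet> b) * (x \<bullet> b))) = cis (\<tau> * (k \<bullet> x))"
      by (simp add: prod_cis euclidean_inner[of k x] sum_distrib_left mult.assoc)
    moreover have "(\<Prod>b\<in>Basis. indicator I (x \<bullet> b) :: real) = indicator (prod_cell I) x"
      by (auto simp: indicator_def prod_cell_def)
    moreover have "(\<Prod>b\<in>Basis. indicator I (x \<bullet> b) *\<^sub>R cis (\<tau> * (k \<bullet> b) * (x \<bullet> b))) =
       (\<Prod>b\<in>Basis. indicator I (x \<bullet> b)) *\<^sub>R (\<Prod>b\<in>Basis. cis (\<tau> * (k \<bullet> b) * (x \<bullet> b)))"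
      by (simp add: scaleR_conv_of_real prod.distrib)
    ultimately show "indicator (prod_cell I) x *\<^sub>R cis (\<tau> * (k \<bullet> x)) =
       (\<Prod>b\<in>Basis. indicator I (x \<bullet> b) *\<^sub>R cis (\<tau> * (k \<bullet> b) * (x \<bullet> b)))" by simp
  qed
  also have "\<dots> = (\<Prod>b\<in>Basis. (LINT s:I|lborel. cis (\<tau> * (k \<bullet> b) * s)))"
    unfolding set_lebesgue_integral_def by (rule integral_lborel_prod) (rule int)
  also have "\<dots> = (\<Prod>b\<in>Basis. if k \<bullet> b = 0 then of_real L else 0)"
  proof (intro prod.cong refl)
    fix b :: 'e assume "b \<in> Basis"
    then obtain n where "k \<bullet> b = of_int n" using k by (auto simp: int_lattice_def elim: Ints_cases)
    then show "(LINT s:I|lborel. cis (\<tau> * (k \<bullet> b) * s)) = (if k \<bullet> b = 0 then of_real L else 0)"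
      using ortho[of n] by auto
  qed
  also have "\<dots> = (if k = 0 then of_real L ^ DIM('e) else 0)"
    by (auto simp: euclidean_eq_iff[of k 0] intro: prod_zero)
  finally show ?thesis .
qed

lemma has_integral_cis:
  fixes w :: real
  assumes lu: "l \<le> u" and w: "w \<noteq> 0"
  shows "((\<lambda>s. cis (w * s)) has_integral (cis (w * u) - cis (w * l)) / (\<i> * w)) {l..u}"
proof -
  have "((\<lambda>s. cis (w * s)) has_integral (cis (w * u) / (\<i> * w) - cis (w * l) / (\<i> * w))) {l..u}"
  proof (rule fundamental_theorem_of_calculus[OF lu])
    fix s :: real
    have "((\<lambda>z. exp (\<i> * of_real w * z) / (\<i> * of_real w)) has_field_derivative exp (\<i> * of_real w * of_real s)) (at (of_real s))"
      using w by (auto intro!: derivative_eq_intros)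
    from has_vector_derivative_real_field[OF this]
    show "((\<lambda>s. cis (w * s) / (\<i> * w)) has_vector_derivative cis (w * s)) (at s within {l..u})"
      by (simp add: cis_conv_exp mult.assoc)
  qed
  then show ?thesis by (simp add: diff_divide_distrib)
qed

lemma integral_cis_period:
  fixes n :: int
  assumes "\<tau> > 0" "\<tau> * (u - l) = 2 * pi"
  shows "(LINT s:{l..u}|lborel. cis (\<tau> * of_int n * s)) = (if n = 0 then of_real (u - l) else 0)"
    and "(LINT s:{l..<u}|lborel. cis (\<tau> * of_int n * s)) = (if n = 0 then of_real (u - l) else 0)"
proof -
  have lu: "l \<le> u" using assms pi_gt_zero by (metis less_eq_real_def diff_ge_0_iff_ge mult_pos_neg not_less mult_2 add_pos_pos order_less_trans linorder_le_cases)
  have c: "continuous_on {l..u} (\<lambda>s. cis (\<tau> * of_int n * s))" by (intro continuous_intros)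
  have 1: "(LINT s:{l..u}|lborel. cis (\<tau> * of_int n * s)) = integral {l..u} (\<lambda>s. cis (\<tau> * of_int n * s))"
    using borel_integrable_compact[OF compact_Icc c]
    by (intro set_borel_integral_eq_integral) (auto simp: set_integrable_def indicator_scaleR_eq_if)
  have 2: "integral {l..u} (\<lambda>s. cis (\<tau> * of_int n * s)) = (if n = 0 then of_real (u - l) else 0)"
  proof (cases "n = 0")
    case True
    then show ?thesis using lu by (simp add: scaleR_conv_of_real)
  next
    case False
    define w where "w = \<tau> * of_int n"
    have w: "w \<noteq> 0" using False assms by (simp add: w_def)
    have "w * (u - l) = (\<tau> * (u - l)) * of_int n" by (simp add: w_def)
    then have "w * u = w * l + 2 * pi * of_int n" unfolding assms(2) by (simp add: algebra_simps)
    then have "cis (w * u) = cis (w * l)"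
      by (metis cis_mult cis_multiple_2pi Ints_of_int mult.right_neutral mult.commute)
    then show ?thesis using False integral_unique[OF has_integral_cis[OF lu w]] by (simp add: w_def)
  qed
  show a: "(LINT s:{l..u}|lborel. cis (\<tau> * of_int n * s)) = (if n = 0 then of_real (u - l) else 0)"
    using 1 2 by simp
  have "(LINT s:{l..<u}|lborel. cis (\<tau> * of_int n * s)) = (LINT s:{l..u}|lborel. cis (\<tau> * of_int n * s))"
    unfolding set_lebesgue_integral_def
  proof (rule integral_cong_AE)
    show "AE s in lborel. indicator {l..<u} s *\<^sub>R cis (\<tau> * of_int n * s) = indicator {l..u} s *\<^sub>R cis (\<tau> * of_int n * s)"
      using AE_lborel_singleton[of u] by eventually_elim (auto simp: indicator_def)
  qed measurable
  then show "(LINT s:{l..<u}|lborel. cis (\<tau> * of_int n * s)) = (if n = 0 then of_real (u - l) else 0)"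
    using a by simp
qed

text \<open>Pythagoras with the square completed in the coefficients. It is used in three ways:
  \<open>f = 0\<close> gives Parseval for finite sums, \<open>a i = c i / N\<close> gives Bessel's
  inequality, and arbitrary \<open>a\<close> gives the best approximation property behind
  completeness.\<close>

lemma integral_orthogonal_expansion:
  fixes f :: "'a \<Rightarrow> complex" and e :: "'i \<Rightarrow> 'a \<Rightarrow> complex"
  assumes K: "finite K" and N: "N > 0"
    and ff: "integrable M (\<lambda>x. (cmod (f x))\<^sup>2)"
    and fe: "\<And>i. i \<in> K \<Longrightarrow> integrable M (\<lambda>x. f x * cnj (e i x))"
    and ee: "\<And>i j. i \<in> K \<Longrightarrow> j \<in> K \<Longrightarrow> integrable M (\<lambda>x. e i x * cnj (e j x))"
    and ortho: "\<And>i j. i \<in> K \<Longrightarrow> j \<in> K \<Longrightarrow> (LINT x|M. e i x * cnj (e j x)) = (if i = j then of_real N else 0)"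
  defines "c \<equiv> \<lambda>i. LINT x|M. f x * cnj (e i x)"
  shows "(LINT x|M. (cmod (f x - (\<Sum>i\<in>K. a i * e i x)))\<^sup>2) =
    (LINT x|M. (cmod (f x))\<^sup>2) - (\<Sum>i\<in>K. (cmod (c i))\<^sup>2) / N + (\<Sum>i\<in>K. (cmod (of_real N * a i - c i))\<^sup>2) / N"
proof -
  have ff': "integrable M (\<lambda>x. f x * cnj (f x))"
    using integrable_of_real[OF ff, where 'a = complex] by (simp only: complex_norm_square)
  have ef: "integrable M (\<lambda>x. e i x * cnj (f x))" if "i \<in> K" for i
    using integrable_cnj[OF fe[OF that]] by (simp add: mult.commute)
  have int_ef: "(LINT x|M. e i x * cnj (f x)) = cnj (c i)" if "i \<in> K" for i
    unfolding c_def by (subst Bochner_Integration.integral_cnj[symmetric]) (simp add: mult.commute)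
  have "complex_of_real (LINT x|M. (cmod (f x - (\<Sum>i\<in>K. a i * e i x)))\<^sup>2) =
     (LINT x|M. (f x - (\<Sum>i\<in>K. a i * e i x)) * cnj (f x - (\<Sum>i\<in>K. a i * e i x)))"
    by (simp only: integral_complex_of_real[symmetric] complex_norm_square)
  also have "\<dots> = (LINT x|M. f x * cnj (f x) - (\<Sum>i\<in>K. cnj (a i) * (f x * cnj (e i x)))
       - (\<Sum>i\<in>K. a i * (e i x * cnj (f x))) + (\<Sum>i\<in>K. \<Sum>j\<in>K. a i * cnj (a j) * (e i x * cnj (e j x))))"
  proof (intro Bochner_Integration.integral_cong refl)
    fix x
    have "(\<Sum>i\<in>K. a i * e i x) * cnj (\<Sum>j\<in>K. a j * e j x) =
      (\<Sum>i\<in>K. \<Sum>j\<in>K. a i * cnj (a j) * (e i x * cnj (e j x)))"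
      by (simp add: sum_product mult_ac)
    moreover have "f x * cnj (\<Sum>j\<in>K. a j * e j x) = (\<Sum>i\<in>K. cnj (a i) * (f x * cnj (e i x)))"
      and "(\<Sum>i\<in>K. a i * e i x) * cnj (f x) = (\<Sum>i\<in>K. a i * (e i x * cnj (f x)))"
      by (simp_all add: sum_distrib_left sum_distrib_right mult_ac)
    moreover have "(p - q) * cnj (p - q) = p * cnj p - p * cnj q - q * cnj p + q * cnj q" for p q :: complex
      by (simp add: algebra_simps)
    ultimately show "(f x - (\<Sum>i\<in>K. a i * e i x)) * cnj (f x - (\<Sum>i\<in>K. a i * e i x)) =
      f x * cnj (f x) - (\<Sum>i\<in>K. cnj (a i) * (f x * cnj (e i x)))
       - (\<Sum>i\<in>K. a i * (e i x * cnj (f x))) + (\<Sum>i\<in>K. \<Sum>j\<in>K. a i * cnj (a j) * (e i x * cnj (e j x)))"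
      by presburger
  qed
  also have "\<dots> = (LINT x|M. f x * cnj (f x)) - (\<Sum>i\<in>K. cnj (a i) * c i)
       - (\<Sum>i\<in>K. a i * cnj (c i)) + (\<Sum>i\<in>K. \<Sum>j\<in>K. a i * cnj (a j) * (if i = j then of_real N else 0))"
    using ff' fe ef ee by (simp add: int_ef ortho c_def)
  also have "(\<Sum>i\<in>K. \<Sum>j\<in>K. a i * cnj (a j) * (if i = j then of_real N else 0)) = (\<Sum>i\<in>K. of_real N * (a i * cnj (a i)))"
    using K by (simp add: if_distrib sum.delta cong: if_cong) (simp add: mult.commute)
  also have "(LINT x|M. f x * cnj (f x)) = of_real (LINT x|M. (cmod (f x))\<^sup>2)"
    by (simp only: integral_complex_of_real[symmetric] complex_norm_square)
  also have "of_real (LINT x|M. (cmod (f x))\<^sup>2) - (\<Sum>i\<in>K. cnj (a i) * c i)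
       - (\<Sum>i\<in>K. a i * cnj (c i)) + (\<Sum>i\<in>K. of_real N * (a i * cnj (a i))) =
     of_real ((LINT x|M. (cmod (f x))\<^sup>2) - (\<Sum>i\<in>K. (cmod (c i))\<^sup>2) / N + (\<Sum>i\<in>K. (cmod (of_real N * a i - c i))\<^sup>2) / N)"
  proof -
    \<comment> \<open>Completing the square in \<open>a i\<close>.\<close>
    have "of_real ((cmod (of_real N * a i - c i))\<^sup>2 / N - (cmod (c i))\<^sup>2 / N) =
      of_real N * (a i * cnj (a i)) - a i * cnj (c i) - cnj (a i) * c i" for i
      unfolding of_real_diff of_real_divide complex_norm_square using N by (simp add: field_simps)
    note * = this
    have "(\<Sum>i\<in>K. of_real ((cmod (of_real N * a i - c i))\<^sup>2 / N - (cmod (c i))\<^sup>2 / N)) =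
      (\<Sum>i\<in>K. of_real N * (a i * cnj (a i))) - (\<Sum>i\<in>K. a i * cnj (c i)) - (\<Sum>i\<in>K. cnj (a i) * c i)"
      unfolding * by (simp add: sum_subtractf)
    then show ?thesis by (simp add: sum_subtractf sum_divide_distrib algebra_simps)
  qed
  finally show ?thesis by (simp only: of_real_eq_iff)
qed

lemma bounded_prod_cell:
  assumes "bounded I"
  shows "bounded (prod_cell I :: 'e::euclidean_space set)"
proof -
  obtain r where r: "\<And>s. s \<in> I \<Longrightarrow> \<bar>s\<bar> \<le> r" using assms by (auto simp: bounded_iff)
  have "prod_cell I \<subseteq> (cbox (- (r *\<^sub>R One)) (r *\<^sub>R One) :: 'e set)"
    using r by (force simp: prod_cell_def mem_box abs_le_iff)
  then show ?thesis by (rule bounded_subset[OF bounded_cbox])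
qed

lemma emeasure_prod_cell_finite: "bounded I \<Longrightarrow> emeasure lborel (prod_cell I :: 'e::euclidean_space set) < \<infinity>"
  by (intro emeasure_bounded_finite bounded_prod_cell)

lemma parseval_finite_prod_cell:
  fixes K :: "'e::euclidean_space set"
  assumes K: "finite K" "K \<subseteq> int_lattice" and [measurable]: "I \<in> sets borel" and I: "bounded I" and L: "L > 0"
    and ortho: "\<And>n::int. (LINT s:I|lborel. cis (\<tau> * of_int n * s)) = (if n = 0 then of_real L else 0)"
  shows "(LINT x:prod_cell I|lborel. (cmod (\<Sum>k\<in>K. a k * cis (\<tau> * (k \<bullet> x))))\<^sup>2) =
    L ^ DIM('e) * (\<Sum>k\<in>K. (cmod (a k))\<^sup>2)"
proof -
  let ?e = "\<lambda>k x. indicator (prod_cell I) x *\<^sub>R cis (\<tau> * (k \<bullet> x))"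
  have mul: "?e k x * cnj (?e l x) = indicator (prod_cell I) x *\<^sub>R cis (\<tau> * ((k - l) \<bullet> x))" for k l x
    by (simp add: indicator_def cis_cnj cis_mult inner_diff_left right_diff_distrib)
  have fin: "emeasure lborel I < \<infinity>"
    using I by (metis emeasure_bounded_finite)
  note finc = emeasure_prod_cell_finite[OF I, where 'e = 'e]
  \<comment> \<open>The expansion with \<open>f = 0\<close>: all coefficients \<open>c\<close>
    vanish and only the last sum survives.\<close>
  have "(LINT x|lborel. (cmod (0 - (\<Sum>k\<in>K. a k * ?e k x)))\<^sup>2) =
    (LINT x|(lborel::'e measure). (cmod (0::complex))\<^sup>2) - (\<Sum>k\<in>K. (cmod (LINT x|lborel. 0 * cnj (?e k x)))\<^sup>2) / L ^ DIM('e)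
     + (\<Sum>k\<in>K. (cmod (of_real (L ^ DIM('e)) * a k - (LINT x|lborel. 0 * cnj (?e k x))))\<^sup>2) / L ^ DIM('e)"
  proof (rule integral_orthogonal_expansion)
    fix k l assume kl: "k \<in> K" "l \<in> K"
    show "integrable lborel (\<lambda>x. ?e k x * cnj (?e l x))"
      unfolding mul using finc by (intro integrableI_bounded_set_indicator[where B=1]) auto
    have "k - l \<in> int_lattice" using kl K by (auto intro: int_lattice_diff)
    from integral_prod_cell_cis[OF this _ fin ortho]
    show "(LINT x|lborel. ?e k x * cnj (?e l x)) = (if k = l then of_real (L ^ DIM('e)) else 0)"
      unfolding mul by (simp add: set_lebesgue_integral_def)
  qed (use K L in auto)
  also have "\<dots> = L ^ DIM('e) * (\<Sum>k\<in>K. (cmod (a k))\<^sup>2)"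
    using L by (simp add: norm_mult norm_power power_mult_distrib power2_eq_square sum_distrib_left sum_divide_distrib mult_ac)
  finally have 1: "(LINT x|lborel. (cmod (0 - (\<Sum>k\<in>K. a k * ?e k x)))\<^sup>2) = \<dots>" .
  have "(cmod (0 - (\<Sum>k\<in>K. a k * ?e k x)))\<^sup>2 = indicator (prod_cell I) x *\<^sub>R (cmod (\<Sum>k\<in>K. a k * cis (\<tau> * (k \<bullet> x))))\<^sup>2" for x
    by (simp add: indicator_def)
  with 1 show ?thesis by (simp add: set_lebesgue_integral_def)
qed

section \<open>Observable sets of frequencies\<close>

definition trig_sum :: "'e::euclidean_space set \<Rightarrow> ('e \<Rightarrow> complex) \<Rightarrow> 'e \<Rightarrow> complex" where
  "trig_sum A c X = (\<Sum>l\<in>A. c l * cis (l \<bullet> X))"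

definition cube :: "real \<Rightarrow> 'e::euclidean_space set" where
  "cube e = cbox (- (e *\<^sub>R One)) (e *\<^sub>R One)"

definition energy :: "real \<Rightarrow> ('e::euclidean_space \<Rightarrow> complex) \<Rightarrow> real" where
  "energy e f = integral (cube e) (\<lambda>X. (cmod (f X))\<^sup>2)"

definition observable :: "'e::euclidean_space set \<Rightarrow> real \<Rightarrow> real \<Rightarrow> bool" where
  "observable A e C \<longleftrightarrow> (\<forall>c. (\<Sum>l\<in>A. (cmod (c l))\<^sup>2) \<le> C * energy e (trig_sum A c))"

text \<open>The upper counterpart of \<open>observable\<close>. It controls the part of a sum that
  is discarded when the sum is cut to a window, and the known part when a single missing coefficient
  is recovered.\<close>

definition bessel :: "'e::euclidean_space set \<Rightarrow> real \<Rightarrow> real \<Rightarrow> bool" where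
  "bessel A e B \<longleftrightarrow> (\<forall>c. energy e (trig_sum A c) \<le> B * (\<Sum>l\<in>A. (cmod (c l))\<^sup>2))"

lemma mem_cube: "X \<in> cube e \<longleftrightarrow> (\<forall>b\<in>Basis. \<bar>X \<bullet> b\<bar> \<le> e)"
  by (auto simp: cube_def mem_box abs_le_iff)

lemma cube_mono: "e \<le> e' \<Longrightarrow> cube e \<subseteq> cube e'"
  by (force simp: mem_cube)

lemma continuous_on_trig_sum [continuous_intros]:
  "continuous_on S g \<Longrightarrow> continuous_on S (\<lambda>x. trig_sum A c (g x))"
  unfolding trig_sum_def by (intro continuous_intros)

lemma integrable_on_cube:
  fixes f :: "'e::euclidean_space \<Rightarrow> real"
  shows "continuous_on UNIV f \<Longrightarrow> f integrable_on cube e"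
  unfolding cube_def by (rule integrable_continuous) (rule continuous_on_subset, auto)

text \<open>If the square is not integrable, its integral is 0 by convention, so no regularity of
  \<open>f\<close> is assumed.\<close>

lemma energy_nonneg: "0 \<le> energy e f"
  unfolding energy_def
  by (cases "(\<lambda>X. (cmod (f X))\<^sup>2) integrable_on cube e")
    (auto intro: Henstock_Kurzweil_Integration.integral_nonneg simp: not_integrable_integral)

lemma energy_mono:
  assumes "continuous_on UNIV f" "e \<le> e'"
  shows "energy e f \<le> energy e' f"
  unfolding energy_def using assms cube_mono[OF assms(2)]
  by (intro integral_subset_le integrable_on_cube continuous_intros) auto

lemma energy_shift_le:
  assumes f: "continuous_on UNIV f" and v: "\<And>b. b \<in> Basis \<Longrightarrow> \<bar>v \<bullet> b\<bar> \<le> h"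
  shows "energy e (\<lambda>X. f (v + X)) \<le> energy (e + h) f"
proof -
  have "energy e (\<lambda>X. f (v + X)) = integral (cbox (- (e *\<^sub>R One) + v) (e *\<^sub>R One + v)) (\<lambda>X. (cmod (f X))\<^sup>2)"
    unfolding energy_def cube_def
    using integral_shift_cbox_plus[of "- (e *\<^sub>R One)" "e *\<^sub>R One" "\<lambda>X. (cmod (f X))\<^sup>2" v] by (simp add: o_def)
  also have "\<dots> \<le> energy (e + h) f"
    unfolding energy_def
  proof (rule integral_subset_le)
    show "cbox (- (e *\<^sub>R One) + v) (e *\<^sub>R One + v) \<subseteq> cube (e + h)"
    proof
      fix x assume x: "x \<in> cbox (- (e *\<^sub>R One) + v) (e *\<^sub>R One + v)"
      have "\<bar>x \<bullet> b\<bar> \<le> e + h" if b: "b \<in> Basis" for b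
        using x v[OF b] b by (auto simp: mem_box inner_add_left inner_diff_left abs_le_iff dest!: bspec[of _ _ b])
      then show "x \<in> cube (e + h)" by (simp add: mem_cube)
    qed
    show "(\<lambda>X. (cmod (f X))\<^sup>2) integrable_on cbox (- (e *\<^sub>R One) + v) (e *\<^sub>R One + v)"
      using f by (intro integrable_continuous continuous_intros) (auto intro: continuous_on_subset)
  qed (use f in \<open>auto intro!: integrable_on_cube continuous_intros\<close>)
  finally show ?thesis .
qed

lemma cmod_add_squared_le: "(cmod (u + v))\<^sup>2 \<le> 2 * (cmod u)\<^sup>2 + 2 * (cmod v)\<^sup>2"
proof -
  have "(cmod (u + v))\<^sup>2 \<le> (cmod u + cmod v)\<^sup>2"
    by (intro power_mono norm_triangle_ineq) auto
  also have "\<dots> \<le> 2 * (cmod u)\<^sup>2 + 2 * (cmod v)\<^sup>2"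
    using zero_le_power2[of "cmod u - cmod v"] by (simp add: power2_eq_square algebra_simps)
  finally show ?thesis .
qed

lemma cmod_diff_squared_le: "(cmod (u - v))\<^sup>2 \<le> 2 * (cmod u)\<^sup>2 + 2 * (cmod v)\<^sup>2"
  using cmod_add_squared_le[of u "- v"] by simp

lemma energy_diff_le:
  assumes "continuous_on UNIV f" "continuous_on UNIV g"
  shows "energy e (\<lambda>X. f X - g X) \<le> 2 * energy e f + 2 * energy e g"
proof -
  have "energy e (\<lambda>X. f X - g X) \<le> integral (cube e) (\<lambda>X. 2 * (cmod (f X))\<^sup>2 + 2 * (cmod (g X))\<^sup>2)"
    unfolding energy_def using assms
    by (intro integral_le integrable_on_cube continuous_intros cmod_diff_squared_le) auto
  also have "\<dots> = 2 * energy e f + 2 * energy e g"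
    unfolding energy_def using assms
    by (subst Henstock_Kurzweil_Integration.integral_add) (auto intro!: integrable_on_cube continuous_intros)
  finally show ?thesis .
qed

text \<open>Extending coefficients by zero lets inequalities for \<open>A\<close> pass to its
  subsets with the same constant.\<close>

lemma trig_sum_subset:
  assumes "finite A" "A' \<subseteq> A"
  shows "trig_sum A' c = trig_sum A (\<lambda>l. if l \<in> A' then c l else 0)"
  using assms by (auto simp: trig_sum_def fun_eq_iff if_distrib[of "\<lambda>x. x * _"] sum.If_cases Int_absorb1 cong: if_cong)

lemma sum_cmod_subset:
  assumes "finite A" "A' \<subseteq> A"
  shows "(\<Sum>l\<in>A'. (cmod (c l))\<^sup>2) = (\<Sum>l\<in>A. (cmod (if l \<in> A' then c l else 0))\<^sup>2)"
proof -
  have "(\<Sum>l\<in>A. (cmod (if l \<in> A' then c l else 0))\<^sup>2) = (\<Sum>l\<in>A. if l \<in> A' then (cmod (c l))\<^sup>2 else 0)"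
    by (intro sum.cong) auto
  then show ?thesis using assms by (simp add: sum.If_cases Int_absorb1)
qed

lemma observable_subset:
  assumes "observable A e C" "finite A" "A' \<subseteq> A"
  shows "observable A' e C"
  unfolding observable_def trig_sum_subset[OF assms(2,3)] sum_cmod_subset[OF assms(2,3)]
  using assms(1) by (auto simp: observable_def)

lemma bessel_subset:
  assumes "bessel A e B" "finite A" "A' \<subseteq> A"
  shows "bessel A' e B"
  unfolding bessel_def trig_sum_subset[OF assms(2,3)] sum_cmod_subset[OF assms(2,3)]
  using assms(1) by (auto simp: bessel_def)

lemma observable_mono:
  assumes "observable A e C" "e \<le> e'" "C \<le> C'" "0 \<le> C"
  shows "observable A e' C'"
proof -
  have "C * energy e (trig_sum A c) \<le> C' * energy e' (trig_sum A c)" for c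
    using assms by (intro mult_mono energy_mono energy_nonneg continuous_intros) auto
  then show ?thesis using assms(1) by (fastforce simp: observable_def intro: order_trans)
qed

lemma bessel_mono:
  assumes "bessel A e' B" "e \<le> e'"
  shows "bessel A e B"
  unfolding bessel_def
proof
  fix c
  have "energy e (trig_sum A c) \<le> energy e' (trig_sum A c)"
    by (intro energy_mono assms continuous_intros)
  also have "\<dots> \<le> B * (\<Sum>l\<in>A. (cmod (c l))\<^sup>2)" using assms by (simp add: bessel_def)
  finally show "energy e (trig_sum A c) \<le> B * (\<Sum>l\<in>A. (cmod (c l))\<^sup>2)" .
qed

lemma observable_empty: "0 \<le> C \<Longrightarrow> observable {} e C"
  by (simp add: observable_def energy_nonneg)

section \<open>The cardinal sine and tails of inverse squares\<close>

definition sinc :: "real \<Rightarrow> real" where "sinc x = (if x = 0 then 1 else sin x / x)"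

text \<open>The sharp constant is \<open>2 / pi\<close>; a quarter is enough. On
  \<open>[0, 1]\<close> the derivative of sine is at least \<open>cos (pi / 3) = 1 / 2\<close>;
  beyond 1 monotonicity gives at least \<open>sin 1 \<ge> 1 / 2\<close>, while
  \<open>x \<le> pi / 2 < 2\<close>.\<close>

lemma sinc_lower: "\<bar>x\<bar> \<le> pi / 2 \<Longrightarrow> 1 / 4 \<le> sinc x"
proof -
  have small: "y / 2 \<le> sin y" if y: "0 \<le> y" "y \<le> 1" for y :: real
  proof (cases "y = 0")
    case False
    then have "0 < y" using y by simp
    then obtain z where z: "0 < z" "z < y" "sin y - sin 0 = (y - 0) * cos z"
      using MVT2[of 0 y sin cos] by (auto intro: derivative_eq_intros)
    have "cos (pi / 3) \<le> cos z"
      using z y pi_gt3 by (intro cos_monotone_0_pi_le) auto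
    then have "1 / 2 \<le> cos z" by (simp add: cos_60)
    then show ?thesis using z \<open>0 < y\<close> mult_left_mono[of "1/2" "cos z" y] by simp
  qed simp
  have pos: "x / 4 \<le> sin x" if x: "0 < x" "x \<le> pi / 2" for x :: real
  proof (cases "x \<le> 1")
    case True
    then show ?thesis using small[of x] x by simp
  next
    case False
    then have "sin 1 \<le> sin x" using x by (intro sin_monotone_2pi_le) auto
    then show ?thesis using small[of 1] x pi_less_4 by simp
  qed
  assume x: "\<bar>x\<bar> \<le> pi / 2"
  show ?thesis
  proof (cases "x = 0")
    case False
    have "sinc x = sin \<bar>x\<bar> / \<bar>x\<bar>" using False by (auto simp: sinc_def abs_if)
    moreover have "1 / 4 \<le> sin \<bar>x\<bar> / \<bar>x\<bar>" using pos[of "\<bar>x\<bar>"] x False by (simp add: pos_le_divide_eq)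
    ultimately show ?thesis by simp
  qed (simp add: sinc_def)
qed

lemma sinc_squared_le: "x \<noteq> 0 \<Longrightarrow> (sinc x)\<^sup>2 \<le> 1 / x\<^sup>2"
  by (auto simp: sinc_def power_divide intro!: divide_right_mono abs_square_le_1[THEN iffD2])

text \<open>\<open>sinc (w * h)\<close> is the mean of \<open>cis (w * s)\<close> over a symmetric
  interval; the value of \<open>sinc\<close> at 0 is fixed so that this includes
  \<open>w = 0\<close>.\<close>

lemma integral_cis_symmetric:
  assumes "h > 0"
  shows "integral {-h..h} (\<lambda>s. cis (w * s)) = of_real (2 * h * sinc (w * h))"
proof (cases "w = 0")
  case True
  then show ?thesis using assms by (simp add: sinc_def scaleR_conv_of_real)
next
  case False
  have "cis (w * h) - cis (w * - h) = of_real (2 * sin (w * h)) * \<i>"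
    by (simp add: complex_eq_iff)
  then show ?thesis
    using integral_unique[OF has_integral_cis[of "-h" h w]] assms False by (simp add: sinc_def field_simps)
qed

text \<open>Telescoping:
  \<open>1 / v^2 \<le> 1 / ((v - 1) * v) = 1 / (v - 1) - 1 / v\<close>.\<close>

lemma sum_inverse_squares_nat:
  assumes "u > 1"
  shows "(\<Sum>i<n. 1 / (u + real i)\<^sup>2) \<le> 1 / (u - 1) - 1 / (u + real n - 1)"
proof (induction n)
  case (Suc n)
  have p: "u + real n - 1 > 0" using assms by simp
  have "1 / (u + real n)\<^sup>2 \<le> 1 / ((u + real n - 1) * (u + real n))"
    using p by (intro divide_left_mono mult_pos_pos) (auto simp: power2_eq_square intro!: mult_right_mono)
  also have "\<dots> = 1 / (u + real n - 1) - 1 / (u + real (Suc n) - 1)"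
    using p by (simp add: field_simps)
  finally show ?case using Suc by simp
qed simp

lemma sum_inverse_squares_right:
  assumes J: "finite J" and M: "M > 1"
  shows "(\<Sum>j\<in>{j\<in>J. real_of_int j - y > M}. 1 / (y - real_of_int j)\<^sup>2) \<le> 1 / (M - 1)"
proof -
  \<comment> \<open>The least integer above \<open>y + M\<close>: every \<open>j\<close> in the sum
    is \<open>a + i\<close> with a natural number \<open>i\<close>.\<close>
  define a where "a = \<lfloor>y + M\<rfloor> + 1"
  define u where "u = real_of_int a - y"
  have u: "u > M" unfolding u_def a_def by linarith
  let ?J = "{j\<in>J. real_of_int j - y > M}"
  have fin: "finite ?J" using J by simp
  have ge: "a \<le> j" if "j \<in> ?J" for j using that unfolding a_def by (simp; linarith)
  obtain n where n: "\<And>j. j \<in> ?J \<Longrightarrow> nat (j - a) < n"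
    using finite_nat_set_iff_bounded[of "(\<lambda>j. nat (j - a)) ` ?J"] fin by auto
  have "(\<Sum>j\<in>?J. 1 / (y - real_of_int j)\<^sup>2) = (\<Sum>j\<in>?J. 1 / (u + real (nat (j - a)))\<^sup>2)"
    using ge by (intro sum.cong refl) (auto simp: u_def power2_commute)
  also have "\<dots> = (\<Sum>i\<in>(\<lambda>j. nat (j - a)) ` ?J. 1 / (u + real i)\<^sup>2)"
  proof (subst sum.reindex)
    show "inj_on (\<lambda>j. nat (j - a)) ?J"
    proof (rule inj_onI)
      fix i j assume "i \<in> ?J" "j \<in> ?J" "nat (i - a) = nat (j - a)"
      then show "i = j" using ge[of i] ge[of j] by linarith
    qed
  qed simp
  also have "\<dots> \<le> (\<Sum>i<n. 1 / (u + real i)\<^sup>2)"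
    using n by (intro sum_mono2) auto
  also have "\<dots> \<le> 1 / (u - 1) - 1 / (u + real n - 1)"
    using u M by (intro sum_inverse_squares_nat) auto
  also have "\<dots> \<le> 1 / (u - 1)" using u M by auto
  also have "\<dots> \<le> 1 / (M - 1)" using u M by (intro divide_left_mono mult_pos_pos) auto
  finally show ?thesis .
qed

lemma sum_inverse_squares_int:
  assumes J: "finite J" and M: "M > 1"
  shows "(\<Sum>j\<in>{j\<in>J. \<bar>y - real_of_int j\<bar> > M}. 1 / (y - real_of_int j)\<^sup>2) \<le> 2 / (M - 1)"
proof -
  let ?R = "{j\<in>J. real_of_int j - y > M}" and ?L = "{j\<in>J. y - real_of_int j > M}"
  have "(\<Sum>j\<in>?L. 1 / (y - real_of_int j)\<^sup>2) = (\<Sum>j\<in>{j\<in>uminus ` J. real_of_int j - (- y) > M}. 1 / (- y - real_of_int j)\<^sup>2)"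
    by (rule sum.reindex_bij_witness[of _ uminus uminus]) (auto simp: power2_commute)
  also have "\<dots> \<le> 1 / (M - 1)" using sum_inverse_squares_right[of "uminus ` J" M "- y"] J M by simp
  finally have L: "(\<Sum>j\<in>?L. 1 / (y - real_of_int j)\<^sup>2) \<le> 1 / (M - 1)" .
  have "{j\<in>J. \<bar>y - real_of_int j\<bar> > M} = ?R \<union> ?L" by (auto simp: abs_if)
  moreover have "(\<Sum>j\<in>?R \<union> ?L. 1 / (y - real_of_int j)\<^sup>2) = (\<Sum>j\<in>?R. 1 / (y - real_of_int j)\<^sup>2) + (\<Sum>j\<in>?L. 1 / (y - real_of_int j)\<^sup>2)"
    using J M by (intro sum.union_disjoint) auto
  ultimately show ?thesis using L sum_inverse_squares_right[OF J M, of y] by (simp add: add_divide_distrib)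
qed

section \<open>Localization in frequency\<close>

lemma set_lebesgue_integral_eq_integral_Icc:
  fixes f :: "real \<Rightarrow> 'b::euclidean_space"
  assumes "continuous_on UNIV f"
  shows "(LINT s:{l..u}|lborel. f s) = integral {l..u} f"
    and "integrable lborel (\<lambda>s. indicator {l..u} s *\<^sub>R f s)"
proof -
  have "continuous_on {l..u} f" using assms continuous_on_subset by blast
  from borel_integrable_compact[OF compact_Icc this]
  show *: "integrable lborel (\<lambda>s. indicator {l..u} s *\<^sub>R f s)" by (simp add: indicator_scaleR_eq_if)
  then show "(LINT s:{l..u}|lborel. f s) = integral {l..u} f"
    by (intro set_borel_integral_eq_integral) (simp add: set_integrable_def)
qed

text \<open>Bessel's inequality for the exponentials of period \<open>2 * h\<close>, which are
  orthogonal on the interval with squared norm \<open>2 * h\<close>.\<close>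

lemma bessel_interval:
  fixes \<phi> :: "real \<Rightarrow> complex" and J :: "int set"
  assumes \<phi>: "continuous_on UNIV \<phi>" and h: "h > 0" and J: "finite J"
  shows "(\<Sum>j\<in>J. (cmod (integral {-h..h} (\<lambda>s. \<phi> s * cis (- (pi * of_int j / h * s)))))\<^sup>2)
    \<le> 2 * h * integral {-h..h} (\<lambda>s. (cmod (\<phi> s))\<^sup>2)"
proof -
  let ?I = "indicator {-h..h} :: real \<Rightarrow> real"
  let ?e = "\<lambda>j s. ?I s *\<^sub>R cis (pi * of_int j / h * s)"
  let ?f = "\<lambda>s. ?I s *\<^sub>R \<phi> s"
  have fe: "?f s * cnj (?e j s) = ?I s *\<^sub>R (\<phi> s * cis (- (pi * of_int j / h * s)))" for j s
    by (simp add: indicator_def cis_cnj)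
  have ee: "?e j s * cnj (?e i s) = ?I s *\<^sub>R cis (pi / h * of_int (j - i) * s)" for i j s
    using h by (simp add: indicator_def cis_cnj cis_mult diff_divide_distrib algebra_simps)
  have ff: "(cmod (?f s))\<^sup>2 = ?I s *\<^sub>R (cmod (\<phi> s))\<^sup>2" for s
    by (simp add: indicator_def)
  have coef: "(LINT s|lborel. ?f s * cnj (?e j s)) = integral {-h..h} (\<lambda>s. \<phi> s * cis (- (pi * of_int j / h * s)))" for j
    unfolding fe using h by (subst set_lebesgue_integral_eq_integral_Icc(1)[symmetric])
      (auto simp: set_lebesgue_integral_def intro!: continuous_intros \<phi>)
  have nrm: "(LINT s|lborel. (cmod (?f s))\<^sup>2) = integral {-h..h} (\<lambda>s. (cmod (\<phi> s))\<^sup>2)"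
    unfolding ff by (subst set_lebesgue_integral_eq_integral_Icc(1)[symmetric])
      (auto simp: set_lebesgue_integral_def intro!: continuous_intros \<phi>)
  \<comment> \<open>The optimal coefficients make the last sum of the expansion vanish, so
    nonnegativity of the left-hand side is the claim.\<close>
  have "0 \<le> (LINT s|lborel. (cmod (?f s - (\<Sum>j\<in>J. (LINT s|lborel. ?f s * cnj (?e j s)) / of_real (2 * h) * ?e j s)))\<^sup>2)"
    by simp
  also have "\<dots> = (LINT s|lborel. (cmod (?f s))\<^sup>2) - (\<Sum>j\<in>J. (cmod (LINT s|lborel. ?f s * cnj (?e j s)))\<^sup>2) / (2 * h)
    + (\<Sum>j\<in>J. (cmod (of_real (2 * h) * ((LINT s|lborel. ?f s * cnj (?e j s)) / of_real (2 * h)) - (LINT s|lborel. ?f s * cnj (?e j s))))\<^sup>2) / (2 * h)"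
  proof (rule integral_orthogonal_expansion)
    show "integrable lborel (\<lambda>s. (cmod (?f s))\<^sup>2)"
      unfolding ff by (intro set_lebesgue_integral_eq_integral_Icc continuous_intros \<phi>)
    show "integrable lborel (\<lambda>s. ?f s * cnj (?e j s))" for j
      unfolding fe by (intro set_lebesgue_integral_eq_integral_Icc continuous_intros \<phi>)
    show "integrable lborel (\<lambda>s. ?e j s * cnj (?e i s))" for i j
      unfolding ee by (intro set_lebesgue_integral_eq_integral_Icc continuous_intros)
    have "pi / h > 0" "pi / h * (h - - h) = 2 * pi" using h by simp_all
    note period = integral_cis_period(1)[OF this]
    show "(LINT s|lborel. ?e j s * cnj (?e i s)) = (if j = i then of_real (2 * h) else 0)" for i j
      unfolding ee using period[of "j - i"] by (simp add: set_lebesgue_integral_def del: of_int_diff)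
  qed (use J h in auto)
  also have "\<dots> = (LINT s|lborel. (cmod (?f s))\<^sup>2) - (\<Sum>j\<in>J. (cmod (LINT s|lborel. ?f s * cnj (?e j s)))\<^sup>2) / (2 * h)"
    using h by simp
  finally show ?thesis unfolding coef nrm using h by (simp add: field_simps)
qed

text \<open>Along the segment \<open>X + s b\<close> with \<open>\<bar>s\<bar> \<le> h\<close>, the
  \<open>j\<close>-th Fourier coefficient of the sum is, up to the factor \<open>2 * h\<close>, the
  sum with coefficients weighted by a \<open>sinc\<close> centred at \<open>pi * j / h\<close>.
  Bessel in \<open>s\<close> for fixed \<open>X\<close>, followed by integration over
  \<open>X\<close>, gives the bound, because the cube translated by \<open>s b\<close> stays inside
  the cube enlarged by \<open>h\<close>.\<close>

lemma energy_band_bessel: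
  fixes A :: "'e::euclidean_space set" and J :: "int set"
  assumes b: "b \<in> Basis" and h: "h > 0" and A: "finite A" and J: "finite J"
  shows "(\<Sum>j\<in>J. energy e (trig_sum A (\<lambda>l. c l * of_real (sinc (h * (l \<bullet> b) - pi * of_int j)))))
    \<le> energy (e + h) (trig_sum A c)"
proof -
  let ?f = "trig_sum A c"
  let ?g = "\<lambda>j. trig_sum A (\<lambda>l. c l * of_real (sinc (h * (l \<bullet> b) - pi * of_int j)))"
  have coef: "integral {-h..h} (\<lambda>s. ?f (s *\<^sub>R b + X) * cis (- (pi * of_int j / h * s))) = of_real (2 * h) * ?g j X" for j X
  proof -
    have "integral {-h..h} (\<lambda>s. ?f (s *\<^sub>R b + X) * cis (- (pi * of_int j / h * s))) =
      integral {-h..h} (\<lambda>s. \<Sum>l\<in>A. c l * cis (l \<bullet> X) * cis ((l \<bullet> b - pi * of_int j / h) * s))"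
      unfolding trig_sum_def sum_distrib_right
      by (intro integral_cong sum.cong refl)
        (simp add: inner_add_right cis_mult[symmetric] algebra_simps, simp add: cis_mult algebra_simps)
    also have "\<dots> = (\<Sum>l\<in>A. integral {-h..h} (\<lambda>s. c l * cis (l \<bullet> X) * cis ((l \<bullet> b - pi * of_int j / h) * s)))"
      using A by (intro integral_sum integrable_continuous_interval continuous_intros)
    also have "\<dots> = (\<Sum>l\<in>A. c l * cis (l \<bullet> X) * of_real (2 * h * sinc (h * (l \<bullet> b) - pi * of_int j)))"
    proof (intro sum.cong refl)
      fix l
      have "(l \<bullet> b - pi * of_int j / h) * h = h * (l \<bullet> b) - pi * of_int j" using h by (simp add: field_simps)
      then show "integral {-h..h} (\<lambda>s. c l * cis (l \<bullet> X) * cis ((l \<bullet> b - pi * of_int j / h) * s)) =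
        c l * cis (l \<bullet> X) * of_real (2 * h * sinc (h * (l \<bullet> b) - pi * of_int j))"
        using integral_cis_symmetric[OF h, of "l \<bullet> b - pi * of_int j / h"] by (simp only: integral_mult_right)
    qed
    also have "\<dots> = of_real (2 * h) * ?g j X"
      unfolding trig_sum_def sum_distrib_left by (intro sum.cong refl) (simp add: mult_ac)
    finally show ?thesis .
  qed
  have pointwise: "2 * h * (\<Sum>j\<in>J. (cmod (?g j X))\<^sup>2) \<le> integral {-h..h} (\<lambda>s. (cmod (?f (s *\<^sub>R b + X)))\<^sup>2)" for X
  proof -
    have "(\<Sum>j\<in>J. (cmod (of_real (2 * h) * ?g j X))\<^sup>2) \<le> 2 * h * integral {-h..h} (\<lambda>s. (cmod (?f (s *\<^sub>R b + X)))\<^sup>2)"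
      using bessel_interval[of "\<lambda>s. ?f (s *\<^sub>R b + X)" h J] h J by (simp only: coef) (simp add: continuous_intros)
    then have "2 * h * (2 * h * (\<Sum>j\<in>J. (cmod (?g j X))\<^sup>2)) \<le> 2 * h * integral {-h..h} (\<lambda>s. (cmod (?f (s *\<^sub>R b + X)))\<^sup>2)"
      using h by (simp add: norm_mult power_mult_distrib sum_distrib_left power2_eq_square mult_ac)
    then show ?thesis using h by (simp only: mult_le_cancel_left_pos)
  qed
  have cont: "continuous_on S (\<lambda>(x, y). (cmod (?f (y *\<^sub>R b + x)))\<^sup>2)" for S
    by (simp add: split_beta) (intro continuous_intros)
  have "2 * h * (\<Sum>j\<in>J. energy e (?g j)) = integral (cube e) (\<lambda>X. 2 * h * (\<Sum>j\<in>J. (cmod (?g j X))\<^sup>2))"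
    unfolding energy_def using J
    by (subst Henstock_Kurzweil_Integration.integral_sum[symmetric])
      (auto intro!: integrable_on_cube continuous_intros)
  also have "\<dots> \<le> integral (cube e) (\<lambda>X. integral (cbox (-h) h) (\<lambda>s. (cmod (?f (s *\<^sub>R b + X)))\<^sup>2))"
  proof (rule integral_le)
    show "(\<lambda>X. integral (cbox (-h) h) (\<lambda>s. (cmod (?f (s *\<^sub>R b + X)))\<^sup>2)) integrable_on cube e"
      unfolding cube_def 
      by (intro integrable_continuous integral_continuous_on_param cont[of "cbox _ _ \<times> _"])
  qed (use pointwise in \<open>auto intro!: integrable_on_cube continuous_intros\<close>)
  also have "\<dots> = integral (cbox (-h) h) (\<lambda>s. integral (cube e) (\<lambda>X. (cmod (?f (s *\<^sub>R b + X)))\<^sup>2))"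
    unfolding cube_def by (rule integral_swap_continuous) (rule cont)
  also have "\<dots> \<le> integral (cbox (-h) h) (\<lambda>s. energy (e + h) ?f)"
  proof (rule integral_le)
    show "(\<lambda>s. integral (cube e) (\<lambda>X. (cmod (?f (s *\<^sub>R b + X)))\<^sup>2)) integrable_on cbox (-h) h"
      unfolding cube_def 
      by (intro integrable_continuous integral_continuous_on_param) (simp add: split_beta, intro continuous_intros)
    fix s assume s: "s \<in> cbox (-h) h"
    have "\<bar>(s *\<^sub>R b) \<bullet> i\<bar> \<le> h" if "i \<in> Basis" for i
      using s b that h by (auto simp: inner_Basis)
    then show "integral (cube e) (\<lambda>X. (cmod (?f (s *\<^sub>R b + X)))\<^sup>2) \<le> energy (e + h) ?f"
      using energy_shift_le[of ?f "s *\<^sub>R b" h e] by (simp add: energy_def continuous_intros)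
  qed auto
  also have "\<dots> = 2 * h * energy (e + h) ?f" using h by simp
  finally show ?thesis using h by (simp only: mult_le_cancel_left_pos)
qed

lemma sum_cmod_mult_of_real:
  "(\<Sum>l\<in>A. (cmod (c l * complex_of_real (w l)))\<^sup>2) = (\<Sum>l\<in>A. (cmod (c l))\<^sup>2 * (w l)\<^sup>2)"
  by (simp add: norm_mult power_mult_distrib)

lemma trig_sum_split:
  "finite A \<Longrightarrow> A' \<subseteq> A \<Longrightarrow> trig_sum A' c X = trig_sum A c X - trig_sum (A - A') c X"
  by (simp add: trig_sum_def sum_diff)

text \<open>
  The bands of width \<open>2M\<close> around the points \<open>\<pi>j/h\<close> decouple: multiplication of the coefficients
  by \<^const>\<open>sinc\<close> is averaging over a segment of length \<open>2h\<close>, which costs only an enlargement of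
  the cube by \<open>h\<close>, and the tails of \<^const>\<open>sinc\<close> are square summable.
\<close>

lemma observable_from_bands:
  fixes b :: "'e::euclidean_space"
  assumes b: "b \<in> Basis" and C: "C \<ge> 0" and B: "B \<ge> 0" and h: "h > 0"
  shows "\<exists>M C'. 0 \<le> C' \<and> (\<forall>A. finite A \<longrightarrow> bessel A e B \<longrightarrow>
    (\<forall>\<mu>. observable {l\<in>A. \<bar>l \<bullet> b - \<mu>\<bar> \<le> M} e C) \<longrightarrow> observable A (e + h) C')"
proof -
  \<comment> \<open>Chosen so that the tail \<open>2 / (M' - 1)\<close> of the squared
    \<open>sinc\<close>, multiplied by the loss \<open>2 * C * B\<close>, is at most
    \<open>1 / 32\<close>, half of the \<open>1 / 16\<close> that the central bands supply. The
    scaling in \<open>M\<close> accounts for the spacing \<open>pi / h\<close> of the band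
    centres.\<close>
  define M' where "M' = 1 + 128 * (C * B + 1)"
  define M where "M = pi * M' / h"
  have CB: "0 \<le> C * B" using C B by simp
  have M': "M' > 1" using CB by (simp add: M'_def)
  have small: "2 * C * B * (2 / (M' - 1)) \<le> 1 / 32"
  proof -
    have "2 * C * B * (2 / (M' - 1)) = 4 * (C * B) / (128 * (C * B + 1))" by (simp add: M'_def)
    also have "\<dots> \<le> 1 / 32" using CB by (simp add: divide_le_eq)
    finally show ?thesis .
  qed
  have "observable A (e + h) (64 * C)" if A: "finite A" and bes: "bessel A e B"
    and obs: "\<And>\<mu>. observable {l\<in>A. \<bar>l \<bullet> b - \<mu>\<bar> \<le> M} e C" for A :: "'e set"
    unfolding observable_def
  proof
    fix c :: "'e \<Rightarrow> complex"
    define E where "E = energy (e + h) (trig_sum A c)"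
    \<comment> \<open>For each frequency the index of its nearest band centre; finitely many bands
      suffice because \<open>A\<close> is finite.\<close>
    define J where "J = (\<lambda>l. round (h * (l \<bullet> b) / pi)) ` A"
    have J: "finite J" using A by (simp add: J_def)
    define w where "w j l = sinc (h * (l \<bullet> b) - pi * of_int j)" for j :: int and l
    define near where "near j = {l\<in>A. \<bar>l \<bullet> b - pi * of_int j / h\<bar> \<le> M}" for j :: int
    let ?g = "\<lambda>j. (\<lambda>l. c l * of_real (w j l))"
    have near_iff: "l \<in> near j \<longleftrightarrow> l \<in> A \<and> \<bar>h * (l \<bullet> b) / pi - of_int j\<bar> \<le> M'" for l j
    proof -
      have "l \<bullet> b - pi * of_int j / h = (pi / h) * (h * (l \<bullet> b) / pi - of_int j)"
        using h by (simp add: field_simps)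
      then have "\<bar>l \<bullet> b - pi * of_int j / h\<bar> = (pi / h) * \<bar>h * (l \<bullet> b) / pi - of_int j\<bar>"
        using h by (simp add: abs_mult)
      moreover have "(pi / h) * \<bar>h * (l \<bullet> b) / pi - of_int j\<bar> \<le> M \<longleftrightarrow> \<bar>h * (l \<bullet> b) / pi - of_int j\<bar> \<le> M'"
        using h by (simp add: M_def field_simps)
      ultimately show ?thesis by (simp add: near_def)
    qed
    \<comment> \<open>Observability of one band is applied to the weighted coefficients. The sum
      over the band is the full weighted sum minus its far part, and the far part is bounded by
      Bessel.\<close>
    have step: "(\<Sum>l\<in>near j. (cmod (c l))\<^sup>2 * (w j l)\<^sup>2) \<le> 2 * C * energy e (trig_sum A (?g j))
      + 2 * C * B * (\<Sum>l\<in>A - near j. (cmod (c l))\<^sup>2 * (w j l)\<^sup>2)" for j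
    proof -
      have sub: "near j \<subseteq> A" by (auto simp: near_def)
      have "(\<Sum>l\<in>near j. (cmod (c l))\<^sup>2 * (w j l)\<^sup>2) \<le> C * energy e (trig_sum (near j) (?g j))"
        using obs[of "pi * of_int j / h"] unfolding observable_def near_def[symmetric]
        by (simp add: sum_cmod_mult_of_real[symmetric])
      also have "energy e (trig_sum (near j) (?g j)) = energy e (\<lambda>X. trig_sum A (?g j) X - trig_sum (A - near j) (?g j) X)"
        by (simp add: trig_sum_split[OF A sub, of "?g j", symmetric])
      also have "\<dots> \<le> 2 * energy e (trig_sum A (?g j)) + 2 * energy e (trig_sum (A - near j) (?g j))"
        by (intro energy_diff_le continuous_intros)
      also have "energy e (trig_sum (A - near j) (?g j)) \<le> B * (\<Sum>l\<in>A - near j. (cmod (c l))\<^sup>2 * (w j l)\<^sup>2)"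
        using bessel_subset[OF bes A, of "A - near j"] unfolding bessel_def
        by (simp add: sum_cmod_mult_of_real[symmetric])
      finally have "(\<Sum>l\<in>near j. (cmod (c l))\<^sup>2 * (w j l)\<^sup>2) \<le> C * (2 * energy e (trig_sum A (?g j)) +
        2 * (B * (\<Sum>l\<in>A - near j. (cmod (c l))\<^sup>2 * (w j l)\<^sup>2)))"
        using C by (simp add: mult_left_mono)
      then show ?thesis by (simp add: algebra_simps)
    qed
    have main: "(\<Sum>j\<in>J. \<Sum>l\<in>near j. (cmod (c l))\<^sup>2 * (w j l)\<^sup>2) \<le>
      2 * C * E + 2 * C * B * (\<Sum>j\<in>J. \<Sum>l\<in>A - near j. (cmod (c l))\<^sup>2 * (w j l)\<^sup>2)"
    proof -
      have "(\<Sum>j\<in>J. \<Sum>l\<in>near j. (cmod (c l))\<^sup>2 * (w j l)\<^sup>2) \<le> 2 * C * (\<Sum>j\<in>J. energy e (trig_sum A (?g j)))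
        + 2 * C * B * (\<Sum>j\<in>J. \<Sum>l\<in>A - near j. (cmod (c l))\<^sup>2 * (w j l)\<^sup>2)"
        unfolding sum_distrib_left sum.distrib[symmetric] using step by (intro sum_mono) (simp add: sum_distrib_left)
      moreover have "(\<Sum>j\<in>J. energy e (trig_sum A (?g j))) \<le> E"
        unfolding E_def w_def by (rule energy_band_bessel[OF b h A J])
      ultimately show ?thesis using C by (smt (verit) mult_left_mono)
    qed
    have swap: "(\<Sum>j\<in>J. \<Sum>l\<in>S j. F j l) = (\<Sum>l\<in>A. \<Sum>j\<in>{j\<in>J. l \<in> S j}. F j l)"
      if "\<And>j. S j \<subseteq> A" for S and F :: "int \<Rightarrow> 'e \<Rightarrow> real"
    proof -
      have "(\<Sum>j\<in>J. \<Sum>l\<in>S j. F j l) = (\<Sum>j\<in>J. \<Sum>l\<in>{l\<in>A. l \<in> S j}. F j l)"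
        using that by (intro sum.cong refl) auto
      also have "\<dots> = (\<Sum>l\<in>A. \<Sum>j\<in>{j\<in>J. l \<in> S j}. F j l)" by (rule sum.swap_restrict[OF J A])
      finally show ?thesis .
    qed
    \<comment> \<open>After exchanging the sums, each frequency meets only indices \<open>j\<close>
      at distance more than \<open>M'\<close>, where the squared \<open>sinc\<close> is below an
      inverse square.\<close>
    have far: "(\<Sum>j\<in>J. \<Sum>l\<in>A - near j. (cmod (c l))\<^sup>2 * (w j l)\<^sup>2) \<le> (2 / (M' - 1)) * (\<Sum>l\<in>A. (cmod (c l))\<^sup>2)"
    proof (subst swap, force, subst sum_distrib_left, rule sum_mono)
      fix l assume l: "l \<in> A"
      define y where "y = h * (l \<bullet> b) / pi"
      have "(\<Sum>j\<in>{j\<in>J. l \<in> A - near j}. (w j l)\<^sup>2) = (\<Sum>j\<in>{j\<in>J. \<bar>y - of_int j\<bar> > M'}. (w j l)\<^sup>2)"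
        using l by (intro sum.cong refl) (auto simp: near_iff y_def)
      also have "\<dots> \<le> (\<Sum>j\<in>{j\<in>J. \<bar>y - of_int j\<bar> > M'}. 1 / (y - of_int j)\<^sup>2)"
      proof (rule sum_mono)
        fix j assume j: "j \<in> {j\<in>J. \<bar>y - of_int j\<bar> > M'}"
        have eq: "h * (l \<bullet> b) - pi * of_int j = pi * (y - of_int j)" by (simp add: y_def field_simps)
        have nz: "y - of_int j \<noteq> 0" using j M' by auto
        have "(w j l)\<^sup>2 \<le> 1 / (pi * (y - of_int j))\<^sup>2"
          unfolding w_def eq using nz by (intro sinc_squared_le) auto
        also have "\<dots> \<le> 1 / (y - of_int j)\<^sup>2"
        proof (rule divide_left_mono)
          have "1 * (y - of_int j)\<^sup>2 \<le> pi\<^sup>2 * (y - of_int j)\<^sup>2"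
            using pi_gt3 by (intro mult_right_mono one_le_power) auto
          then show "(y - of_int j)\<^sup>2 \<le> (pi * (y - of_int j))\<^sup>2" by (simp add: power_mult_distrib)
        qed (use nz in auto)
        finally show "(w j l)\<^sup>2 \<le> 1 / (y - of_int j)\<^sup>2" .
      qed
      also have "\<dots> \<le> 2 / (M' - 1)" by (rule sum_inverse_squares_int[OF J M'])
      finally have "(cmod (c l))\<^sup>2 * (\<Sum>j\<in>{j\<in>J. l \<in> A - near j}. (w j l)\<^sup>2) \<le> (cmod (c l))\<^sup>2 * (2 / (M' - 1))"
        by (rule mult_left_mono) simp
      then show "(\<Sum>j\<in>{j\<in>J. l \<in> A - near j}. (cmod (c l))\<^sup>2 * (w j l)\<^sup>2) \<le> (2 / (M' - 1)) * (cmod (c l))\<^sup>2"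
        by (simp only: sum_distrib_left mult.commute)
    qed
    \<comment> \<open>Each frequency lies in the band of its nearest centre, where the argument of
      \<open>sinc\<close> is at most \<open>pi / 2\<close>; hence the weight is at least
      \<open>1 / 4\<close> and its square at least \<open>1 / 16\<close>.\<close>
    have close: "(1 / 16) * (\<Sum>l\<in>A. (cmod (c l))\<^sup>2) \<le> (\<Sum>j\<in>J. \<Sum>l\<in>near j. (cmod (c l))\<^sup>2 * (w j l)\<^sup>2)"
    proof (subst swap, force simp: near_def, subst sum_distrib_left, rule sum_mono)
      fix l assume l: "l \<in> A"
      define y where "y = h * (l \<bullet> b) / pi"
      define j where "j = round y"
      have yj: "\<bar>y - of_int j\<bar> \<le> 1 / 2" unfolding j_def using of_int_round_abs_le[of y] by (simp add: abs_minus_commute)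
      have eq: "h * (l \<bullet> b) - pi * of_int j = pi * (y - of_int j)" by (simp add: y_def field_simps)
      have "\<bar>pi * (y - of_int j)\<bar> \<le> pi / 2" using yj by (simp add: abs_mult)
      then have "1 / 4 \<le> w j l" unfolding w_def eq by (rule sinc_lower)
      then have "(1 / 4)\<^sup>2 \<le> (w j l)\<^sup>2" by (intro power_mono) auto
      then have "(1 / 16) * (cmod (c l))\<^sup>2 \<le> (cmod (c l))\<^sup>2 * (w j l)\<^sup>2"
        by (subst mult.commute, intro mult_left_mono) (auto simp: power2_eq_square)
      also have "\<dots> \<le> (\<Sum>j\<in>{j\<in>J. l \<in> near j}. (cmod (c l))\<^sup>2 * (w j l)\<^sup>2)"
      proof (rule member_le_sum)
        have "l \<in> near j" using l yj M' by (simp add: near_iff y_def)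
        then show "j \<in> {j\<in>J. l \<in> near j}" using l by (auto simp: J_def j_def y_def)
      qed (use J in auto)
      finally show "(1 / 16) * (cmod (c l))\<^sup>2 \<le> (\<Sum>j\<in>{j\<in>J. l \<in> near j}. (cmod (c l))\<^sup>2 * (w j l)\<^sup>2)" .
    qed
    define S where "S = (\<Sum>l\<in>A. (cmod (c l))\<^sup>2)"
    have S: "0 \<le> S" by (simp add: S_def sum_nonneg)
    have "2 * C * B * (\<Sum>j\<in>J. \<Sum>l\<in>A - near j. (cmod (c l))\<^sup>2 * (w j l)\<^sup>2) \<le> 2 * C * B * ((2 / (M' - 1)) * S)"
      using far C B unfolding S_def by (intro mult_left_mono) auto
    also have "\<dots> = 2 * C * B * (2 / (M' - 1)) * S" by (simp only: mult.assoc)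
    also have "\<dots> \<le> (1 / 32) * S" using small S by (rule mult_right_mono)
    \<comment> \<open>Moving the \<open>1 / 32\<close> to the left leaves \<open>1 / 32\<close> of
      the sum against \<open>2 * C * E\<close>; this is the origin of 64.\<close>
    finally have "(1 / 16) * S \<le> 2 * C * E + (1 / 32) * S" using close main unfolding S_def by linarith
    then have "S \<le> 64 * C * E" by linarith
    then show "(\<Sum>l\<in>A. (cmod (c l))\<^sup>2) \<le> 64 * C * energy (e + h) (trig_sum A c)" by (simp only: S_def E_def)
  qed
  then show ?thesis using C by - (rule exI[of _ M], rule exI[of _ "64 * C"], auto)
qed

text \<open>One coordinate direction at a time: bands in direction \<open>d\<close> reduce
  \<open>A\<close> to slabs, and the induction hypothesis reduces each slab to windows inside it.
  Each of the two steps receives half of \<open>h\<close>.\<close>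

lemma observable_from_windows:
  fixes D :: "'e::euclidean_space set"
  assumes "finite D" "D \<subseteq> Basis" "B \<ge> 0"
  shows "C \<ge> 0 \<Longrightarrow> h > 0 \<Longrightarrow> \<exists>M C'. 0 \<le> C' \<and> (\<forall>A. finite A \<longrightarrow> bessel A (e + h) B \<longrightarrow>
    (\<forall>\<mu>. observable {l\<in>A. \<forall>b\<in>D. \<bar>l \<bullet> b - \<mu> \<bullet> b\<bar> \<le> M} e C) \<longrightarrow> observable A (e + h) C')"
  using assms(1,2)
proof (induction D arbitrary: C e h rule: finite_induct)
  case empty
  then show ?case by (intro exI[of _ 0] exI[of _ C]) (auto intro: observable_mono)
next
  case (insert d D)
  have h2: "h / 2 > 0" using insert.prems by simp
  from insert.IH[OF insert.prems(1) h2, of e] insert.prems(3)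
  obtain M1 C1 where C1: "0 \<le> C1" and 1: "\<And>A. finite A \<Longrightarrow> bessel A (e + h/2) B \<Longrightarrow>
    (\<And>\<mu>. observable {l\<in>A. \<forall>b\<in>D. \<bar>l \<bullet> b - \<mu> \<bullet> b\<bar> \<le> M1} e C) \<Longrightarrow> observable A (e + h/2) C1" by auto
  have d: "d \<in> Basis" using insert.prems by auto
  from observable_from_bands[OF d C1 assms(3) h2, of "e + h/2"]
  obtain M2 C2 where C2: "0 \<le> C2" and 2: "\<And>A. finite A \<Longrightarrow> bessel A (e + h/2) B \<Longrightarrow>
    (\<And>\<mu>. observable {l\<in>A. \<bar>l \<bullet> d - \<mu>\<bar> \<le> M2} (e + h/2) C1) \<Longrightarrow> observable A (e + h) C2"
    by (auto simp: add.assoc)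
  show ?case
  proof (rule exI[of _ "max M1 M2"], rule exI[of _ C2], intro conjI allI impI C2)
    fix A :: "'e set"
    assume A: "finite A" and bes: "bessel A (e + h) B"
      and obs: "\<forall>\<mu>. observable {l\<in>A. \<forall>b\<in>insert d D. \<bar>l \<bullet> b - \<mu> \<bullet> b\<bar> \<le> max M1 M2} e C"
    have bes2: "bessel A (e + h/2) B" using bes by (rule bessel_mono) (use insert.prems in simp)
    show "observable A (e + h) C2"
    proof (rule 2[OF A bes2])
      fix \<mu> :: real
      let ?A = "{l\<in>A. \<bar>l \<bullet> d - \<mu>\<bar> \<le> M2}"
      show "observable ?A (e + h/2) C1"
      proof (rule 1)
        show "finite ?A" using A by simp
        show "bessel ?A (e + h/2) B" by (rule bessel_subset[OF bes2 A]) auto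
        fix \<nu> :: 'e
        \<comment> \<open>The window centre \<nu> with its coordinate \<open>d\<close> replaced by
          the centre \<mu> of the slab.\<close>
        define \<nu>' where "\<nu>' = \<nu> + (\<mu> - \<nu> \<bullet> d) *\<^sub>R d"
        have "\<nu>' \<bullet> d = \<mu>" using d by (simp add: \<nu>'_def inner_add_left)
        moreover have "\<nu>' \<bullet> b = \<nu> \<bullet> b" if "b \<in> D" for b
        proof -
          have "d \<noteq> b" "b \<in> Basis" using that insert.hyps insert.prems by auto
          then show ?thesis using d by (simp add: \<nu>'_def inner_add_left inner_not_same_Basis)
        qed
        ultimately have sub: "{l\<in>?A. \<forall>b\<in>D. \<bar>l \<bullet> b - \<nu> \<bullet> b\<bar> \<le> M1} \<subseteq>
            {l\<in>A. \<forall>b\<in>insert d D. \<bar>l \<bullet> b - \<nu>' \<bullet> b\<bar> \<le> max M1 M2}"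
          by auto
        show "observable {l\<in>?A. \<forall>b\<in>D. \<bar>l \<bullet> b - \<nu> \<bullet> b\<bar> \<le> M1} e C"
          by (rule observable_subset[OF obs[rule_format, of \<nu>'] _ sub]) (use A in simp)
      qed
    qed
  qed
qed

section \<open>Adding frequencies\<close>

lemma cmod_cis_diff_one: "(cmod (cis x - 1))\<^sup>2 = 2 - 2 * cos x"
  unfolding cmod_power2 using sin_cos_squared_add[of x] by (simp add: power2_eq_square algebra_simps)

text \<open>With \<open>d = \<bar>\<delta>\<bar>\<close> the integral is
  \<open>2 * (h - sin (h * d) / d)\<close>, which is positive and tends to \<open>2 * h\<close> as
  \<open>d\<close> grows, hence bounded below for \<open>d \<ge> 1\<close>. A case distinction makes
  the bound explicit.\<close>

lemma integral_one_minus_cos_ge: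
  fixes h :: real
  assumes h: "h > 0"
  shows "\<exists>\<kappa>>0. \<forall>\<delta>. 1 \<le> \<bar>\<delta>\<bar> \<longrightarrow> \<kappa> \<le> integral {0..h} (\<lambda>s. 2 - 2 * cos (s * \<delta>))"
proof -
  have strict: "sin h < h"
  proof (cases "h \<le> 1")
    case True
    have "sin h = 2 * sin (h/2) * cos (h/2)" using sin_double[of "h/2"] by simp
    also have "\<dots> < 2 * sin (h/2) * 1"
    proof (rule mult_strict_left_mono)
      show "cos (h/2) < 1" using cos_monotone_0_pi[of 0 "h/2"] h True pi_gt3 by simp
      show "0 < 2 * sin (h/2)" using sin_gt_zero[of "h/2"] h True pi_gt3 by simp
    qed
    also have "\<dots> \<le> h" using sin_x_le_x[of "h/2"] h by simp
    finally show ?thesis .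
  next
    case False
    then show ?thesis using sin_le_one[of h] by linarith
  qed
  \<comment> \<open>The first entry serves \<open>h * d \<ge> 2\<close>, the second
    \<open>h * d < 2\<close>, where \<open>1 / d > h / 2\<close>.\<close>
  define \<kappa> where "\<kappa> = 2 * min (h / 2) ((h - sin h) * h / 2)"
  have "\<kappa> \<le> integral {0..h} (\<lambda>s. 2 - 2 * cos (s * \<delta>))" if \<delta>: "1 \<le> \<bar>\<delta>\<bar>" for \<delta>
  proof -
    define d where "d = \<bar>\<delta>\<bar>"
    have d: "1 \<le> d" using \<delta> by (simp add: d_def)
    have "((\<lambda>s. 2 - 2 * cos (s * d)) has_integral ((2 * h - 2 * sin (h * d) / d) - (2 * 0 - 2 * sin (0 * d) / d))) {0..h}"
      using h d by (intro fundamental_theorem_of_calculus)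
        (auto intro!: derivative_eq_intros simp: has_real_derivative_iff_has_vector_derivative[symmetric])
    then have I: "integral {0..h} (\<lambda>s. 2 - 2 * cos (s * d)) = 2 * (h - sin (h * d) / d)"
      by (auto dest!: integral_unique)
    have "min (h / 2) ((h - sin h) * h / 2) \<le> h - sin (h * d) / d"
    proof (cases "2 \<le> h * d")
      case True
      have "sin (h * d) / d \<le> 1 / d" using d by (intro divide_right_mono) auto
      also have "\<dots> \<le> h / 2" using d True by (simp add: field_simps)
      finally show ?thesis by linarith
    next
      case False
      have hd: "h \<le> h * d" using h d by simp
      \<comment> \<open>This amounts to monotonicity of \<open>x - sin x\<close> between
        \<open>h\<close> and \<open>h * d\<close>.\<close>
      have "sin (h * d) - sin h = 2 * sin ((h * d - h) / 2) * cos ((h * d + h) / 2)" by (rule sin_diff_sin)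
      also have "\<dots> \<le> \<bar>2 * sin ((h * d - h) / 2) * cos ((h * d + h) / 2)\<bar>" by simp
      also have "\<dots> \<le> 2 * \<bar>(h * d - h) / 2\<bar> * 1"
        unfolding abs_mult by (intro mult_mono abs_sin_x_le_abs_x abs_cos_le_one) auto
      also have "\<dots> = h * d - h" using hd by simp
      finally have "h - sin h \<le> h * d - sin (h * d)" by simp
      then have le: "(h - sin h) / d \<le> (h * d - sin (h * d)) / d" using d by (intro divide_right_mono) auto
      have "(h - sin h) * h / 2 = (h - sin h) * (h / 2)" by simp
      also have "\<dots> \<le> (h - sin h) * (1 / d)"
        using strict False d by (intro mult_left_mono) (auto simp: field_simps)
      also have "\<dots> = (h - sin h) / d" by simp
      also have "\<dots> \<le> (h * d - sin (h * d)) / d" by (rule le)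
      also have "\<dots> = h - sin (h * d) / d" using d by (simp add: field_simps)
      finally show ?thesis by linarith
    qed
    moreover have "integral {0..h} (\<lambda>s. 2 - 2 * cos (s * \<delta>)) = integral {0..h} (\<lambda>s. 2 - 2 * cos (s * d))"
      by (intro integral_cong) (simp add: d_def abs_if)
    ultimately show ?thesis by (simp only: I \<kappa>_def mult_left_mono zero_le_numeral)
  qed
  moreover have "\<kappa> > 0" using h strict by (simp add: \<kappa>_def)
  ultimately show ?thesis by blast
qed

lemma energy_unimodular: "energy e (\<lambda>X. cis (g X) * f X) = energy e f"
  by (simp add: energy_def norm_mult)

text \<open>
  Passing from \<open>f(X)\<close> to \<open>cis (- s (l\<^sub>0 \<bullet> b)) f(X + s b) - f(X)\<close> removes the frequency \<open>l\<^sub>0\<close>; averaging over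
  \<open>s \<in> [0, h]\<close> bounds the multipliers of the other frequencies from below.
\<close>

lemma observable_insert:
  assumes C: "C \<ge> 0" and B: "B \<ge> 0" and e: "e > 0" and h: "h > 0"
  shows "\<exists>C'. 0 \<le> C' \<and> (\<forall>(A::'e::euclidean_space set) l0. finite A \<longrightarrow> bessel A (e + h) B \<longrightarrow>
    (\<forall>l\<in>A. \<exists>b\<in>Basis. 1 \<le> \<bar>(l - l0) \<bullet> b\<bar>) \<longrightarrow> observable A e C \<longrightarrow> observable (insert l0 A) (e + h) C')"
proof -
  obtain \<kappa> where \<kappa>: "\<kappa> > 0" "\<And>\<delta>. 1 \<le> \<bar>\<delta>\<bar> \<Longrightarrow> \<kappa> \<le> integral {0..h} (\<lambda>s. 2 - 2 * cos (s * \<delta>))"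
    using integral_one_minus_cos_ge[OF h] by auto
  define V where "V = integral (cube (e + h) :: 'e set) (\<lambda>_. 1::real)"
  have "0 < measure lborel (cube (e + h) :: 'e set)" unfolding cube_def using e h by (intro content_pos_lt) auto
  then have V: "V > 0" by (simp add: V_def cube_def del: content_cbox_if)
  \<comment> \<open>\<open>4 * C\<close> comes from the difference of two functions of energy at
    most \<open>E\<close>, \<open>h\<close> from averaging over \<open>s\<close>, the dimension from
    summing over all directions, and \<kappa> from the lower bound for the averaged
    multiplier.\<close>
  define K where "K = 4 * C * h * real DIM('e) / \<kappa>"
  have K: "K \<ge> 0" using C h \<kappa> by (simp add: K_def)
  have "observable (insert l0 A) (e + h) (K + (2 + 2 * B * K) / V)"
    if A: "finite A" and bes: "bessel A (e + h) B"
      and sep: "\<And>l. l \<in> A \<Longrightarrow> \<exists>b\<in>Basis. 1 \<le> \<bar>(l - l0) \<bullet> b\<bar>" and obs: "observable A e C"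
    for A :: "'e set" and l0
    unfolding observable_def
  proof
    fix c :: "'e \<Rightarrow> complex"
    have l0: "l0 \<notin> A" using sep[of l0] by auto
    let ?f = "trig_sum (insert l0 A) c"
    define E where "E = energy (e + h) ?f"
    have E0: "E \<ge> 0" by (simp add: E_def energy_nonneg)
    have f_split: "?f X = c l0 * cis (l0 \<bullet> X) + trig_sum A c X" for X
      using A l0 by (simp add: trig_sum_def)
    define \<delta> where "\<delta> b l = (l - l0) \<bullet> b" for b l
    have diff: "(\<Sum>l\<in>A. (cmod (c l))\<^sup>2 * (2 - 2 * cos (s * \<delta> b l))) \<le> 4 * C * E"
      if b: "b \<in> Basis" and s: "s \<in> {0..h}" for b s
    proof -
      let ?c = "\<lambda>l. c l * (cis (s * \<delta> b l) - 1)"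
      \<comment> \<open>The term of \<open>l0\<close> cancels, so the difference is a sum over
        \<open>A\<close> alone.\<close>
      have g: "trig_sum A ?c X = cis (- (s * (l0 \<bullet> b))) * ?f (s *\<^sub>R b + X) - ?f X" for X
      proof -
        have "cis (- (s * (l0 \<bullet> b))) * ?f (s *\<^sub>R b + X) - ?f X =
          (\<Sum>l\<in>insert l0 A. c l * cis (l \<bullet> X) * (cis (- (s * (l0 \<bullet> b))) * cis (s * (l \<bullet> b)) - 1))"
          unfolding trig_sum_def sum_distrib_left sum_subtractf[symmetric]
          by (intro sum.cong refl) (simp add: inner_add_right cis_mult[symmetric] algebra_simps)
        also have "\<dots> = (\<Sum>l\<in>insert l0 A. c l * cis (l \<bullet> X) * (cis (s * \<delta> b l) - 1))"
          by (simp add: cis_mult \<delta>_def inner_diff_left algebra_simps)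
        also have "\<dots> = trig_sum A ?c X"
          using A l0 by (simp add: trig_sum_def \<delta>_def mult_ac)
        finally show ?thesis by simp
      qed
      have "(\<Sum>l\<in>A. (cmod (c l))\<^sup>2 * (2 - 2 * cos (s * \<delta> b l))) = (\<Sum>l\<in>A. (cmod (?c l))\<^sup>2)"
        by (simp add: norm_mult power_mult_distrib cmod_cis_diff_one)
      also have "\<dots> \<le> C * energy e (trig_sum A ?c)"
        using obs by (simp add: observable_def)
      also have "energy e (trig_sum A ?c) = energy e (\<lambda>X. cis (- (s * (l0 \<bullet> b))) * ?f (s *\<^sub>R b + X) - ?f X)"
        by (intro arg_cong[where f = "energy e"] ext g)
      also have "\<dots> \<le> 2 * energy e (\<lambda>X. cis (- (s * (l0 \<bullet> b))) * ?f (s *\<^sub>R b + X)) + 2 * energy e ?f"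
        by (intro energy_diff_le continuous_intros)
      also have "energy e (\<lambda>X. cis (- (s * (l0 \<bullet> b))) * ?f (s *\<^sub>R b + X)) = energy e (\<lambda>X. ?f (s *\<^sub>R b + X))"
        by (rule energy_unimodular)
      also have "\<dots> \<le> E"
        unfolding E_def using s b by (intro energy_shift_le continuous_intros) (auto simp: inner_Basis)
      also have "energy e ?f \<le> E"
        unfolding E_def using h by (intro energy_mono continuous_intros) auto
      finally show ?thesis using C by (simp add: mult_left_mono)
    qed
    let ?I = "\<lambda>b l. integral {0..h} (\<lambda>s. 2 - 2 * cos (s * \<delta> b l))"
    have I0: "?I b l \<ge> 0" for b l
      by (rule Henstock_Kurzweil_Integration.integral_nonneg)
        (auto intro!: integrable_continuous_interval continuous_intros)
    have perb: "(\<Sum>l\<in>A. (cmod (c l))\<^sup>2 * ?I b l) \<le> 4 * C * E * h" if b: "b \<in> Basis" for b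
    proof -
      have "(\<Sum>l\<in>A. (cmod (c l))\<^sup>2 * ?I b l) = integral {0..h} (\<lambda>s. \<Sum>l\<in>A. (cmod (c l))\<^sup>2 * (2 - 2 * cos (s * \<delta> b l)))"
        using A by (subst Henstock_Kurzweil_Integration.integral_sum)
          (auto intro!: integrable_continuous_interval continuous_intros)
      also have "\<dots> \<le> integral {0..h} (\<lambda>s. 4 * C * E)"
        using diff[OF b] by (intro integral_le integrable_continuous_interval continuous_intros) auto
      also have "\<dots> = 4 * C * E * h" using h by simp
      finally show ?thesis .
    qed
    \<comment> \<open>The direction separating \<open>l\<close> from \<open>l0\<close> depends on
      \<open>l\<close>; the sum over all directions contains it, and the other terms are
      nonnegative.\<close>
    have "\<kappa> * (\<Sum>l\<in>A. (cmod (c l))\<^sup>2) \<le> (\<Sum>l\<in>A. \<Sum>b\<in>Basis. (cmod (c l))\<^sup>2 * ?I b l)"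
      unfolding sum_distrib_left
    proof (rule sum_mono)
      fix l assume "l \<in> A"
      then obtain b where b: "b \<in> Basis" "1 \<le> \<bar>\<delta> b l\<bar>" using sep by (auto simp: \<delta>_def)
      have "\<kappa> * (cmod (c l))\<^sup>2 \<le> (cmod (c l))\<^sup>2 * ?I b l"
        using \<kappa>(2)[OF b(2)] by (subst mult.commute, intro mult_left_mono) auto
      also have "\<dots> \<le> (\<Sum>b\<in>Basis. (cmod (c l))\<^sup>2 * ?I b l)"
        using b I0 by (intro member_le_sum[of b Basis "\<lambda>b. (cmod (c l))\<^sup>2 * ?I b l"]) auto
      finally show "\<kappa> * (cmod (c l))\<^sup>2 \<le> (\<Sum>b\<in>Basis. (cmod (c l))\<^sup>2 * ?I b l)" .
    qed
    also have "\<dots> = (\<Sum>b\<in>Basis. \<Sum>l\<in>A. (cmod (c l))\<^sup>2 * ?I b l)" by (rule sum.swap)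
    also have "\<dots> \<le> (\<Sum>b\<in>(Basis::'e set). 4 * C * E * h)" by (intro sum_mono perb)
    finally have SA: "(\<Sum>l\<in>A. (cmod (c l))\<^sup>2) \<le> K * E" using \<kappa> by (simp add: K_def field_simps)
    \<comment> \<open>The missing term has constant modulus, so its energy is \<open>V\<close> times
      its squared coefficient. It equals the full sum minus the sum over \<open>A\<close>, whose
      energy is bounded by Bessel and the estimate just obtained.\<close>
    have "(cmod (c l0))\<^sup>2 * V = energy (e + h) (\<lambda>X. c l0 * cis (l0 \<bullet> X))"
      unfolding energy_def V_def by (simp add: norm_mult cube_def)
    also have "\<dots> = energy (e + h) (\<lambda>X. ?f X - trig_sum A c X)" by (simp add: f_split)
    also have "\<dots> \<le> 2 * E + 2 * energy (e + h) (trig_sum A c)"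
      unfolding E_def by (intro energy_diff_le continuous_intros)
    also have "energy (e + h) (trig_sum A c) \<le> B * (\<Sum>l\<in>A. (cmod (c l))\<^sup>2)"
      using bes by (simp add: bessel_def)
    also have "\<dots> \<le> B * (K * E)" using SA B by (rule mult_left_mono)
    finally have "(cmod (c l0))\<^sup>2 \<le> (2 + 2 * B * K) / V * E" using V by (simp add: field_simps)
    then show "(\<Sum>l\<in>insert l0 A. (cmod (c l))\<^sup>2) \<le> (K + (2 + 2 * B * K) / V) * energy (e + h) ?f"
      using A l0 SA unfolding E_def[symmetric] by (simp add: distrib_right)
  qed
  moreover have "0 \<le> K + (2 + 2 * B * K) / V" using K B V by simp
  ultimately show ?thesis by blast
qed

text \<open>A gap of size 1 in the maximum norm: every pair of distinct frequencies is told apart by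
  translations in some coordinate direction, uniformly in the set.\<close>

definition separated :: "'e::euclidean_space set \<Rightarrow> bool" where
  "separated A \<longleftrightarrow> (\<forall>k\<in>A. \<forall>l\<in>A. k \<noteq> l \<longrightarrow> (\<exists>b\<in>Basis. 1 \<le> \<bar>(k - l) \<bullet> b\<bar>))"

text \<open>Only the number of added frequencies enters the constant, not their position, so
  induction on that number keeps the bound uniform. Half of \<open>h\<close> goes to the first
  \<open>N\<close> insertions and half to the last one.\<close>

lemma observable_union:
  assumes B: "B \<ge> 0"
  shows "C \<ge> 0 \<Longrightarrow> e > 0 \<Longrightarrow> h > 0 \<Longrightarrow> \<exists>C'. 0 \<le> C' \<and> (\<forall>(A::'e::euclidean_space set) F. finite A \<longrightarrow> finite F \<longrightarrow>
    card F \<le> N \<longrightarrow> bessel (A \<union> F) (e + h) B \<longrightarrow> separated (A \<union> F) \<longrightarrow> observable A e C \<longrightarrow> observable (A \<union> F) (e + h) C')"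
proof (induction N arbitrary: C e h)
  case 0
  then show ?case by (intro exI[of _ C]) (auto intro: observable_mono)
next
  case (Suc N)
  have h2: "h / 2 > 0" "e + h / 2 > 0" using Suc.prems by simp_all
  from Suc.IH[OF Suc.prems(1,2) h2(1)] obtain C1 where C1: "0 \<le> C1" and
    1: "\<And>(A::'e set) F. finite A \<Longrightarrow> finite F \<Longrightarrow> card F \<le> N \<Longrightarrow> bessel (A \<union> F) (e + h/2) B \<Longrightarrow> separated (A \<union> F) \<Longrightarrow>
      observable A e C \<Longrightarrow> observable (A \<union> F) (e + h/2) C1" by blast
  have eq: "e + h / 2 + h / 2 = e + h" by simp
  from observable_insert[OF C1 B h2(2,1), unfolded eq] obtain C2 where C2: "0 \<le> C2" and
    2: "\<forall>(A::'e set) l0. finite A \<longrightarrow> bessel A (e + h) B \<longrightarrow> (\<forall>l\<in>A. \<exists>b\<in>Basis. 1 \<le> \<bar>(l - l0) \<bullet> b\<bar>) \<longrightarrow>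
      observable A (e + h/2) C1 \<longrightarrow> observable (insert l0 A) (e + h) C2"
    by (elim exE conjE) 
  show ?case
  \<comment> \<open>If nothing new is added, only \<open>C1\<close> is available; otherwise
    \<open>C2\<close> is.\<close>
  proof (rule exI[of _ "max C1 C2"], intro conjI allI impI)
    show "0 \<le> max C1 C2" using C1 by simp
    fix A F :: "'e set"
    assume A: "finite A" and F: "finite F" "card F \<le> Suc N" and bes: "bessel (A \<union> F) (e + h) B"
      and sep: "separated (A \<union> F)" and obs: "observable A e C"
    have bes': "bessel (A \<union> F) (e + h/2) B" using bes by (rule bessel_mono) (use Suc.prems in simp)
    show "observable (A \<union> F) (e + h) (max C1 C2)"
    proof (cases "F \<subseteq> A")
      case True
      then have "A \<union> F = A" by auto
      then show ?thesis using 1[of A "{}"] A bes' sep obs C1 Suc.prems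
        by (auto intro!: observable_mono[of A "e + h/2" C1])
    next
      case False
      then obtain l0 where l0: "l0 \<in> F" "l0 \<notin> A" by auto
      let ?A = "A \<union> (F - {l0})"
      have sub: "?A \<subseteq> A \<union> F" by auto
      have "observable ?A (e + h/2) C1"
      proof (rule 1)
        show "card (F - {l0}) \<le> N" using F l0 by simp
        show "bessel ?A (e + h/2) B" using bessel_subset[OF bes' _ sub] A F by simp
        show "separated ?A" using sep unfolding separated_def by blast
      qed (use A F obs in auto)
      moreover have "bessel ?A (e + h) B" using bessel_subset[OF bes _ sub] A F by simp
      moreover have "\<forall>l\<in>?A. \<exists>b\<in>Basis. 1 \<le> \<bar>(l - l0) \<bullet> b\<bar>"
      proof
        fix l assume that: "l \<in> ?A"
        have "l \<noteq> l0" "l \<in> A \<union> F" "l0 \<in> A \<union> F" using that l0 by auto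
        then show "\<exists>b\<in>Basis. 1 \<le> \<bar>(l - l0) \<bullet> b\<bar>" using sep unfolding separated_def by blast
      qed
      ultimately have "observable (insert l0 ?A) (e + h) C2" using A F by (intro 2[rule_format]) auto
      moreover have "insert l0 ?A = A \<union> F" using l0 by auto
      ultimately show ?thesis using C2 by (auto intro: observable_mono)
    qed
  qed
qed

text \<open>A functional bounded on \<open>G\<close> is bounded on its span with a constant
  depending on \<open>G\<close> alone: expand in a basis \<open>D\<close> chosen inside
  \<open>G\<close> and bound the coordinate functionals. Later \<open>G\<close> ranges over the
  subsets of one finite set, so the constants can be made uniform.\<close>

lemma inner_span_le:
  fixes G :: "'e::euclidean_space set"
  assumes G: "finite G"
  shows "\<exists>\<kappa>\<ge>0. \<forall>v w L. w \<in> span G \<longrightarrow> (\<forall>h\<in>G. \<bar>v \<bullet> h\<bar> \<le> L) \<longrightarrow> \<bar>v \<bullet> w\<bar> \<le> \<kappa> * norm w * L"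
proof -
  obtain D where D: "D \<subseteq> G" "independent D" "G \<subseteq> span D"
    by (rule maximal_independent_subset)
  have fD: "finite D" using D G finite_subset by blast
  have spanD: "span D = span G" using D by (metis span_mono span_span subset_antisym)
  \<comment> \<open>The coordinate functionals of \<open>D\<close>, extended linearly to the whole
    space.\<close>
  have "\<exists>g. linear g \<and> (\<forall>x\<in>D. g x = (if x = b then 1 else 0 :: real))" for b
    by (rule linear_independent_extend[OF D(2)])
  then obtain g where g: "\<And>b. linear (g b)" "\<And>b x. x \<in> D \<Longrightarrow> g b x = (if x = b then 1 else 0 :: real)" by metis
  have "\<exists>K\<ge>0. \<forall>x. norm (g b x) \<le> K * norm x" for b
    using linear_bounded_pos[OF g(1)[of b]] by (metis less_imp_le)
  then obtain K where K: "\<And>b. K b \<ge> 0" "\<And>b x. norm (g b x) \<le> K b * norm x" by metis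
  have rep: "w = (\<Sum>b\<in>D. g b w *\<^sub>R b)" if "w \<in> span G" for w
  proof -
    have "id w = (\<Sum>b\<in>D. g b w *\<^sub>R b)"
    proof (rule linear_eq_on[where f = id and B = D])
      show "linear (\<lambda>w. \<Sum>b\<in>D. g b w *\<^sub>R b)"
        by (intro linear_compose_sum ballI linearI)
          (simp_all add: linear_add[OF g(1)] linear_cmul[OF g(1)] scaleR_add_left)
      show "id x = (\<Sum>b\<in>D. g b x *\<^sub>R b)" if x: "x \<in> D" for x
      proof -
        have "(\<Sum>b\<in>D. g b x *\<^sub>R b) = (\<Sum>b\<in>D. if x = b then b else 0)"
          using g(2)[OF x] by (intro sum.cong) auto
        then show ?thesis using fD x by simp
      qed
    qed (use that spanD in \<open>auto intro: linear_id\<close>)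
    then show ?thesis by simp
  qed
  show ?thesis
  proof (intro exI[of _ "\<Sum>b\<in>D. K b"] conjI allI impI)
    show "0 \<le> (\<Sum>b\<in>D. K b)" using K by (simp add: sum_nonneg)
    fix v w :: 'e and L
    assume w: "w \<in> span G" and v: "\<forall>h\<in>G. \<bar>v \<bullet> h\<bar> \<le> L"
    have "\<bar>v \<bullet> w\<bar> = \<bar>\<Sum>b\<in>D. g b w * (v \<bullet> b)\<bar>"
      by (subst rep[OF w]) (simp add: inner_sum_right)
    also have "\<dots> \<le> (\<Sum>b\<in>D. \<bar>g b w\<bar> * \<bar>v \<bullet> b\<bar>)"
      by (rule order_trans[OF sum_abs]) (simp add: abs_mult)
    also have "\<dots> \<le> (\<Sum>b\<in>D. (K b * norm w) * L)"
      using K v D(1) by (intro sum_mono mult_mono) auto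
    also have "\<dots> = (\<Sum>b\<in>D. K b) * norm w * L" by (simp add: sum_distrib_right)
    finally show "\<bar>v \<bullet> w\<bar> \<le> (\<Sum>b\<in>D. K b) * norm w * L" .
  qed
qed

section \<open>Lattice points on paraboloids\<close>

text \<open>The linear term comes from shifted lattices: \<open>|k + \<theta>|^2 = k \<bullet> k +
  (2 \<theta>) \<bullet> k + |\<theta>|^2\<close>, where the last summand is a common phase in time.
  Thus \<open>a = 2 \<theta>\<close>.\<close>

definition paraboloid_point :: "'e::euclidean_space \<Rightarrow> 'e \<Rightarrow> 'e \<times> real" where
  "paraboloid_point a k = (k, k \<bullet> k + a \<bullet> k)"

lemma inj_paraboloid_point: "inj (paraboloid_point a)"
  by (auto simp: paraboloid_point_def inj_def)

lemma cube_prod: "(cube e :: ('e::euclidean_space \<times> real) set) = cbox (- (e *\<^sub>R One), - e) (e *\<^sub>R One, e)"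
proof -
  have "z \<in> cube e \<longleftrightarrow> z \<in> cbox (- (e *\<^sub>R One), - e) (e *\<^sub>R One, e)" for z :: "'e \<times> real"
    by (cases z) (auto simp: mem_cube cbox_Pair_eq Basis_prod_def mem_box abs_le_iff)
  then show ?thesis by blast
qed

text \<open>For \<open>e \<le> pi\<close> the cube fits into one period, on which Parseval is
  exact.\<close>

lemma energy_trig_sum_lattice_le:
  fixes K :: "'e::euclidean_space set"
  assumes K: "finite K" "K \<subseteq> int_lattice" and e: "e \<le> pi"
  shows "energy e (trig_sum K a) \<le> (2 * pi) ^ DIM('e) * (\<Sum>k\<in>K. (cmod (a k))\<^sup>2)"
proof -
  have cell: "prod_cell {-pi..pi} = (cube pi :: 'e set)"
  proof -
    have "s \<in> {-pi..pi} \<longleftrightarrow> \<bar>s\<bar> \<le> pi" for s by auto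
    then show ?thesis by (simp only: prod_cell_def mem_cube set_eq_iff mem_Collect_eq) simp
  qed
  have ortho: "(LINT s:{-pi..pi}|lborel. cis (1 * of_int n * s)) = (if n = 0 then of_real (2 * pi) else 0)" for n :: int
    using integral_cis_period(1)[of 1 pi "-pi" n] by simp
  have "energy e (trig_sum K a) \<le> energy pi (trig_sum K a)"
    by (intro energy_mono continuous_intros e)
  also have "\<dots> = (LINT x:cube pi|lborel. (cmod (\<Sum>k\<in>K. a k * cis (1 * (k \<bullet> x))))\<^sup>2)"
  proof -
    have "continuous_on (cube pi) (\<lambda>x. (cmod (trig_sum K a x))\<^sup>2)" by (intro continuous_intros)
    then have "set_integrable lborel (cube pi) (\<lambda>x. (cmod (trig_sum K a x))\<^sup>2)"
      unfolding set_integrable_def indicator_scaleR_eq_if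
      by (intro borel_integrable_compact) (simp_all add: cube_def)
    from set_borel_integral_eq_integral(2)[OF this] show ?thesis
      by (simp add: energy_def trig_sum_def)
  qed
  also have "\<dots> = (2 * pi) ^ DIM('e) * (\<Sum>k\<in>K. (cmod (a k))\<^sup>2)"
    unfolding cell[symmetric] by (intro parseval_finite_prod_cell K ortho) auto
  finally show ?thesis .
qed

text \<open>At each fixed time the temporal phase only multiplies the coefficients by unimodular
  numbers, so the spatial bound holds with a constant free of \<open>a\<close> and \<open>S\<close>;
  it is then integrated over a time interval of length at most \<open>2 * pi\<close>.\<close>

lemma bessel_paraboloid:
  fixes S :: "'e::euclidean_space set"
  assumes S: "finite S" "S \<subseteq> int_lattice" and e: "0 \<le> e" "e \<le> pi"
  shows "bessel (paraboloid_point a ` S) e ((2 * pi) ^ DIM('e) * (2 * pi))"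
  unfolding bessel_def
proof
  fix c :: "'e \<times> real \<Rightarrow> complex"
  let ?g = "paraboloid_point a"
  let ?c = "\<lambda>t k. c (?g k) * cis ((k \<bullet> k + a \<bullet> k) * t)"
  let ?N = "\<Sum>k\<in>S. (cmod (c (?g k)))\<^sup>2"
  have inj: "inj_on ?g S" using inj_paraboloid_point by (rule inj_on_subset) auto
  have ts: "trig_sum (?g ` S) c (x, t) = trig_sum S (?c t) x" for x t
    unfolding trig_sum_def by (subst sum.reindex[OF inj], simp add: o_def, intro sum.cong refl)
      (simp add: paraboloid_point_def cis_mult[symmetric])
  have cont: "continuous_on U (\<lambda>(x, t). (cmod (trig_sum S (?c t) x))\<^sup>2)" for U
    unfolding ts[symmetric] split_beta by (simp only: prod.collapse) (intro continuous_intros)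
  have "energy e (trig_sum (?g ` S) c) = integral (cbox (- (e *\<^sub>R One)) (e *\<^sub>R One))
      (\<lambda>x. integral (cbox (-e) e) (\<lambda>t. (cmod (trig_sum S (?c t) x))\<^sup>2))"
    unfolding energy_def cube_prod by (subst integral_prod_continuous) (auto simp: ts intro!: continuous_intros)
  also have "\<dots> = integral (cbox (-e) e) (\<lambda>t. energy e (trig_sum S (?c t)))"
    unfolding energy_def cube_def by (rule integral_swap_continuous) (rule cont)
  also have "\<dots> \<le> integral (cbox (-e) e) (\<lambda>t. (2 * pi) ^ DIM('e) * ?N)"
  proof (rule integral_le)
    show "(\<lambda>t. energy e (trig_sum S (?c t))) integrable_on cbox (-e) e"
      unfolding energy_def cube_def
      unfolding ts[symmetric]
      by (intro integrable_continuous integral_continuous_on_param)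
        (simp add: split_beta, intro continuous_intros)
    fix t
    show "energy e (trig_sum S (?c t)) \<le> (2 * pi) ^ DIM('e) * ?N"
      using energy_trig_sum_lattice_le[OF S e(2), of "?c t"] by (simp add: norm_mult)
  qed auto
  also have "\<dots> = (2 * e) * ((2 * pi) ^ DIM('e) * ?N)" using e by simp
  also have "\<dots> \<le> (2 * pi) * ((2 * pi) ^ DIM('e) * ?N)"
    using e by (intro mult_right_mono mult_nonneg_nonneg sum_nonneg) auto
  also have "\<dots> = (2 * pi) ^ DIM('e) * (2 * pi) * (\<Sum>l\<in>?g ` S. (cmod (c l))\<^sup>2)"
    by (simp add: sum.reindex[OF inj] mult_ac)
  finally show "energy e (trig_sum (?g ` S) c) \<le> (2 * pi) ^ DIM('e) * (2 * pi) * (\<Sum>l\<in>?g ` S. (cmod (c l))\<^sup>2)" .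
qed

lemma separated_paraboloid:
  assumes "S \<subseteq> int_lattice"
  shows "separated (paraboloid_point a ` S)"
  unfolding separated_def
proof (intro ballI impI)
  fix l l' assume l: "l \<in> paraboloid_point a ` S" "l' \<in> paraboloid_point a ` S" "l \<noteq> l'"
  then obtain k k' where k: "l = paraboloid_point a k" "l' = paraboloid_point a k'" "k \<in> S" "k' \<in> S" "k \<noteq> k'" by auto
  obtain b where b: "b \<in> Basis" "1 \<le> \<bar>(k - k') \<bullet> b\<bar>"
    using int_lattice_eqI[of k k'] k assms by (meson not_le subsetD)
  then show "\<exists>b\<in>Basis. 1 \<le> \<bar>(l - l') \<bullet> b\<bar>"
    by (intro bexI[of _ "(b, 0)"]) (auto simp: k paraboloid_point_def Basis_prod_def)
qed

text \<open>The strict inequality makes \<open>r = 0\<close> the case of the empty set, the only set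
  of negative affine dimension. In the step the induction hypothesis is used on the cube of size
  \<open>e / 4\<close>, the windows enlarge it to \<open>e / 2\<close>, and the exceptional points
  enlarge it to \<open>e\<close>.\<close>

theorem observable_paraboloid_aff_dim:
  "0 < e \<Longrightarrow> e \<le> pi \<Longrightarrow> \<exists>C\<ge>0. \<forall>(S::'e::euclidean_space set) a. finite S \<longrightarrow> S \<subseteq> int_lattice \<longrightarrow>
    aff_dim S < int r \<longrightarrow> observable (paraboloid_point a ` S) e C"
proof (induction r arbitrary: e)
  case 0
  then show ?case by (intro exI[of _ 0]) (auto simp: observable_empty)
next
  case (Suc r)
  define B where "B = (2 * pi) ^ DIM('e) * (2 * pi)"
  have B: "B \<ge> 0" by (simp add: B_def)
  have e4: "0 < e / 4" "e / 4 \<le> pi" and e2: "0 < e / 2" using Suc.prems by auto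
  from Suc.IH[OF e4] obtain C0 where C0: "C0 \<ge> 0" and
    low: "\<And>(S::'e set) a. finite S \<Longrightarrow> S \<subseteq> int_lattice \<Longrightarrow> aff_dim S < int r \<Longrightarrow> observable (paraboloid_point a ` S) (e / 4) C0"
    by blast
  have eq: "e / 4 + e / 4 = e / 2" "e / 2 + e / 2 = e" by auto
  from observable_from_windows[OF finite_Basis subset_refl B C0 e4(1), of "e / 4", unfolded eq]
  obtain M C1 where C1: "0 \<le> C1" and
    windows: "\<forall>A. finite A \<longrightarrow> bessel A (e / 2) B \<longrightarrow>
     (\<forall>\<mu>::'e \<times> real. observable {l\<in>A. \<forall>b\<in>Basis. \<bar>l \<bullet> b - \<mu> \<bullet> b\<bar> \<le> M} (e / 4) C0) \<longrightarrow> observable A (e / 2) C1"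
    by (elim exE conjE)
  \<comment> \<open>Two points of one window differ by at most \<open>2 * \<bar>M\<bar>\<close> in
    every coordinate. \<open>R\<close> bounds the norm of their spatial difference through the sum
    of coordinates. The temporal difference is a linear term plus a square of size at most
    \<open>R^2\<close>, which gives the bound \<open>L\<close> for the linear term.\<close>
  define R where "R = real DIM('e) * (2 * \<bar>M\<bar>)"
  define L where "L = 2 * \<bar>M\<bar> + R\<^sup>2"
  have RL: "0 \<le> R" "0 \<le> L" by (auto simp: R_def L_def)
  define F where "F = {h \<in> int_lattice :: 'e set. norm h \<le> R}"
  have F: "finite F" unfolding F_def by (rule finite_int_lattice_bounded)
  have "\<exists>\<kappa>\<ge>0. \<forall>v w L. w \<in> span G \<longrightarrow> (\<forall>h\<in>G. \<bar>v \<bullet> h\<bar> \<le> L) \<longrightarrow> \<bar>v \<bullet> w\<bar> \<le> \<kappa> * norm w * L" if "G \<subseteq> F" for G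
    by (rule inner_span_le) (use that F finite_subset in blast)
  then obtain k where k: "\<And>G. G \<subseteq> F \<Longrightarrow> k G \<ge> 0"
    "\<And>G v w L. G \<subseteq> F \<Longrightarrow> w \<in> span G \<Longrightarrow> (\<forall>h\<in>G. \<bar>v \<bullet> h\<bar> \<le> L) \<Longrightarrow> \<bar>v \<bullet> w\<bar> \<le> k G * norm w * L" by metis
  \<comment> \<open>The sum dominates the constants of all subsets of \<open>F\<close>. As
    \<open>F\<close> depends only on \<open>R\<close>, so does \<kappa>: neither \<open>S\<close>
    nor \<open>a\<close> enters.\<close>
  define \<kappa> where "\<kappa> = (\<Sum>G\<in>Pow F. k G)"
  have \<kappa>: "\<bar>v \<bullet> w\<bar> \<le> \<kappa> * norm w * L" if "G \<subseteq> F" "w \<in> span G" "\<And>h. h \<in> G \<Longrightarrow> \<bar>v \<bullet> h\<bar> \<le> L" for G v w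
  proof -
    have "k G \<le> \<kappa>" unfolding \<kappa>_def using that(1) k(1) F by (intro member_le_sum) auto
    then have "k G * norm w * L \<le> \<kappa> * norm w * L" using RL by (intro mult_right_mono) auto
    then show ?thesis using k(2)[OF that(1,2), of v L] that(3) by force
  qed
  \<comment> \<open>Exceptional points will be shown to lie within distance
    \<open>\<kappa> * L\<close> of each other, so this counts all possible differences from one of
    them.\<close>
  define N where "N = card {h \<in> int_lattice :: 'e set. norm h \<le> \<kappa> * L}"
  from observable_union[OF B C1 e2 e2, of N, unfolded eq]
  obtain C2 where C2: "0 \<le> C2" and union: "\<forall>(A::('e \<times> real) set) F. finite A \<longrightarrow> finite F \<longrightarrow>
    card F \<le> N \<longrightarrow> bessel (A \<union> F) e B \<longrightarrow> separated (A \<union> F) \<longrightarrow> observable A (e / 2) C1 \<longrightarrow> observable (A \<union> F) e C2"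
    by (elim exE conjE)
  have "observable (paraboloid_point a ` S) e C2"
    if S: "finite S" "S \<subseteq> int_lattice" and dimS: "aff_dim S < int (Suc r)" for S :: "'e set" and a
  proof -
    let ?g = "paraboloid_point a"
    define near where "near k0 = {k \<in> S. norm (k - k0) \<le> R \<and> \<bar>(2 *\<^sub>R k0 + a) \<bullet> (k - k0)\<bar> \<le> L}" for k0
    \<comment> \<open>The points whose neighbourhood is too large in dimension for the induction
      hypothesis.\<close>
    define bad where "bad = {k0 \<in> S. int r \<le> aff_dim (near k0)}"
    have bad_span: "\<bar>(2 *\<^sub>R k0 + a) \<bullet> (k1 - k0)\<bar> \<le> \<kappa> * norm (k1 - k0) * L"
      if k0: "k0 \<in> bad" and k1: "k1 \<in> S" for k0 k1
    proof (rule \<kappa>)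
      let ?G = "(\<lambda>k. k - k0) ` near k0"
      have k0S: "k0 \<in> S" using k0 by (simp add: bad_def)
      show "?G \<subseteq> F" using S(2) k0S by (auto simp: F_def near_def intro: int_lattice_diff)
      show "\<bar>(2 *\<^sub>R k0 + a) \<bullet> h\<bar> \<le> L" if "h \<in> ?G" for h using that by (auto simp: near_def)
      have k0n: "k0 \<in> near k0" using k0S RL by (simp add: near_def)
      \<comment> \<open>The neighbourhood of an exceptional point has the full affine dimension of
        \<open>S\<close>, so its differences span all differences in \<open>S\<close>. The bound
        \<open>L\<close> on the spanning vectors thus reaches every \<open>k1 - k0\<close>.\<close>
      have "int (dim ((\<lambda>k. k - k0) ` S)) \<le> int r"
        using dimS aff_dim_eq_dim_subtract[OF hull_inc[OF k0S]] by simp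
      also have "\<dots> \<le> int (dim ?G)"
        using k0 aff_dim_eq_dim_subtract[OF hull_inc[OF k0n]] by (simp add: bad_def)
      finally have "dim ((\<lambda>k. k - k0) ` S) \<le> dim ?G" by simp
      moreover have "?G \<subseteq> (\<lambda>k. k - k0) ` S" by (auto simp: near_def)
      ultimately have "span ?G = span ((\<lambda>k. k - k0) ` S)" by (metis dim_eq_span)
      then show "k1 - k0 \<in> span ?G" using k1 by (auto intro: span_base)
    qed
    have bad_close: "norm (k1 - k0) \<le> \<kappa> * L" if k0: "k0 \<in> bad" and k1: "k1 \<in> bad" for k0 k1
    proof (cases "k1 = k0")
      case True
      have "0 \<le> \<kappa>" unfolding \<kappa>_def using k(1) by (intro sum_nonneg) auto
      then show ?thesis using True RL by simp
    next
      case False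
      have S01: "k0 \<in> S" "k1 \<in> S" using k0 k1 by (auto simp: bad_def)
      \<comment> \<open>Both linear bounds apply to the same pair of points, and \<open>a\<close>
        drops out.\<close>
      have "2 * (norm (k1 - k0))\<^sup>2 = - ((2 *\<^sub>R k1 + a) \<bullet> (k0 - k1)) - (2 *\<^sub>R k0 + a) \<bullet> (k1 - k0)"
        by (simp add: power2_norm_eq_inner inner_diff_left inner_diff_right inner_add_left inner_add_right inner_commute)
      also have "\<dots> \<le> 2 * (\<kappa> * norm (k1 - k0) * L)"
        using bad_span[OF k0 S01(2)] bad_span[OF k1 S01(1)] by (simp add: norm_minus_commute)
      finally have "norm (k1 - k0) * norm (k1 - k0) \<le> norm (k1 - k0) * (\<kappa> * L)"
        by (simp add: power2_eq_square mult_ac)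
      then show ?thesis using False by simp
    qed
    have card_bad: "card bad \<le> N"
    proof (cases "bad = {}")
      case False
      then obtain k0 where k0: "k0 \<in> bad" by auto
      have "(\<lambda>k. k - k0) ` bad \<subseteq> {h \<in> int_lattice. norm h \<le> \<kappa> * L}"
        using bad_close[OF k0] k0 S(2) by (auto simp: bad_def intro!: int_lattice_diff)
      then have "card ((\<lambda>k. k - k0) ` bad) \<le> N"
        unfolding N_def by (rule card_mono[OF finite_int_lattice_bounded])
      then show ?thesis by (subst (asm) card_image) (auto simp: inj_on_def)
    qed simp
    have finbad: "finite bad" using S by (simp add: bad_def)
    define S' where "S' = S - bad"
    have S': "finite S'" "S' \<subseteq> int_lattice" using S by (auto simp: S'_def)
    have "observable (?g ` S') (e / 2) C1"
    proof (rule windows[rule_format])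
      show "bessel (?g ` S') (e / 2) B"
        unfolding B_def using Suc.prems by (intro bessel_paraboloid S') auto
      fix \<mu> :: "'e \<times> real"
      let ?W = "{l \<in> ?g ` S'. \<forall>b\<in>Basis. \<bar>l \<bullet> b - \<mu> \<bullet> b\<bar> \<le> M}"
      show "observable ?W (e / 4) C0"
      proof (cases "?W = {}")
        case True
        then show ?thesis using C0 by (simp only: observable_empty)
      next
        case False
        \<comment> \<open>Any point of the window serves as its centre. It is not exceptional, so
          the set near it falls under the induction hypothesis.\<close>
        then obtain k0 where k0: "k0 \<in> S'" "?g k0 \<in> ?W" by auto
        have "?W \<subseteq> ?g ` near k0"
        proof
          fix l assume l: "l \<in> ?W"
          then obtain k where k: "k \<in> S'" "l = ?g k" by auto
          have diff: "\<bar>(?g k - ?g k0) \<bullet> b\<bar> \<le> 2 * \<bar>M\<bar>" if b: "b \<in> Basis" for b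
          proof -
            have "\<bar>?g k \<bullet> b - \<mu> \<bullet> b\<bar> \<le> M" "\<bar>?g k0 \<bullet> b - \<mu> \<bullet> b\<bar> \<le> M" using l k k0 b by auto
            then show ?thesis by (simp add: inner_diff_left)
          qed
          have "\<bar>(k - k0) \<bullet> b\<bar> \<le> 2 * \<bar>M\<bar>" if b: "b \<in> Basis" for b
            using diff[of "(b, 0)"] b by (simp add: paraboloid_point_def Basis_prod_def)
          then have "norm (k - k0) \<le> (\<Sum>b\<in>(Basis::'e set). 2 * \<bar>M\<bar>)"
            by (intro order_trans[OF norm_le_l1] sum_mono) auto
          then have nR: "norm (k - k0) \<le> R" by (simp add: R_def)
          \<comment> \<open>Expansion of the quadratic polynomial at \<open>k0\<close>: the temporal
            difference is its derivative at \<open>k0\<close> applied to \<open>k - k0\<close>, plus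
            the squared distance.\<close>
          have "(2 *\<^sub>R k0 + a) \<bullet> (k - k0) = (?g k - ?g k0) \<bullet> (0, 1) - (norm (k - k0))\<^sup>2"
            by (simp add: paraboloid_point_def power2_norm_eq_inner inner_diff_left inner_diff_right
                inner_add_left inner_add_right inner_commute)
          moreover have "\<bar>(?g k - ?g k0) \<bullet> (0, 1)\<bar> \<le> 2 * \<bar>M\<bar>"
            by (rule diff) (simp add: Basis_prod_def)
          moreover have "(norm (k - k0))\<^sup>2 \<le> R\<^sup>2" using nR by (intro power_mono) auto
          ultimately have "\<bar>(2 *\<^sub>R k0 + a) \<bullet> (k - k0)\<bar> \<le> L"
            unfolding L_def using zero_le_power2[of "norm (k - k0)"] by linarith
          then show "l \<in> ?g ` near k0" using k nR by (auto simp: near_def S'_def)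
        qed
        moreover have "observable (?g ` near k0) (e / 4) C0"
        proof (rule low)
          show "aff_dim (near k0) < int r" using k0 by (auto simp: S'_def bad_def)
        qed (use S in \<open>auto simp: near_def\<close>)
        moreover have "finite (?g ` near k0)" using S by (simp add: near_def)
        ultimately show ?thesis using observable_subset by blast
      qed
    qed (use S' in auto)
    moreover have eqS: "?g ` S' \<union> ?g ` bad = ?g ` S" by (auto simp: S'_def bad_def)
    moreover have "card (?g ` bad) \<le> N" using card_bad card_image_le[OF finbad] by (rule le_trans[rotated])
    moreover have "bessel (?g ` S) e B" unfolding B_def using Suc.prems by (intro bessel_paraboloid S) auto
    moreover have "separated (?g ` S)" by (rule separated_paraboloid[OF S(2)])
    ultimately show ?thesis using union[rule_format, of "?g ` S'" "?g ` bad"] S' finbad by auto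
  qed
  then show ?case using C2 by blast
qed

theorem observable_paraboloid:
  assumes "0 < e" "e \<le> pi"
  shows "\<exists>C\<ge>0. \<forall>(S::'e::euclidean_space set) a. finite S \<longrightarrow> S \<subseteq> int_lattice \<longrightarrow> observable (paraboloid_point a ` S) e C"
  using observable_paraboloid_aff_dim[OF assms, of "Suc DIM('e)"] aff_dim_le_DIM
  by (metis of_nat_Suc add.commute zle_add1_eq_le)

section \<open>Parseval's identity on the unit cell\<close>

abbreviation esq :: "complex \<Rightarrow> ennreal" where
  "esq z \<equiv> ennreal ((cmod z)\<^sup>2)"

text \<open>Extended nonnegative values keep estimates and limits free of integrability conditions,
  whereas \<open>L2_norm\<close> is 0 on functions that are not square-integrable.\<close>

definition sq_norm :: "'a measure \<Rightarrow> ('a \<Rightarrow> complex) \<Rightarrow> ennreal" where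
  "sq_norm M f = (\<integral>\<^sup>+z. esq (f z) \<partial>M)"

lemma sq_norm_add_le:
  assumes [measurable]: "f \<in> borel_measurable M" "g \<in> borel_measurable M"
  shows "sq_norm M (\<lambda>z. f z + g z) \<le> 2 * sq_norm M f + 2 * sq_norm M g"
proof -
  have "sq_norm M (\<lambda>z. f z + g z) \<le> (\<integral>\<^sup>+z. 2 * esq (f z) + 2 * esq (g z) \<partial>M)"
    unfolding sq_norm_def
  proof (rule nn_integral_mono)
    fix z
    have "esq (f z + g z) \<le> ennreal (2 * (cmod (f z))\<^sup>2 + 2 * (cmod (g z))\<^sup>2)"
      by (intro ennreal_leI cmod_add_squared_le)
    then show "esq (f z + g z) \<le> 2 * esq (f z) + 2 * esq (g z)"
      by (simp add: ennreal_plus ennreal_mult)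
  qed
  also have "\<dots> = 2 * sq_norm M f + 2 * sq_norm M g"
    unfolding sq_norm_def by (simp add: nn_integral_add nn_integral_cmult)
  finally show ?thesis .
qed

lemma sq_norm_minus: "sq_norm M (\<lambda>z. f z - g z) = sq_norm M (\<lambda>z. g z - f z)"
  by (simp add: sq_norm_def norm_minus_commute)

lemma sq_norm_diff_le:
  assumes [measurable]: "f \<in> borel_measurable M" "g \<in> borel_measurable M"
  shows "sq_norm M (\<lambda>z. f z - g z) \<le> 2 * sq_norm M f + 2 * sq_norm M g"
  using sq_norm_add_le[of f M "\<lambda>z. - g z"] by (simp add: sq_norm_def)

lemma sq_norm_cmult: 
  assumes [measurable]: "f \<in> borel_measurable M"
  shows "sq_norm M (\<lambda>z. c * f z) = esq c * sq_norm M f"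
  unfolding sq_norm_def by (subst nn_integral_cmult[symmetric]) (auto simp: norm_mult power_mult_distrib ennreal_mult)

text \<open>On a set of finite measure square integrability implies integrability, by
  \<open>2 * x \<le> 1 + x^2\<close>.\<close>

lemma integrable_mult_finite_support:
  assumes [measurable]: "w \<in> borel_measurable M" "f \<in> borel_measurable M" "S \<in> sets M"
    and fin: "sq_norm M w < \<infinity>" and S: "emeasure M S < \<infinity>" "\<And>z. z \<in> space M \<Longrightarrow> z \<notin> S \<Longrightarrow> w z = 0"
    and f: "\<And>z. cmod (f z) \<le> 1"
  shows "integrable M (\<lambda>z. f z * w z)"
proof (rule Bochner_Integration.integrable_bound)
  have "integrable M (\<lambda>z. (cmod (w z))\<^sup>2)"
    by (rule integrableI_bounded) (use fin in \<open>auto simp: sq_norm_def\<close>)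
  then show "integrable M (\<lambda>z. indicator S z + (cmod (w z))\<^sup>2)"
    using S(1) by (intro Bochner_Integration.integrable_add integrable_real_indicator) auto
  show "AE z in M. norm (f z * w z) \<le> norm (indicator S z + (cmod (w z))\<^sup>2)"
  proof (rule AE_I2)
    fix z assume z: "z \<in> space M"
    have fw: "norm (f z * w z) \<le> cmod (w z)"
      using mult_right_mono[OF f, of "cmod (w z)" z] by (simp add: norm_mult)
    have "2 * cmod (w z) \<le> 1 + (cmod (w z))\<^sup>2"
      using zero_le_power2[of "cmod (w z) - 1"] by (simp add: power2_eq_square algebra_simps)
    then show "norm (f z * w z) \<le> norm (indicator S z + (cmod (w z))\<^sup>2)"
      using fw S(2)[OF z] norm_ge_zero[of "w z"] by (cases "z \<in> S") (auto simp del: norm_ge_zero)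
  qed
qed measurable

section \<open>Trigonometric polynomials of period one\<close>

inductive trig_poly :: "('e::euclidean_space \<Rightarrow> complex) \<Rightarrow> bool" where
  monomial: "q \<in> int_lattice \<Longrightarrow> trig_poly (\<lambda>x. c * cis (2 * pi * (q \<bullet> x)))"
| add: "trig_poly f \<Longrightarrow> trig_poly g \<Longrightarrow> trig_poly (\<lambda>x. f x + g x)"

lemma trig_poly_const: "trig_poly (\<lambda>x. c)"
  using trig_poly.monomial[OF int_lattice_0, of c] by simp

lemma trig_poly_mult:
  assumes "trig_poly f" "trig_poly g"
  shows "trig_poly (\<lambda>x. f x * g x)"
  using assms(1)
proof induction
  case (monomial q c)
  show ?case using assms(2)
  proof induction
    case (monomial r d)
    then show ?case
      using trig_poly.monomial[OF int_lattice_add[OF \<open>q \<in> int_lattice\<close> monomial], of "c * d"]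
      by (simp add: inner_add_left distrib_left cis_mult[symmetric] mult_ac)
  next
    case (add f g)
    then show ?case using trig_poly.add by (fastforce simp: distrib_left)
  qed
next
  case (add f g)
  then show ?case using trig_poly.add by (fastforce simp: distrib_right)
qed

lemma trig_poly_prod:
  "finite B \<Longrightarrow> (\<And>b. b \<in> B \<Longrightarrow> trig_poly (f b)) \<Longrightarrow> trig_poly (\<lambda>x. \<Prod>b\<in>B. f b x)"
  by (induction B rule: finite_induct) (auto intro: trig_poly_const trig_poly_mult)

text \<open>The inductive form is suited to products; the form with pairwise distinct frequencies is
  the one to which orthogonality applies.\<close>

lemma trig_poly_expansion:
  "trig_poly f \<Longrightarrow> \<exists>K c. finite K \<and> K \<subseteq> int_lattice \<and> f = (\<lambda>x. \<Sum>q\<in>K. c q * cis (2 * pi * (q \<bullet> x)))"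
proof (induction rule: trig_poly.induct)
  case (monomial q c)
  then show ?case by (intro exI[of _ "{q}"] exI[of _ "\<lambda>_. c"]) auto
next
  case (add f g)
  then obtain K c K' c' where K: "finite K" "K \<subseteq> int_lattice" "f = (\<lambda>x. \<Sum>q\<in>K. c q * cis (2 * pi * (q \<bullet> x)))"
    and K': "finite K'" "K' \<subseteq> int_lattice" "g = (\<lambda>x. \<Sum>q\<in>K'. c' q * cis (2 * pi * (q \<bullet> x)))" by blast
  have ext: "(\<Sum>q\<in>A. d q * w q) = (\<Sum>q\<in>K \<union> K'. (if q \<in> A then d q else 0) * w q)"
    if "A \<subseteq> K \<union> K'" for A and d w :: "'a \<Rightarrow> complex"
    using that K(1) K'(1) by (intro sum.mono_neutral_cong_left) auto
  have "f x + g x = (\<Sum>q\<in>K \<union> K'. ((if q \<in> K then c q else 0) + (if q \<in> K' then c' q else 0)) * cis (2 * pi * (q \<bullet> x)))" for x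
    unfolding K(3) K'(3) ext[of K, OF Un_upper1] ext[of K', OF Un_upper2] by (simp only: distrib_right sum.distrib)
  then show ?case using K K'
    by (intro exI[of _ "K \<union> K'"] exI[of _ "\<lambda>q. (if q \<in> K then c q else 0) + (if q \<in> K' then c' q else 0)"]) auto
qed

lemma continuous_on_trig_poly: "trig_poly f \<Longrightarrow> continuous_on S f"
  by (induction rule: trig_poly.induct) (auto intro!: continuous_intros)

lemma borel_measurable_trig_poly: "trig_poly f \<Longrightarrow> f \<in> borel_measurable borel"
  by (intro borel_measurable_continuous_onI continuous_on_trig_poly)

text \<open>The shifted cosine is the sum of two characters with frequencies \<open>b\<close> and
  \<open>- b\<close>, and trigonometric polynomials are closed under sums and products. In the
  linear case \<open>f\<close> is multiplication by \<open>f 1\<close>.\<close>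

lemma trig_poly_polynomial_cos:
  fixes b :: "'e::euclidean_space"
  assumes "real_polynomial_function P" and b: "b \<in> Basis"
  shows "trig_poly (\<lambda>x. of_real (P (cos (2 * pi * (x \<bullet> b - c)))))"
  using assms(1)
proof induction
  case (linear f)
  have bl: "b \<in> int_lattice" "- b \<in> int_lattice" using b by (auto simp: int_lattice_def inner_Basis)
  have lin: "f y = y * f 1" for y using bounded_linear.linear[OF linear] linear_cmul[of f y 1] by simp
  have eq: "complex_of_real (f (cos (2 * pi * (x \<bullet> b - c)))) =
     (of_real (f 1) / 2 * cis (- (2 * pi * c))) * cis (2 * pi * (b \<bullet> x)) +
     (of_real (f 1) / 2 * cis (2 * pi * c)) * cis (2 * pi * ((- b) \<bullet> x))" for x
  proof -
    have "complex_of_real (cos (2 * pi * (x \<bullet> b - c))) = (cis (2 * pi * (x \<bullet> b - c)) + cis (- (2 * pi * (x \<bullet> b - c)))) / 2"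
      by (simp add: complex_eq_iff)
    also have "\<dots> = cis (- (2 * pi * c)) * cis (2 * pi * (b \<bullet> x)) / 2 + cis (2 * pi * c) * cis (2 * pi * ((- b) \<bullet> x)) / 2"
      by (simp add: cis_mult inner_commute algebra_simps add_divide_distrib)
    finally show ?thesis by (subst lin) (simp add: distrib_left mult_ac)
  qed
  show ?case unfolding eq by (intro trig_poly.add trig_poly.monomial bl)
next
  case (const c)
  then show ?case by (rule trig_poly_const)
next
  case (add f g)
  then show ?case using trig_poly.add by fastforce
next
  case (mult f g)
  then show ?case using trig_poly_mult by fastforce
qed

text \<open>\<open>cos (2 * pi * d)\<close> decreases for \<open>d\<close> in
  \<open>[0, 1/2]\<close> and is symmetric about \<open>1/2\<close>. The bounds on \<open>c\<close>
  and \<open>r\<close> prevent the arc from wrapping around: they give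
  \<open>\<bar>x - c\<bar> \<le> 1 - r\<close>, so a reflected distance is never below
  \<open>r\<close>.\<close>

lemma cos_gt_iff_dist:
  fixes c r x :: real
  assumes r: "0 < r" "0 \<le> c - r" "c + r \<le> 1" and x: "0 < x" "x < 1"
  shows "cos (2 * pi * r) < cos (2 * pi * (x - c)) \<longleftrightarrow> \<bar>x - c\<bar> < r"
proof -
  define d where "d = \<bar>x - c\<bar>"
  have d: "0 \<le> d" "d \<le> 1 - r" using assms by (auto simp: d_def abs_if)
  have r2: "r \<le> 1 / 2" using r by simp
  have eq: "cos (2 * pi * (x - c)) = cos (2 * pi * d)" by (simp add: d_def abs_if right_diff_distrib cos_diff)
  have mono: "cos (2 * pi * t) \<le> cos (2 * pi * s)" if "0 \<le> s" "s \<le> t" "t \<le> 1 / 2" for s t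
    using that by (intro cos_monotone_0_pi_le) auto
  show ?thesis
  proof (cases "d < r")
    case True
    have "cos (2 * pi * r) < cos (2 * pi * d)" using True d r2 by (intro cos_monotone_0_pi) auto
    then show ?thesis using True eq by (simp add: d_def)
  next
    case False
    have "cos (2 * pi * d) \<le> cos (2 * pi * r)"
    proof (cases "d \<le> 1 / 2")
      case True
      then show ?thesis using mono[of r d] False r by simp
    next
      case F: False
      have "cos (2 * pi * d) = cos (2 * pi * (1 - d))" by (simp add: right_diff_distrib cos_diff)
      also have "\<dots> \<le> cos (2 * pi * r)" using mono[of r "1 - d"] F d r by simp
      finally show ?thesis .
    qed
    then show ?thesis using False eq by (simp add: d_def)
  qed
qed

text \<open>
  An arc of the circle is a superlevel set of \<open>cos (2\<pi>(x - c))\<close>, so its indicator is a pointwise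
  limit of polynomials in this function, that is, of trigonometric polynomials.
\<close>

lemma indicator_interval_limit_polynomial_cos:
  fixes u v :: real
  shows "\<exists>P c. (\<forall>i::nat. real_polynomial_function (P i)) \<and> (\<forall>i. \<forall>s. \<bar>s\<bar> \<le> 1 \<longrightarrow> \<bar>P i s :: real\<bar> \<le> 2) \<and>
    (\<forall>x. 0 < x \<longrightarrow> x < 1 \<longrightarrow> (\<lambda>i. P i (cos (2 * pi * (x - c)))) \<longlonglongrightarrow> indicator {u<..<v} x)"
proof (cases "max u 0 < min v 1")
  case False
  then have "indicator {u<..<v} x = (0::real)" if "0 < x" "x < 1" for x
    using that by (auto simp: indicator_def)
  then show ?thesis by (intro exI[of _ "\<lambda>_ _. 0"] exI[of _ 0]) auto
next
  case True
  \<comment> \<open>Centre and radius of the interval clipped to the unit interval.\<close>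
  define c where "c = (max u 0 + min v 1) / 2"
  define r where "r = (min v 1 - max u 0) / 2"
  have r: "0 < r" "0 \<le> c - r" "c + r \<le> 1" using True by (auto simp: c_def r_def field_simps)
  have mem: "x \<in> {u<..<v} \<longleftrightarrow> \<bar>x - c\<bar> < r" if "0 < x" "x < 1" for x
  proof -
    have "c - r = max u 0" "c + r = min v 1" by (auto simp: c_def r_def field_simps)
    then have "\<bar>x - c\<bar> < r \<longleftrightarrow> max u 0 < x \<and> x < min v 1" by (auto simp: abs_less_iff)
    then show ?thesis using that by auto
  qed
  define s0 where "s0 = cos (2 * pi * r)"
  \<comment> \<open>Ramps of slope \<open>i\<close> starting at the threshold converge to the
    indicator of \<open>s > s0\<close>. Polynomials within \<open>1 / (i + 1)\<close> of them have
    the same limit and are bounded by \<open>1 + 1\<close>.\<close>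
  define H where "H i s = min 1 (max 0 (real i * (s - s0)))" for i :: nat and s
  have contH: "continuous_on {-1..1} (H i)" for i unfolding H_def by (intro continuous_intros)
  have "\<exists>g. real_polynomial_function g \<and> (\<forall>s\<in>{-1..1}. \<bar>H i s - g s\<bar> < 1 / real (Suc i))" for i
    by (rule Stone_Weierstrass_real_polynomial_function[OF compact_Icc contH[of i], of "1 / real (Suc i)"]) auto
  then obtain P where P: "\<And>i. real_polynomial_function (P i)"
    "\<And>i s. s \<in> {-1..1} \<Longrightarrow> \<bar>H i s - P i s\<bar> < 1 / real (Suc i)" by metis
  have lim: "(\<lambda>i. P i s) \<longlonglongrightarrow> (if s0 < s then 1 else 0)" if s: "s \<in> {-1..1}" for s
  proof -
    have Hlim: "(\<lambda>i. H i s) \<longlonglongrightarrow> (if s0 < s then 1 else 0)"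
    proof (cases "s0 < s")
      case True
      obtain n where n: "1 / (s - s0) \<le> real n" using real_arch_simple by blast
      have "H i s = 1" if "n \<le> i" for i
      proof -
        have "1 / (s - s0) \<le> real i" using n that by linarith
        then have "1 \<le> real i * (s - s0)" using True by (simp add: field_simps)
        then show ?thesis by (simp add: H_def)
      qed
      then show ?thesis using True by (auto intro!: tendsto_eventually eventually_sequentiallyI[of n])
    next
      case False
      have "real i * (s - s0) \<le> 0" for i using False by (intro mult_nonneg_nonpos) auto
      then have "H i s = 0" for i by (simp add: H_def)
      then show ?thesis using False by simp
    qed
    have "(\<lambda>i. P i s - H i s) \<longlonglongrightarrow> 0"
    proof (rule Lim_null_comparison)
      show "\<forall>\<^sub>F i in sequentially. norm (P i s - H i s) \<le> 1 / real (Suc i)"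
        using P(2)[OF s] by (intro always_eventually allI) (simp add: abs_minus_commute less_imp_le)
      show "(\<lambda>i. 1 / real (Suc i)) \<longlonglongrightarrow> 0" by (rule LIMSEQ_Suc[OF lim_1_over_n])
    qed
    from tendsto_add[OF this Hlim] show ?thesis by simp
  qed
  have bound: "\<bar>P i s\<bar> \<le> 2" if "\<bar>s\<bar> \<le> 1" for i s
  proof -
    have "\<bar>H i s - P i s\<bar> < 1 / real (Suc i)" using that by (intro P(2)) auto
    also have "\<dots> \<le> 1" by simp
    finally have "\<bar>H i s - P i s\<bar> < 1" .
    moreover have "0 \<le> H i s" "H i s \<le> 1" by (auto simp: H_def)
    ultimately show ?thesis by linarith
  qed
  show ?thesis
  proof (intro exI[of _ P] exI[of _ c] conjI allI impI P bound)
    fix x :: real assume x: "0 < x" "x < 1"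
    have "(indicator {u<..<v} x :: real) = (if s0 < cos (2 * pi * (x - c)) then 1 else 0)"
      unfolding s0_def using cos_gt_iff_dist[OF r x] mem[OF x] by (auto simp: indicator_def)
    then show "(\<lambda>i. P i (cos (2 * pi * (x - c)))) \<longlonglongrightarrow> indicator {u<..<v} x"
      using lim[of "cos (2 * pi * (x - c))"] by simp
  qed auto
qed

lemma nn_integral_count_space_SUP:
  fixes g :: "'i \<Rightarrow> ennreal"
  assumes A: "\<And>n. finite (A n)" "incseq A"
  shows "(\<integral>\<^sup>+i. g i \<partial>count_space (\<Union>n. A n)) = (SUP n. \<Sum>i\<in>A n. g i)"
proof -
  let ?I = "\<Union>n. A n"
  have "(\<integral>\<^sup>+i. g i \<partial>count_space ?I) = (\<integral>\<^sup>+i. (SUP n. g i * indicator (A n) i) \<partial>count_space ?I)"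
  proof (intro nn_integral_cong)
    fix i assume "i \<in> space (count_space ?I)"
    then obtain n where "i \<in> A n" by auto
    then have "g i \<le> (SUP n. g i * indicator (A n) i)" by (intro SUP_upper2[of n]) auto
    moreover have "(SUP n. g i * indicator (A n) i) \<le> g i" by (intro SUP_least) (auto simp: indicator_def)
    ultimately show "g i = (SUP n. g i * indicator (A n) i)" by (rule antisym)
  qed
  also have "\<dots> = (SUP n. \<integral>\<^sup>+i. g i * indicator (A n) i \<partial>count_space ?I)"
    using A(2) by (intro nn_integral_monotone_convergence_SUP)
      (auto simp: incseq_def le_fun_def indicator_def intro!: mult_left_mono)
  also have "\<dots> = (SUP n. \<Sum>i\<in>A n. g i)"
  proof (intro SUP_cong refl)
    fix n
    have "(\<integral>\<^sup>+i. g i * indicator (A n) i \<partial>count_space ?I) = (\<Sum>i\<in>A n. g i * emeasure (count_space ?I) {i})"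
      by (rule nn_integral_indicator_finite) (use A in auto)
    also have "\<dots> = (\<Sum>i\<in>A n. g i)"
      by (intro sum.cong refl) (subst emeasure_count_space_finite, auto)
    finally show "(\<integral>\<^sup>+i. g i * indicator (A n) i \<partial>count_space ?I) = (\<Sum>i\<in>A n. g i)" .
  qed
  finally show ?thesis .
qed

section \<open>Density of trigonometric polynomials and completeness\<close>

lemma ennreal_two_quarters: "2 * (\<delta> / 4) + 2 * (\<delta> / 4) = (\<delta> :: ennreal)"
proof -
  have "2 * (\<delta> / 4) + 2 * (\<delta> / 4) = (2 + 2) * (\<delta> / 4)" by (simp only: distrib_right)
  also have "\<dots> = \<delta> * 4 / 4" by (simp add: ennreal_times_divide mult.commute)
  also have "\<dots> = \<delta>" by (rule ennreal_mult_divide_eq) auto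
  finally show ?thesis .
qed

text \<open>Instantiated with Lebesgue measure cut to the unit cell by a density, which keeps the
  Borel sets of the whole space as sigma algebra. Concentration on the open cube disposes of the
  faces, where arcs and intervals do not match.\<close>

locale unit_box_measure = finite_measure M for M :: "'e::euclidean_space measure" +
  assumes sets_M [measurable_cong]: "sets M = sets borel"
    and AE_M: "AE x in M. \<forall>b\<in>Basis. 0 < x \<bullet> b \<and> x \<bullet> b < 1"
    and ortho_M: "q \<in> int_lattice \<Longrightarrow> (LINT x|M. cis (2 * pi * (q \<bullet> x))) = (if q = 0 then 1 else 0)"
begin

definition approximable :: "('e \<Rightarrow> complex) \<Rightarrow> bool" where
  "approximable f \<longleftrightarrow> f \<in> borel_measurable borel \<and>
    (\<forall>\<delta>>0. \<exists>p. trig_poly p \<and> sq_norm M (\<lambda>x. f x - p x) < \<delta>)"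

lemma measurable_M: "borel_measurable M = borel_measurable borel"
  by (rule measurable_cong_sets[OF sets_M refl])

lemma approximable_trig_poly: "trig_poly p \<Longrightarrow> approximable p"
  by (auto simp: approximable_def sq_norm_def borel_measurable_trig_poly intro!: exI[of _ p])

lemma approximable_limit:
  assumes f: "f \<in> borel_measurable borel"
    and lim: "\<And>\<delta>::ennreal. 0 < \<delta> \<Longrightarrow> \<exists>g. approximable g \<and> sq_norm M (\<lambda>x. f x - g x) < \<delta>"
  shows "approximable f"
  unfolding approximable_def
proof (intro conjI f allI impI)
  fix \<delta> :: ennreal assume \<delta>: "\<delta> > 0"
  \<comment> \<open>Quarters, because \<open>sq_norm_add_le\<close> puts a factor 2 in front of both
    terms.\<close>
  then have d4: "\<delta> / 4 > 0" by (simp add: ennreal_zero_less_divide)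
  obtain g where g: "approximable g" "sq_norm M (\<lambda>x. f x - g x) < \<delta> / 4" using lim[OF d4] by auto
  obtain p where p: "trig_poly p" "sq_norm M (\<lambda>x. g x - p x) < \<delta> / 4"
    using g(1) d4 by (auto simp: approximable_def)
  have [measurable]: "f \<in> borel_measurable M" "g \<in> borel_measurable M" "p \<in> borel_measurable M"
    using f g(1) borel_measurable_trig_poly[OF p(1)] by (auto simp: approximable_def measurable_M)
  have "sq_norm M (\<lambda>x. f x - p x) = sq_norm M (\<lambda>x. (f x - g x) + (g x - p x))" by simp
  also have "\<dots> \<le> 2 * sq_norm M (\<lambda>x. f x - g x) + 2 * sq_norm M (\<lambda>x. g x - p x)"
    by (rule sq_norm_add_le) measurable
  also have "\<dots> < 2 * (\<delta> / 4) + 2 * (\<delta> / 4)"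
    using g(2) p(2) by (intro add_strict_mono ennreal_mult_strict_left_mono) auto
  also have "\<dots> = \<delta>" by (rule ennreal_two_quarters)
  finally show "\<exists>p. trig_poly p \<and> sq_norm M (\<lambda>x. f x - p x) < \<delta>" using p(1) by blast
qed

lemma approximable_limit_seq:
  assumes f: "f \<in> borel_measurable borel" and g: "\<And>n. approximable (g n)"
    and lim: "(\<lambda>n. sq_norm M (\<lambda>x. f x - g n x)) \<longlonglongrightarrow> 0"
  shows "approximable f"
proof (rule approximable_limit[OF f])
  fix \<delta> :: ennreal assume "\<delta> > 0"
  then have "\<forall>\<^sub>F n in sequentially. sq_norm M (\<lambda>x. f x - g n x) < \<delta>" by (rule order_tendstoD(2)[OF lim])
  then show "\<exists>g. approximable g \<and> sq_norm M (\<lambda>x. f x - g x) < \<delta>"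
    using g by (auto simp: eventually_sequentially)
qed

lemma approximable_dominated:
  assumes f: "f \<in> borel_measurable borel" and g: "\<And>n. approximable (g n)"
    and w: "w \<in> borel_measurable borel" "(\<integral>\<^sup>+x. w x \<partial>M) < \<infinity>"
    and dom: "\<And>n x. esq (f x - g n x) \<le> w x"
    and lim: "AE x in M. (\<lambda>n. g n x) \<longlonglongrightarrow> f x"
  shows "approximable f"
proof (rule approximable_limit_seq[OF f g])
  have [measurable]: "f \<in> borel_measurable M" "g n \<in> borel_measurable M" "w \<in> borel_measurable M" for n
    using f w g[of n] by (auto simp: approximable_def measurable_M)
  have "(\<lambda>n. sq_norm M (\<lambda>x. f x - g n x)) \<longlonglongrightarrow> (\<integral>\<^sup>+x. 0 \<partial>M)"
    unfolding sq_norm_def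
  proof (rule nn_integral_dominated_convergence)
    show "AE x in M. (\<lambda>n. esq (f x - g n x)) \<longlonglongrightarrow> 0"
      using lim
    proof eventually_elim
      fix x assume "(\<lambda>n. g n x) \<longlonglongrightarrow> f x"
      then have "(\<lambda>n. (cmod (f x - g n x))\<^sup>2) \<longlonglongrightarrow> (cmod (f x - f x))\<^sup>2" by (intro tendsto_intros)
      from tendsto_ennrealI[OF this]
      show "(\<lambda>n. esq (f x - g n x)) \<longlonglongrightarrow> 0" by simp
    qed
  qed (use w dom in auto)
  then show "(\<lambda>n. sq_norm M (\<lambda>x. f x - g n x)) \<longlonglongrightarrow> 0" by simp
qed

lemma approximable_add:
  assumes f: "approximable f" and g: "approximable g"
  shows "approximable (\<lambda>x. f x + g x)"
  unfolding approximable_def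
proof (intro conjI allI impI)
  have [measurable]: "f \<in> borel_measurable borel" "g \<in> borel_measurable borel"
    using f g by (auto simp: approximable_def)
  show "(\<lambda>x. f x + g x) \<in> borel_measurable borel" by measurable
  fix \<delta> :: ennreal assume \<delta>: "\<delta> > 0"
  then have d4: "\<delta> / 4 > 0" by (simp add: ennreal_zero_less_divide)
  obtain p where p: "trig_poly p" "sq_norm M (\<lambda>x. f x - p x) < \<delta> / 4" using f d4 by (auto simp: approximable_def)
  obtain q where q: "trig_poly q" "sq_norm M (\<lambda>x. g x - q x) < \<delta> / 4" using g d4 by (auto simp: approximable_def)
  have [measurable]: "p \<in> borel_measurable borel" "q \<in> borel_measurable borel"
    using p q by (auto intro: borel_measurable_trig_poly)
  have "sq_norm M (\<lambda>x. (f x + g x) - (p x + q x)) = sq_norm M (\<lambda>x. (f x - p x) + (g x - q x))"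
    by (simp add: algebra_simps)
  also have "\<dots> \<le> 2 * sq_norm M (\<lambda>x. f x - p x) + 2 * sq_norm M (\<lambda>x. g x - q x)"
    by (rule sq_norm_add_le) measurable
  also have "\<dots> < 2 * (\<delta> / 4) + 2 * (\<delta> / 4)"
    using p(2) q(2) by (intro add_strict_mono ennreal_mult_strict_left_mono) auto
  also have "\<dots> = \<delta>" by (rule ennreal_two_quarters)
  finally show "\<exists>p. trig_poly p \<and> sq_norm M (\<lambda>x. f x + g x - p x) < \<delta>"
    using trig_poly.add[OF p(1) q(1)] by blast
qed

lemma approximable_cmult:
  assumes f: "approximable f"
  shows "approximable (\<lambda>x. c * f x)"
proof (cases "c = 0")
  case True
  then show ?thesis using approximable_trig_poly[OF trig_poly_const[of 0]] by simp
next
  case False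
  have [measurable]: "f \<in> borel_measurable borel" using f by (auto simp: approximable_def)
  show ?thesis
    unfolding approximable_def
  proof (intro conjI allI impI)
    fix \<delta> :: ennreal assume \<delta>: "\<delta> > 0"
    have c: "esq c \<noteq> 0" using False by (simp add: ennreal_eq_0_iff)
    then have "\<delta> / esq c > 0" using \<delta> by (simp add: ennreal_zero_less_divide)
    then obtain p where p: "trig_poly p" "sq_norm M (\<lambda>x. f x - p x) < \<delta> / esq c"
      using f by (auto simp: approximable_def)
    have [measurable]: "p \<in> borel_measurable borel" using p by (auto intro: borel_measurable_trig_poly)
    have "sq_norm M (\<lambda>x. c * f x - c * p x) = esq c * sq_norm M (\<lambda>x. f x - p x)"
      by (subst sq_norm_cmult[symmetric]) (auto simp: right_diff_distrib)
    also have "\<dots> < esq c * (\<delta> / esq c)"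
      using p(2) c by (intro ennreal_mult_strict_left_mono) (auto simp: zero_less_iff_neq_zero)
    also have "\<dots> = \<delta>" using c by (simp add: ennreal_times_divide mult.commute ennreal_mult_divide_eq)
    finally show "\<exists>p. trig_poly p \<and> sq_norm M (\<lambda>x. c * f x - p x) < \<delta>"
      using trig_poly_mult[OF trig_poly_const p(1)] by blast
  qed measurable
qed

text \<open>The product of the one-dimensional approximations over the coordinates. It is bounded by
  \<open>2 ^ DIM('e)\<close>, which is integrable over a finite measure, so dominated convergence
  applies.\<close>

lemma approximable_box: "approximable (\<lambda>x. indicator (box u v) x)"
proof -
  have "\<exists>P c. (\<forall>i::nat. real_polynomial_function (P i)) \<and> (\<forall>i. \<forall>s. \<bar>s\<bar> \<le> 1 \<longrightarrow> \<bar>P i s :: real\<bar> \<le> 2) \<and>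
    (\<forall>x. 0 < x \<longrightarrow> x < 1 \<longrightarrow> (\<lambda>i. P i (cos (2 * pi * (x - c)))) \<longlonglongrightarrow> indicator {u \<bullet> b<..<v \<bullet> b} x)" for b
    by (rule indicator_interval_limit_polynomial_cos)
  then obtain P c where P: "\<And>b i. real_polynomial_function (P b i)" "\<And>b i s. \<bar>s\<bar> \<le> 1 \<Longrightarrow> \<bar>P b i s :: real\<bar> \<le> 2"
    "\<And>b x. 0 < x \<Longrightarrow> x < 1 \<Longrightarrow> (\<lambda>i::nat. P b i (cos (2 * pi * (x - c b)))) \<longlonglongrightarrow> indicator {u \<bullet> b<..<v \<bullet> b} x" by metis
  define g where "g i x = (\<Prod>b\<in>Basis. complex_of_real (P b i (cos (2 * pi * (x \<bullet> b - c b)))))" for i x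
  have g_le: "cmod (g i x) \<le> 2 ^ DIM('e)" for i x
  proof -
    have "cmod (g i x) = (\<Prod>b\<in>Basis. \<bar>P b i (cos (2 * pi * (x \<bullet> b - c b)))\<bar>)" by (simp add: g_def prod_norm[symmetric])
    also have "\<dots> \<le> (\<Prod>b\<in>(Basis::'e set). 2)" by (intro prod_mono) (auto intro: P(2))
    finally show ?thesis by simp
  qed
  show ?thesis
  proof (rule approximable_dominated[where g = g and w = "\<lambda>_. ennreal ((1 + 2 ^ DIM('e))\<^sup>2)"])
    show "approximable (g i)" for i
      unfolding g_def by (intro approximable_trig_poly trig_poly_prod trig_poly_polynomial_cos P) auto
    show "(\<integral>\<^sup>+x. ennreal ((1 + 2 ^ DIM('e))\<^sup>2) \<partial>M) < \<infinity>"
    proof -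
      have "emeasure M (space M) < top" by (metis emeasure_finite infinity_ennreal_def less_top)
      then show ?thesis by (simp add: ennreal_mult_less_top)
    qed
    show "esq (indicator (box u v) x - g i x) \<le> ennreal ((1 + 2 ^ DIM('e))\<^sup>2)" for i x
    proof (intro ennreal_leI power_mono)
      have "cmod (indicator (box u v) x - g i x) \<le> cmod (indicator (box u v) x) + cmod (g i x)"
        by (rule norm_triangle_ineq4)
      also have "\<dots> \<le> 1 + 2 ^ DIM('e)" using g_le by (intro add_mono) (auto simp: indicator_def)
      finally show "cmod (indicator (box u v) x - g i x) \<le> 1 + 2 ^ DIM('e)" .
    qed simp
    show "AE x in M. (\<lambda>i. g i x) \<longlonglongrightarrow> indicator (box u v) x"
      using AE_M
    proof eventually_elim
      fix x :: 'e assume x: "\<forall>b\<in>Basis. 0 < x \<bullet> b \<and> x \<bullet> b < 1"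
      have "(\<lambda>i. g i x) \<longlonglongrightarrow> (\<Prod>b\<in>Basis. complex_of_real (indicator {u \<bullet> b<..<v \<bullet> b} (x \<bullet> b)))"
        unfolding g_def using x by (intro tendsto_prod tendsto_of_real P(3)) auto
      also have "(\<Prod>b\<in>Basis. complex_of_real (indicator {u \<bullet> b<..<v \<bullet> b} (x \<bullet> b))) = indicator (box u v) x"
        by (auto simp: indicator_def box_def prod_zero_iff)
      finally show "(\<lambda>i. g i x) \<longlonglongrightarrow> indicator (box u v) x" .
    qed
  qed auto
qed

text \<open>Boxes form an intersection-stable generator of the Borel sets, so it suffices to treat
  complements, by linearity, and disjoint countable unions, by dominated convergence.\<close>

lemma approximable_indicator:
  assumes "A \<in> sets borel"
  shows "approximable (\<lambda>x. indicator A x)"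
proof -
  have "Int_stable (range (\<lambda>(a, b). box a b :: 'e set))"
    by (auto simp: Int_stable_def box_Int_box)
  moreover have "range (\<lambda>(a, b). box a b :: 'e set) \<subseteq> Pow UNIV" by simp
  moreover have "A \<in> sigma_sets UNIV (range (\<lambda>(a, b). box a b))"
    using assms unfolding borel_eq_box by simp
  ultimately show ?thesis
  proof (induction rule: sigma_sets_induct_disjoint)
    case (basic A)
    then show ?case by (auto intro: approximable_box)
  next
    case empty
    then show ?case using approximable_trig_poly[OF trig_poly_const[of 0]] by simp
  next
    case (compl A)
    have eq: "indicator (UNIV - A) = (\<lambda>x::'e. 1 + (- 1) * (indicator A x :: complex))"
      by (auto simp: indicator_def)
    show ?case
      unfolding eq by (intro approximable_add approximable_cmult approximable_trig_poly trig_poly_const compl.IH)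
  next
    case (union A)
    have A: "A i \<in> sets borel" for i using union.hyps(2) unfolding borel_eq_box by auto
    have part: "(\<Sum>i<n. indicator (A i) x) = (indicator (\<Union>i<n. A i) x :: complex)" for n x
      using union.hyps(1) by (intro indicator_UN_disjoint[symmetric]) (auto simp: disjoint_family_on_def)
    have fin: "approximable (\<lambda>x. \<Sum>i<n. indicator (A i) x)" for n
    proof (induction n)
      case 0
      then show ?case using approximable_trig_poly[OF trig_poly_const[of 0]] by simp
    next
      case (Suc n)
      then show ?case using approximable_add[OF Suc union.IH[of n]] by simp
    qed
    show ?case
    proof (rule approximable_dominated[where g = "\<lambda>n x. \<Sum>i<n. indicator (A i) x" and w = "\<lambda>_. 1"])
      show "(\<lambda>x. indicator (\<Union> (range A)) x) \<in> borel_measurable borel" using A by auto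
      show "esq (indicator (\<Union> (range A)) x - (\<Sum>i<n. indicator (A i) x)) \<le> 1" for n x
        unfolding part by (auto simp: indicator_def)
      show "AE x in M. (\<lambda>n. \<Sum>i<n. indicator (A i) x) \<longlonglongrightarrow> (indicator (\<Union> (range A)) x :: complex)"
        unfolding part by (auto intro: LIMSEQ_indicator_UN)
      show "(\<integral>\<^sup>+x. 1 \<partial>M) < \<infinity>" by (simp add: emeasure_finite less_top[symmetric])
    qed (use fin in auto)
  qed
qed

text \<open>Simple functions converge to \<open>f\<close> pointwise with modulus at most
  \<open>2 * cmod (f x)\<close>. The squared error is then at most \<open>(1 + 2)^2 = 9\<close>
  times the square of \<open>f\<close>.\<close>

lemma approximable_L2:
  assumes f: "f \<in> borel_measurable borel" and fin: "sq_norm M f < \<infinity>"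
  shows "approximable f"
proof -
  obtain F where F: "\<And>i. simple_function borel (F i)" "\<And>x. (\<lambda>i. F i x) \<longlonglongrightarrow> f x"
    "\<And>i x. dist (F i x) 0 \<le> 2 * dist (f x) 0"
    using borel_measurable_implies_sequence_metric[OF f, of 0] by auto
  have simple: "approximable g" if g: "simple_function borel g" for g :: "'e \<Rightarrow> complex"
  proof -
    have sum: "approximable (\<lambda>x. \<Sum>y\<in>Y. y * indicator (g -` {y}) x)" if "finite Y" for Y
      using that
    proof induction
      case empty
      then show ?case using approximable_trig_poly[OF trig_poly_const[of 0]] by simp
    next
      case (insert y Y)
      have "g -` {y} \<in> sets borel" using simple_functionD(2)[OF g, of "{y}"] by simp
      then have "approximable (\<lambda>x. y * indicator (g -` {y}) x + (\<Sum>y\<in>Y. y * indicator (g -` {y}) x))"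
        by (intro approximable_add approximable_cmult approximable_indicator insert.IH)
      then show ?case unfolding sum.insert[OF insert.hyps] .
    qed
    have eq: "g = (\<lambda>x. \<Sum>y\<in>range g. y * indicator (g -` {y}) x)"
    proof
      fix x
      have "g x = (\<Sum>y\<in>range g. indicator (g -` {y}) x *\<^sub>R y)"
        using simple_function_indicator_representation_banach[OF g, of x]
        by (simp only: space_borel Int_UNIV_right UNIV_I simp_thms True_implies_equals)
      also have "\<dots> = (\<Sum>y\<in>range g. y * indicator (g -` {y}) x)"
        by (intro sum.cong refl) (auto simp: indicator_def)
      finally show "g x = (\<Sum>y\<in>range g. y * indicator (g -` {y}) x)" .
    qed
    have "finite (range g)" using simple_functionD(1)[OF g] by simp
    then show ?thesis by (subst eq) (rule sum)
  qed
  show ?thesis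
  proof (rule approximable_dominated[OF f, where g = F and w = "\<lambda>x. 9 * esq (f x)"])
    show "approximable (F n)" for n by (rule simple[OF F(1)])
    show "(\<integral>\<^sup>+x. 9 * esq (f x) \<partial>M) < \<infinity>"
      using fin f by (subst nn_integral_cmult) (auto simp: sq_norm_def ennreal_mult_less_top measurable_M)
    show "esq (f x - F n x) \<le> 9 * esq (f x)" for n x
    proof -
      have "cmod (f x - F n x) \<le> cmod (f x) + cmod (F n x)" by (rule norm_triangle_ineq4)
      also have "\<dots> \<le> 3 * cmod (f x)" using F(3)[of n x] by simp
      finally have "(cmod (f x - F n x))\<^sup>2 \<le> (3 * cmod (f x))\<^sup>2" by (intro power_mono) auto
      then have "esq (f x - F n x) \<le> ennreal (9 * (cmod (f x))\<^sup>2)"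
        by (intro ennreal_leI) (simp add: power_mult_distrib)
      then show ?thesis by (simp add: ennreal_mult)
    qed
  qed (use f F(2) in auto)
qed

text \<open>One inequality is Bessel. For the other, a trigonometric polynomial close to
  \<open>f\<close> cannot be closer than the projection of \<open>f\<close> onto its frequencies, so
  these already carry almost the whole norm.\<close>

theorem parseval:
  assumes f: "f \<in> borel_measurable borel" and fin: "sq_norm M f < \<infinity>"
  shows "(\<integral>\<^sup>+q. esq (LINT x|M. f x * cis (- (2 * pi * (q \<bullet> x)))) \<partial>count_space int_lattice) = sq_norm M f"
proof -
  let ?e = "\<lambda>q x. cis (2 * pi * (q \<bullet> x))"
  let ?c = "\<lambda>q. LINT x|M. f x * cnj (?e q x)"
  have f' [measurable]: "f \<in> borel_measurable M" using f by (simp add: measurable_M)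
  have ff: "integrable M (\<lambda>x. (cmod (f x))\<^sup>2)"
    by (rule integrableI_bounded) (use fin in \<open>auto simp: sq_norm_def\<close>)
  have fe: "integrable M (\<lambda>x. f x * cnj (?e q x))" for q
  proof (subst mult.commute, rule integrable_mult_finite_support[of _ _ _ "space M"])
    show "(\<lambda>x. cnj (?e q x)) \<in> borel_measurable M" unfolding cis_cnj by measurable
    show "emeasure M (space M) < \<infinity>" by (metis emeasure_finite infinity_ennreal_def less_top)
  qed (use fin in auto)
  have mul: "?e q x * cnj (?e r x) = cis (2 * pi * ((q - r) \<bullet> x))" for q r x
    by (simp add: cis_cnj cis_mult inner_diff_left right_diff_distrib)
  have expand: "(LINT x|M. (cmod (f x - (\<Sum>q\<in>K. a q * ?e q x)))\<^sup>2) =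
    (LINT x|M. (cmod (f x))\<^sup>2) - (\<Sum>q\<in>K. (cmod (?c q))\<^sup>2) + (\<Sum>q\<in>K. (cmod (a q - ?c q))\<^sup>2)"
    if K: "finite K" "K \<subseteq> int_lattice" for K a
  proof -
    have "(LINT x|M. (cmod (f x - (\<Sum>q\<in>K. a q * ?e q x)))\<^sup>2) =
      (LINT x|M. (cmod (f x))\<^sup>2) - (\<Sum>q\<in>K. (cmod (?c q))\<^sup>2) / 1 + (\<Sum>q\<in>K. (cmod (of_real 1 * a q - ?c q))\<^sup>2) / 1"
    proof (rule integral_orthogonal_expansion[OF K(1) _ ff fe])
      fix q r assume "q \<in> K" "r \<in> K"
      then have qr: "q - r \<in> int_lattice" using K by (auto intro: int_lattice_diff)
      show "(LINT x|M. ?e q x * cnj (?e r x)) = (if q = r then of_real 1 else 0)"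
        unfolding mul using ortho_M[OF qr] by simp
      show "integrable M (\<lambda>x. ?e q x * cnj (?e r x))"
        unfolding mul by (rule integrable_const_bound[of _ 1]) auto
    qed simp
    then show ?thesis by simp
  qed
  let ?F = "LINT x|M. (cmod (f x))\<^sup>2"
  let ?s = "\<integral>\<^sup>+q. esq (?c q) \<partial>count_space int_lattice"
  define A where "A n = {q \<in> int_lattice :: 'e set. norm q \<le> real n}" for n :: nat
  have A: "finite (A n)" "incseq A" "(\<Union>n. A n) = int_lattice" for n
    unfolding A_def incseq_def using finite_int_lattice_bounded real_arch_simple by auto
  have F: "sq_norm M f = ennreal ?F"
    unfolding sq_norm_def by (rule nn_integral_eq_integral[OF ff]) auto
  have s_SUP: "?s = (SUP n. ennreal (\<Sum>q\<in>A n. (cmod (?c q))\<^sup>2))"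
    using nn_integral_count_space_SUP[OF A(1,2), of "\<lambda>q. esq (?c q)"] by (simp add: A(3))
  have "?s \<le> ennreal ?F"
    unfolding s_SUP
  proof (rule SUP_least)
    fix n
    have "0 \<le> (LINT x|M. (cmod (f x - (\<Sum>q\<in>A n. ?c q * ?e q x)))\<^sup>2)" by simp
    also have "\<dots> = ?F - (\<Sum>q\<in>A n. (cmod (?c q))\<^sup>2)"
      by (subst expand) (auto simp: A(1), auto simp: A_def)
    finally show "ennreal (\<Sum>q\<in>A n. (cmod (?c q))\<^sup>2) \<le> ennreal ?F" by (intro ennreal_leI) simp
  qed
  moreover have "ennreal ?F \<le> ?s"
  proof (rule ennreal_le_epsilon)
    fix \<delta> :: real assume \<delta>: "0 < \<delta>"
    obtain p where p: "trig_poly p" "sq_norm M (\<lambda>x. f x - p x) < ennreal \<delta>"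
    proof -
      have "0 < ennreal \<delta>" using \<delta> by simp
      then show ?thesis using approximable_L2[OF f fin] that unfolding approximable_def by blast
    qed
    obtain K a where K: "finite K" "K \<subseteq> int_lattice" and pK: "p = (\<lambda>x. \<Sum>q\<in>K. a q * ?e q x)"
      using trig_poly_expansion[OF p(1)] by blast
    have mp [measurable]: "p \<in> borel_measurable M" using borel_measurable_trig_poly[OF p(1)] by (simp add: measurable_M)
    have ip: "integrable M (\<lambda>x. (cmod (f x - p x))\<^sup>2)"
      by (rule integrableI_bounded) (use p(2) in \<open>auto simp: sq_norm_def intro: less_trans\<close>)
    have "ennreal (LINT x|M. (cmod (f x - p x))\<^sup>2) < ennreal \<delta>"
      using p(2) nn_integral_eq_integral[OF ip] by (simp add: sq_norm_def)
    then have "(LINT x|M. (cmod (f x - p x))\<^sup>2) < \<delta>" by (simp add: ennreal_less_iff)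
    \<comment> \<open>The dropped term is the nonnegative sum measuring how far \<open>a\<close> is
      from the optimal coefficients.\<close>
    then have "?F - (\<Sum>q\<in>K. (cmod (?c q))\<^sup>2) < \<delta>"
      unfolding pK expand[OF K] using sum_nonneg[of K "\<lambda>q. (cmod (a q - ?c q))\<^sup>2"] by simp
    then have "ennreal ?F \<le> ennreal ((\<Sum>q\<in>K. (cmod (?c q))\<^sup>2) + \<delta>)" by (intro ennreal_leI) simp
    also have "\<dots> = (\<Sum>q\<in>K. esq (?c q)) + ennreal \<delta>"
      using \<delta> by (simp add: ennreal_plus sum_nonneg)
    also have "(\<Sum>q\<in>K. esq (?c q)) \<le> ?s"
    proof -
      have "(\<Sum>q\<in>K. esq (?c q)) = (\<integral>\<^sup>+q. esq (?c q) \<partial>count_space K)"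
        using K by (simp add: nn_integral_count_space_finite)
      also have "\<dots> = (\<integral>\<^sup>+q. esq (?c q) * indicator K q \<partial>count_space int_lattice)"
        using K by (subst nn_integral_count_space_indicator[of K]) (auto simp: nn_integral_count_space_indicator intro!: nn_integral_cong split: split_indicator)
      also have "\<dots> \<le> ?s" by (intro nn_integral_mono) (auto split: split_indicator)
      finally show ?thesis .
    qed
    finally show "ennreal ?F \<le> ?s + ennreal \<delta>" by (simp add: add_right_mono)
  qed
  ultimately have "?s = ennreal ?F" by (rule antisym)
  then show ?thesis by (simp add: F cis_cnj)
qed

end

abbreviation unit_cell :: "'e::euclidean_space set" where "unit_cell \<equiv> prod_cell {0..<1}"

lemma bounded_half_open: "bounded {l..<u::real}"
  by (rule bounded_subset[of "{l..u}"]) auto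

lemma AE_lborel_inner_neq:
  fixes b :: "'e::euclidean_space"
  assumes "b \<noteq> 0"
  shows "AE x in lborel. x \<bullet> b \<noteq> 0"
proof (rule AE_I')
  have "negligible {x. b \<bullet> x = 0}" by (rule negligible_hyperplane) (use assms in simp)
  moreover have "{x. b \<bullet> x = 0} \<in> sets lborel" by measurable
  ultimately show "{x. b \<bullet> x = 0} \<in> null_sets lborel"
    by (simp add: negligible_iff_null_sets null_sets_completion_iff)
qed (auto simp: inner_commute)

lemma unit_box_measure_density:
  "unit_box_measure (density lborel (\<lambda>x. ennreal (indicator (unit_cell :: 'e::euclidean_space set) x)))"
proof (intro unit_box_measure.intro unit_box_measure_axioms.intro)
  let ?U = "unit_cell :: 'e set" and ?M = "density lborel (\<lambda>x. ennreal (indicator (unit_cell :: 'e set) x))"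
  show "finite_measure ?M"
  proof
    have "emeasure ?M (space ?M) = emeasure lborel ?U"
      by (simp add: emeasure_density ennreal_indicator)
    then show "emeasure ?M (space ?M) \<noteq> \<infinity>"
      using emeasure_prod_cell_finite[OF bounded_half_open[of 0 1], where 'e = 'e] by simp
  qed
  show "sets ?M = sets borel" by simp
  show "AE x in ?M. \<forall>b\<in>Basis. 0 < x \<bullet> b \<and> x \<bullet> b < 1"
  proof (subst AE_density)
    have "AE x in lborel. \<forall>b\<in>(Basis::'e set). x \<bullet> b \<noteq> 0"
      by (intro AE_finite_allI AE_lborel_inner_neq) auto
    then show "AE x in lborel. 0 < ennreal (indicator ?U x) \<longrightarrow> (\<forall>b\<in>Basis. 0 < x \<bullet> b \<and> x \<bullet> b < 1)"
      by eventually_elim (auto simp: indicator_def prod_cell_def less_le split: if_splits)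
  qed simp
  fix q :: 'e assume q: "q \<in> int_lattice"
  have "(LINT x|?M. cis (2 * pi * (q \<bullet> x))) = (LINT x:?U|lborel. cis (2 * pi * (q \<bullet> x)))"
    by (simp add: integral_density set_lebesgue_integral_def)
  also have "\<dots> = (if q = 0 then of_real 1 ^ DIM('e) else 0)"
    using integral_cis_period(2)[of "2 * pi" 1 0]
    by (intro integral_prod_cell_cis q) (auto simp: mult.assoc)
  finally show "(LINT x|?M. cis (2 * pi * (q \<bullet> x))) = (if q = 0 then 1 else 0)" by simp
qed

lemma bij_uminus_int_lattice: "bij_betw uminus (int_lattice :: 'e::euclidean_space set) int_lattice"
  by (rule bij_betwI[of _ _ _ uminus]) (auto intro: int_lattice_uminus)

theorem parseval_unit_cell:
  fixes f :: "'e::euclidean_space \<Rightarrow> complex"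
  assumes f [measurable]: "f \<in> borel_measurable borel" and fin: "(\<integral>\<^sup>+x\<in>unit_cell. esq (f x) \<partial>lborel) < \<infinity>"
  shows "(\<integral>\<^sup>+q. esq (LINT x:unit_cell|lborel. f x * cis (- (2 * pi * (q \<bullet> x)))) \<partial>count_space int_lattice)
    = (\<integral>\<^sup>+x\<in>unit_cell. esq (f x) \<partial>lborel)" (is ?minus)
    and "(\<integral>\<^sup>+q. esq (LINT x:unit_cell|lborel. f x * cis (2 * pi * (q \<bullet> x))) \<partial>count_space int_lattice)
    = (\<integral>\<^sup>+x\<in>unit_cell. esq (f x) \<partial>lborel)" (is ?plus)
proof -
  interpret unit_box_measure "density lborel (\<lambda>x. ennreal (indicator (unit_cell :: 'e set) x))"
    by (rule unit_box_measure_density)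
  have sq: "sq_norm (density lborel (\<lambda>x. ennreal (indicator (unit_cell :: 'e set) x))) f =
    (\<integral>\<^sup>+x\<in>unit_cell. esq (f x) \<partial>lborel)"
    unfolding sq_norm_def by (subst nn_integral_density) (auto simp: ennreal_indicator mult.commute)
  have "(LINT x|density lborel (\<lambda>x. ennreal (indicator (unit_cell :: 'e set) x)). f x * cis (- (2 * pi * (q \<bullet> x)))) =
    (LINT x:unit_cell|lborel. f x * cis (- (2 * pi * (q \<bullet> x))))" for q
    by (subst integral_density) (auto simp: set_lebesgue_integral_def)
  then show m: ?minus using parseval[OF f] fin unfolding sq by simp
  show ?plus
    by (subst m[symmetric], subst nn_integral_bij_count_space[OF bij_uminus_int_lattice, symmetric]) simp
qed

section \<open>Zak transform and Plancherel's identity\<close>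

lemma nn_integral_translate:
  fixes c :: "'e::euclidean_space"
  assumes [measurable]: "f \<in> borel_measurable borel"
  shows "(\<integral>\<^sup>+x. f (c + x) \<partial>lborel) = (\<integral>\<^sup>+x. f x \<partial>lborel)"
  by (subst (2) lborel_distr_plus[of c, symmetric], subst nn_integral_distr) auto

lemma integral_translate:
  fixes c :: "'e::euclidean_space" and f :: "'e \<Rightarrow> complex"
  assumes [measurable]: "f \<in> borel_measurable borel"
  shows "(LINT x|lborel. f (c + x)) = (LINT x|lborel. f x)"
  by (subst (2) lborel_distr_plus[of c, symmetric], subst integral_distr) auto

lemma prod_cell_translate_unique:
  fixes x :: "'e::euclidean_space"
  assumes a: "a > 0"
  shows "\<exists>!q. q \<in> int_lattice \<and> x - a *\<^sub>R q \<in> prod_cell {0..<a}"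
proof (rule ex_ex1I)
  define q where "q = (\<Sum>b\<in>Basis. of_int \<lfloor>(x \<bullet> b) / a\<rfloor> *\<^sub>R b)"
  have qb: "q \<bullet> b = of_int \<lfloor>(x \<bullet> b) / a\<rfloor>" if "b \<in> Basis" for b
    using that by (simp add: q_def)
  have "0 \<le> x \<bullet> b - a * (q \<bullet> b) \<and> x \<bullet> b - a * (q \<bullet> b) < a" if b: "b \<in> Basis" for b
  proof -
    have "of_int \<lfloor>(x \<bullet> b) / a\<rfloor> * a \<le> x \<bullet> b" "x \<bullet> b < (of_int \<lfloor>(x \<bullet> b) / a\<rfloor> + 1) * a"
      using a by (simp_all only: pos_le_divide_eq[symmetric] pos_divide_less_eq[symmetric]) linarith+
    then show ?thesis using qb[OF b] by (simp add: algebra_simps)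
  qed
  then show "\<exists>q. q \<in> int_lattice \<and> x - a *\<^sub>R q \<in> prod_cell {0..<a}"
    by (intro exI[of _ q]) (auto simp: int_lattice_def prod_cell_def qb inner_diff_left)
next
  fix q r assume q: "q \<in> int_lattice \<and> x - a *\<^sub>R q \<in> prod_cell {0..<a}" and r: "r \<in> int_lattice \<and> x - a *\<^sub>R r \<in> prod_cell {0..<a}"
  show "q = r"
  proof (rule int_lattice_eqI)
    fix b :: 'e assume b: "b \<in> Basis"
    have "\<bar>a * ((q - r) \<bullet> b)\<bar> < a"
    proof -
      have "0 \<le> x \<bullet> b - a * (q \<bullet> b)" "x \<bullet> b - a * (q \<bullet> b) < a" "0 \<le> x \<bullet> b - a * (r \<bullet> b)" "x \<bullet> b - a * (r \<bullet> b) < a"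
        using q r b by (simp_all add: prod_cell_def inner_diff_left)
      then show ?thesis by (simp add: inner_diff_left right_diff_distrib abs_less_iff)
    qed
    then show "\<bar>(q - r) \<bullet> b\<bar> < 1" using a by (simp add: abs_mult)
  qed (use q r in auto)
qed

text \<open>For each \<open>x\<close> exactly one lattice translate of the cell contains it, so the
  indicators of the translates sum to 1. Inserting this sum, exchanging it with the integral and
  translating each term gives the identity.\<close>

lemma nn_integral_tiling:
  fixes f :: "'e::euclidean_space \<Rightarrow> ennreal"
  assumes a: "a > 0" and f [measurable]: "f \<in> borel_measurable borel"
  shows "(\<integral>\<^sup>+x. f x \<partial>lborel) = (\<integral>\<^sup>+x\<in>prod_cell {0..<a}. (\<integral>\<^sup>+q. f (x + a *\<^sub>R q) \<partial>count_space int_lattice) \<partial>lborel)"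
proof -
  let ?Q = "prod_cell {0..<a} :: 'e set"
  have "(\<integral>\<^sup>+x. f x \<partial>lborel) = (\<integral>\<^sup>+x. (\<integral>\<^sup>+q. f x * indicator ?Q (x - a *\<^sub>R q) \<partial>count_space int_lattice) \<partial>lborel)"
  proof (rule nn_integral_cong)
    fix x :: 'e
    obtain q where q: "q \<in> int_lattice" "x - a *\<^sub>R q \<in> ?Q" and uniq: "\<And>r. r \<in> int_lattice \<Longrightarrow> x - a *\<^sub>R r \<in> ?Q \<Longrightarrow> r = q"
      using prod_cell_translate_unique[OF a, of x] by auto
    have "(\<integral>\<^sup>+r. f x * indicator ?Q (x - a *\<^sub>R r) \<partial>count_space int_lattice) =
      (\<integral>\<^sup>+r. f x * indicator {q} r \<partial>count_space int_lattice)"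
    proof (rule nn_integral_cong)
      fix r :: 'e assume "r \<in> space (count_space int_lattice)"
      then have "x - a *\<^sub>R r \<in> ?Q \<longleftrightarrow> r \<in> {q}" using q uniq[of r] by auto
      then show "f x * indicator ?Q (x - a *\<^sub>R r) = f x * indicator {q} r" by (simp only: indicator_def)
    qed
    also have "\<dots> = f x"
      using q by (subst nn_integral_indicator_finite) (auto simp: emeasure_count_space_finite)
    finally show "f x = (\<integral>\<^sup>+q. f x * indicator ?Q (x - a *\<^sub>R q) \<partial>count_space int_lattice)" by simp
  qed
  also have "\<dots> = (\<integral>\<^sup>+q. (\<integral>\<^sup>+x. f x * indicator ?Q (x - a *\<^sub>R q) \<partial>lborel) \<partial>count_space int_lattice)"
    by (rule nn_integral_count_space_nn_integral[OF countable_int_lattice]) measurable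
  also have "\<dots> = (\<integral>\<^sup>+q. (\<integral>\<^sup>+x. f (x + a *\<^sub>R q) * indicator ?Q x \<partial>lborel) \<partial>count_space int_lattice)"
  proof (rule nn_integral_cong)
    fix q :: 'e
    show "(\<integral>\<^sup>+x. f x * indicator ?Q (x - a *\<^sub>R q) \<partial>lborel) = (\<integral>\<^sup>+x. f (x + a *\<^sub>R q) * indicator ?Q x \<partial>lborel)"
      by (subst nn_integral_translate[of _ "a *\<^sub>R q", symmetric]) (auto simp: add.commute)
  qed
  also have "\<dots> = (\<integral>\<^sup>+x. (\<integral>\<^sup>+q. f (x + a *\<^sub>R q) * indicator ?Q x \<partial>count_space int_lattice) \<partial>lborel)"
    by (rule nn_integral_count_space_nn_integral[OF countable_int_lattice, symmetric]) measurable
  also have "\<dots> = (\<integral>\<^sup>+x\<in>?Q. (\<integral>\<^sup>+q. f (x + a *\<^sub>R q) \<partial>count_space int_lattice) \<partial>lborel)"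
    by (rule nn_integral_cong, rule nn_integral_multc) simp
  finally show ?thesis .
qed

lemma parseval_finite_prod_cell_nn:
  fixes K :: "'e::euclidean_space set"
  assumes K: "finite K" "K \<subseteq> int_lattice" and I [measurable]: "I \<in> sets borel" and bI: "bounded I" and L: "L > 0"
    and ortho: "\<And>n::int. (LINT s:I|lborel. cis (\<tau> * of_int n * s)) = (if n = 0 then of_real L else 0)"
  shows "(\<integral>\<^sup>+x\<in>prod_cell I. esq (\<Sum>k\<in>K. a k * cis (\<tau> * (k \<bullet> x))) \<partial>lborel) =
    ennreal (L ^ DIM('e)) * (\<Sum>k\<in>K. esq (a k))"
proof -
  let ?g = "\<lambda>x. (cmod (\<Sum>k\<in>K. a k * cis (\<tau> * (k \<bullet> x))))\<^sup>2"
  have "?g x \<le> (\<Sum>k\<in>K. cmod (a k))\<^sup>2" for x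
    by (intro power_mono order_trans[OF norm_sum]) (auto simp: norm_mult)
  then have int: "integrable lborel (\<lambda>x. indicator (prod_cell I) x *\<^sub>R ?g x)"
    using emeasure_prod_cell_finite[OF bI]
    by (intro integrableI_bounded_set_indicator[where B = "(\<Sum>k\<in>K. cmod (a k))\<^sup>2"] always_eventually) simp_all
  have "(\<integral>\<^sup>+x\<in>prod_cell I. ennreal (?g x) \<partial>lborel) = (\<integral>\<^sup>+x. ennreal (indicator (prod_cell I) x *\<^sub>R ?g x) \<partial>lborel)"
    by (intro nn_integral_cong) (auto simp: indicator_def)
  also have "\<dots> = ennreal (LINT x:prod_cell I|lborel. ?g x)"
    unfolding set_lebesgue_integral_def by (rule nn_integral_eq_integral[OF int]) auto
  also have "\<dots> = ennreal (L ^ DIM('e)) * (\<Sum>k\<in>K. esq (a k))"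
    using L by (simp add: parseval_finite_prod_cell[OF K I bI L ortho] ennreal_mult sum_nonneg)
  finally show ?thesis .
qed

text \<open>\<open>J\<close> lists the finitely many lattice translates of the unit cell which meet the support of \<open>h\<close>.\<close>

locale cell_supported =
  fixes h :: "'e::euclidean_space \<Rightarrow> complex" and J :: "'e set"
  assumes h [measurable]: "h \<in> borel_measurable borel"
    and J: "finite J" "J \<subseteq> int_lattice"
    and supp: "\<And>\<theta> j. \<theta> \<in> unit_cell \<Longrightarrow> j \<in> int_lattice \<Longrightarrow> j \<notin> J \<Longrightarrow> h (\<theta> + j) = 0"
begin

lemma indicator_sum: "f \<xi> * h \<xi> = (\<Sum>j\<in>J. indicator unit_cell (\<xi> - j) * (f \<xi> * h \<xi>))"
proof -
  obtain q where q: "q \<in> int_lattice" "\<xi> - 1 *\<^sub>R q \<in> unit_cell" and uniq: "\<And>r. r \<in> int_lattice \<Longrightarrow> \<xi> - 1 *\<^sub>R r \<in> unit_cell \<Longrightarrow> r = q"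
    using prod_cell_translate_unique[of 1 \<xi>] by auto
  have "(\<Sum>j\<in>J. indicator unit_cell (\<xi> - j) * (f \<xi> * h \<xi>)) = (\<Sum>j\<in>J. if j = q then f \<xi> * h \<xi> else 0)"
  proof (rule sum.cong)
    fix j assume "j \<in> J"
    then have "\<xi> - j \<in> unit_cell \<longleftrightarrow> j = q" using q uniq[of j] J by auto
    then show "indicator unit_cell (\<xi> - j) * (f \<xi> * h \<xi>) = (if j = q then f \<xi> * h \<xi> else 0)"
      by (simp add: indicator_def)
  qed simp
  also have "\<dots> = f \<xi> * h \<xi>" using J supp[of "\<xi> - q" q] q by auto
  finally show ?thesis by simp
qed

lemma integral_tiling_finite:
  assumes [measurable]: "f \<in> borel_measurable borel" and int: "integrable lborel (\<lambda>\<xi>. f \<xi> * h \<xi>)"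
  shows "(LINT \<xi>|lborel. f \<xi> * h \<xi>) = (LINT \<theta>:unit_cell|lborel. (\<Sum>j\<in>J. f (\<theta> + j) * h (\<theta> + j)))"
proof -
  have part: "integrable lborel (\<lambda>\<xi>. indicator unit_cell (\<xi> - j) * (f \<xi> * h \<xi>))" for j
    by (rule Bochner_Integration.integrable_bound[OF int]) (auto simp: indicator_def)
  have shift: "(LINT \<xi>|lborel. indicator unit_cell (\<xi> - j) * (f \<xi> * h \<xi>)) =
    (LINT \<theta>|lborel. indicator unit_cell \<theta> * (f (\<theta> + j) * h (\<theta> + j)))" for j
    by (subst integral_translate[of _ j, symmetric]) (auto simp: add.commute)
  have part': "integrable lborel (\<lambda>\<theta>. indicator unit_cell \<theta> * (f (\<theta> + j) * h (\<theta> + j)))" for j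
  proof -
    have "integrable (distr lborel borel ((+) j)) (\<lambda>\<xi>. indicator unit_cell (\<xi> - j) * (f \<xi> * h \<xi>))"
      using part[of j] by (simp only: lborel_distr_plus)
    then have "integrable lborel (\<lambda>\<theta>. indicator unit_cell (j + \<theta> - j) * (f (j + \<theta>) * h (j + \<theta>)))"
      by (subst (asm) integrable_distr_eq) auto
    then show ?thesis by (simp add: add.commute)
  qed
  have "(LINT \<xi>|lborel. f \<xi> * h \<xi>) = (LINT \<xi>|lborel. (\<Sum>j\<in>J. indicator unit_cell (\<xi> - j) * (f \<xi> * h \<xi>)))"
    by (subst indicator_sum) simp
  also have "\<dots> = (\<Sum>j\<in>J. LINT \<theta>|lborel. indicator unit_cell \<theta> * (f (\<theta> + j) * h (\<theta> + j)))"
    using part by (simp add: shift)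
  also have "\<dots> = (LINT \<theta>|lborel. (\<Sum>j\<in>J. indicator unit_cell \<theta> * (f (\<theta> + j) * h (\<theta> + j))))"
    using part' by (subst Bochner_Integration.integral_sum) auto
  also have "\<dots> = (LINT \<theta>:unit_cell|lborel. (\<Sum>j\<in>J. f (\<theta> + j) * h (\<theta> + j)))"
    unfolding set_lebesgue_integral_def
    by (intro Bochner_Integration.integral_cong refl) (auto simp: indicator_def)
  finally show ?thesis .
qed

lemma nn_integral_sq_tiling:
  "(\<integral>\<^sup>+\<theta>\<in>unit_cell. (\<Sum>j\<in>J. esq (h (\<theta> + j))) \<partial>lborel) = (\<integral>\<^sup>+\<xi>. esq (h \<xi>) \<partial>lborel)"
proof -
  have "(\<integral>\<^sup>+\<xi>. esq (h \<xi>) \<partial>lborel) =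
    (\<integral>\<^sup>+\<theta>\<in>unit_cell. (\<integral>\<^sup>+j. esq (h (\<theta> + 1 *\<^sub>R j)) \<partial>count_space int_lattice) \<partial>lborel)"
    by (rule nn_integral_tiling) auto
  also have "\<dots> = (\<integral>\<^sup>+\<theta>\<in>unit_cell. (\<Sum>j\<in>J. esq (h (\<theta> + j))) \<partial>lborel)"
  proof (intro nn_integral_cong)
    fix \<theta> :: 'e
    have "(\<integral>\<^sup>+j. esq (h (\<theta> + 1 *\<^sub>R j)) \<partial>count_space int_lattice) = (\<Sum>j\<in>J. esq (h (\<theta> + j)))"
      if "\<theta> \<in> unit_cell"
      using J supp[OF that] by (subst nn_integral_count_space'[of J]) auto
    then show "(\<integral>\<^sup>+j. esq (h (\<theta> + 1 *\<^sub>R j)) \<partial>count_space int_lattice) * indicator unit_cell \<theta> =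
      (\<Sum>j\<in>J. esq (h (\<theta> + j))) * indicator unit_cell \<theta>"
      by (auto simp: indicator_def)
  qed
  finally show ?thesis by simp
qed

lemma integrable_h:
  assumes fin: "(\<integral>\<^sup>+\<xi>. esq (h \<xi>) \<partial>lborel) < \<infinity>" and [measurable]: "f \<in> borel_measurable borel"
    and f: "\<And>\<xi>. cmod (f \<xi>) \<le> 1"
  shows "integrable lborel (\<lambda>\<xi>. f \<xi> * h \<xi>)"
proof (rule integrable_mult_finite_support[of _ _ _ "\<Union>j\<in>J. (+) j ` unit_cell"])
  have "bounded ((+) j ` (unit_cell :: 'e set))" for j
    by (intro bounded_translation bounded_prod_cell bounded_half_open)
  then show "emeasure lborel (\<Union>j\<in>J. (+) j ` (unit_cell :: 'e set)) < \<infinity>"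
    using J(1) by (intro emeasure_bounded_finite bounded_UN) auto
  have "(+) j ` (unit_cell :: 'e set) = (\<lambda>\<xi>. \<xi> - j) -` unit_cell" for j
    by (auto simp: image_iff intro!: bexI[of _ "_ - j"])
  moreover have "(\<lambda>\<xi>. \<xi> - j) -` (unit_cell :: 'e set) \<in> sets borel" for j
    using measurable_sets_borel[of "\<lambda>\<xi>. \<xi> - j" borel unit_cell] by simp
  ultimately show "(\<Union>j\<in>J. (+) j ` (unit_cell :: 'e set)) \<in> sets lborel"
    using J(1) by (simp add: sets.finite_UN)
  fix \<xi> :: 'e assume \<xi>: "\<xi> \<notin> (\<Union>j\<in>J. (+) j ` unit_cell)"
  obtain q where q: "q \<in> int_lattice" "\<xi> - 1 *\<^sub>R q \<in> unit_cell"
    using prod_cell_translate_unique[of 1 \<xi>] by auto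
  then have "\<xi> \<in> (+) q ` unit_cell" by (intro image_eqI[of _ _ "\<xi> - q"]) auto
  then have "q \<notin> J" using \<xi> by blast
  then show "h \<xi> = 0" using supp[of "\<xi> - q" q] q by auto
qed (use f fin in \<open>auto simp: sq_norm_def\<close>)

text \<open>Since \<open>cis (2 * pi * (q \<bullet> j)) = 1\<close> on the lattice, folding the
  integral over the unit cell turns its value at \<open>x + 2 * pi * q\<close> into the Fourier
  coefficient of order \<open>- q\<close> of one function of \<theta>. Parseval in \<theta> sums
  over all \<open>q\<close>.\<close>

theorem nn_integral_zak:
  assumes fin: "(\<integral>\<^sup>+\<xi>. esq (h \<xi>) \<partial>lborel) < \<infinity>"
  shows "(\<integral>\<^sup>+q. esq (LINT \<xi>|lborel. cis ((x + (2 * pi) *\<^sub>R q) \<bullet> \<xi>) * h \<xi>) \<partial>count_space int_lattice) =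
    (\<integral>\<^sup>+\<theta>\<in>unit_cell. esq (\<Sum>j\<in>J. cis (x \<bullet> (\<theta> + j)) * h (\<theta> + j)) \<partial>lborel)"
proof -
  let ?H = "\<lambda>\<theta>. \<Sum>j\<in>J. cis (x \<bullet> (\<theta> + j)) * h (\<theta> + j)"
  have eq: "(LINT \<xi>|lborel. cis ((x + (2 * pi) *\<^sub>R q) \<bullet> \<xi>) * h \<xi>) =
    (LINT \<theta>:unit_cell|lborel. ?H \<theta> * cis (2 * pi * (q \<bullet> \<theta>)))" if q: "q \<in> int_lattice" for q
  proof -
    have "cis ((x + (2 * pi) *\<^sub>R q) \<bullet> (\<theta> + j)) = cis (x \<bullet> (\<theta> + j)) * cis (2 * pi * (q \<bullet> \<theta>))" if "j \<in> J" for \<theta> j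
    proof -
      have "q \<bullet> j \<in> \<int>" using int_lattice_inner q J that by blast
      then have "cis (2 * pi * (q \<bullet> j)) = 1" by (rule cis_multiple_2pi)
      moreover have "(x + (2 * pi) *\<^sub>R q) \<bullet> (\<theta> + j) = x \<bullet> (\<theta> + j) + 2 * pi * (q \<bullet> \<theta>) + 2 * pi * (q \<bullet> j)"
        by (simp add: inner_add_left inner_add_right distrib_left)
      ultimately show ?thesis by (simp only: cis_mult[symmetric]) simp
    qed
    then have "(\<Sum>j\<in>J. cis ((x + (2 * pi) *\<^sub>R q) \<bullet> (\<theta> + j)) * h (\<theta> + j)) = ?H \<theta> * cis (2 * pi * (q \<bullet> \<theta>))" for \<theta>
      unfolding sum_distrib_right by (intro sum.cong refl) (simp add: mult_ac)
    moreover have "(LINT \<xi>|lborel. cis ((x + (2 * pi) *\<^sub>R q) \<bullet> \<xi>) * h \<xi>) =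
      (LINT \<theta>:unit_cell|lborel. (\<Sum>j\<in>J. cis ((x + (2 * pi) *\<^sub>R q) \<bullet> (\<theta> + j)) * h (\<theta> + j)))"
      by (intro integral_tiling_finite integrable_h fin) auto
    ultimately show ?thesis by simp
  qed
  have Hm: "?H \<in> borel_measurable borel" by measurable
  \<comment> \<open>Parseval requires a square-integrable function; Cauchy-Schwarz over the finite
    set \<open>J\<close> provides this.\<close>
  have "(\<integral>\<^sup>+\<theta>\<in>unit_cell. esq (?H \<theta>) \<partial>lborel) \<le>
    (\<integral>\<^sup>+\<theta>. ennreal (real (card J)) * ((\<Sum>j\<in>J. esq (h (\<theta> + j))) * indicator unit_cell \<theta>) \<partial>lborel)"
  proof (rule nn_integral_mono)
    fix \<theta> :: 'e
    have "(cmod (?H \<theta>))\<^sup>2 \<le> (\<Sum>j\<in>J. 1 * cmod (h (\<theta> + j)))\<^sup>2"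
      by (intro power_mono order_trans[OF norm_sum]) (auto simp: norm_mult)
    also have "\<dots> \<le> (\<Sum>j\<in>J. 1\<^sup>2) * (\<Sum>j\<in>J. (cmod (h (\<theta> + j)))\<^sup>2)"
      by (rule Cauchy_Schwarz_ineq_sum)
    finally have "esq (?H \<theta>) \<le> ennreal (real (card J) * (\<Sum>j\<in>J. (cmod (h (\<theta> + j)))\<^sup>2))"
      by (intro ennreal_leI) simp
    also have "\<dots> = ennreal (real (card J)) * (\<Sum>j\<in>J. esq (h (\<theta> + j)))"
      by (subst ennreal_mult) (auto simp: sum_nonneg)
    finally show "esq (?H \<theta>) * indicator unit_cell \<theta> \<le>
      ennreal (real (card J)) * ((\<Sum>j\<in>J. esq (h (\<theta> + j))) * indicator unit_cell \<theta>)"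
      by (auto simp: indicator_def)
  qed
  also have "\<dots> = ennreal (real (card J)) * (\<integral>\<^sup>+\<xi>. esq (h \<xi>) \<partial>lborel)"
    by (subst nn_integral_cmult) (auto simp: nn_integral_sq_tiling simp del: sum_ennreal)
  also have "\<dots> < \<infinity>" using fin by (simp add: ennreal_mult_less_top)
  finally have "(\<integral>\<^sup>+\<theta>\<in>unit_cell. esq (?H \<theta>) \<partial>lborel) < \<infinity>" .
  note zak = parseval_unit_cell(2)[OF Hm this]
  have "(\<integral>\<^sup>+q. esq (LINT \<xi>|lborel. cis ((x + (2 * pi) *\<^sub>R q) \<bullet> \<xi>) * h \<xi>) \<partial>count_space int_lattice) =
    (\<integral>\<^sup>+q. esq (LINT \<theta>:unit_cell|lborel. ?H \<theta> * cis (2 * pi * (q \<bullet> \<theta>))) \<partial>count_space int_lattice)"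
    by (rule nn_integral_cong) (simp only: eq space_count_space)
  then show ?thesis using zak by (rule trans)
qed

text \<open>Tile the \<open>x\<close>-space by cells of side \<open>2 * pi\<close> and apply the Zak
  identity at each \<open>x\<close> of one cell. After exchanging the integrals, the inner integral
  for fixed \<theta> is the finite Parseval identity in \<open>j\<close>.\<close>

theorem plancherel:
  assumes fin: "(\<integral>\<^sup>+\<xi>. esq (h \<xi>) \<partial>lborel) < \<infinity>"
  shows "(\<integral>\<^sup>+x. esq (LINT \<xi>|lborel. cis (x \<bullet> \<xi>) * h \<xi>) \<partial>lborel) =
    ennreal ((2 * pi) ^ DIM('e)) * (\<integral>\<^sup>+\<xi>. esq (h \<xi>) \<partial>lborel)"
proof -
  let ?Q = "prod_cell {0..<2 * pi} :: 'e set"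
  have "(\<integral>\<^sup>+x. esq (LINT \<xi>|lborel. cis (x \<bullet> \<xi>) * h \<xi>) \<partial>lborel) =
    (\<integral>\<^sup>+x\<in>?Q. (\<integral>\<^sup>+q. esq (LINT \<xi>|lborel. cis ((x + (2 * pi) *\<^sub>R q) \<bullet> \<xi>) * h \<xi>) \<partial>count_space int_lattice) \<partial>lborel)"
    by (rule nn_integral_tiling) auto
  also have "\<dots> = (\<integral>\<^sup>+x. (\<integral>\<^sup>+\<theta>. esq (\<Sum>j\<in>J. cis (x \<bullet> (\<theta> + j)) * h (\<theta> + j)) * indicator unit_cell \<theta> * indicator ?Q x \<partial>lborel) \<partial>lborel)"
    unfolding nn_integral_zak[OF fin] by (subst nn_integral_multc) auto
  also have "\<dots> = (\<integral>\<^sup>+\<theta>. (\<integral>\<^sup>+x. esq (\<Sum>j\<in>J. cis (x \<bullet> (\<theta> + j)) * h (\<theta> + j)) * indicator unit_cell \<theta> * indicator ?Q x \<partial>lborel) \<partial>lborel)"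
    by (rule lborel_pair.Fubini') measurable
  also have "\<dots> = (\<integral>\<^sup>+\<theta>. ennreal ((2 * pi) ^ DIM('e)) * ((\<Sum>j\<in>J. esq (h (\<theta> + j))) * indicator unit_cell \<theta>) \<partial>lborel)"
  proof (rule nn_integral_cong)
    fix \<theta> :: 'e
    \<comment> \<open>The shift \<theta> contributes a common unimodular factor, which leaves a sum
      with frequencies in the lattice.\<close>
    have "(\<Sum>j\<in>J. cis (x \<bullet> (\<theta> + j)) * h (\<theta> + j)) = cis (x \<bullet> \<theta>) * (\<Sum>j\<in>J. h (\<theta> + j) * cis (1 * (j \<bullet> x)))" for x
      by (simp add: sum_distrib_left inner_add_right cis_mult[symmetric] inner_commute mult_ac)
    then have "cmod (\<Sum>j\<in>J. cis (x \<bullet> (\<theta> + j)) * h (\<theta> + j)) = cmod (\<Sum>j\<in>J. h (\<theta> + j) * cis (1 * (j \<bullet> x)))" for x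
      by (simp add: norm_mult)
    then have "(\<integral>\<^sup>+x. esq (\<Sum>j\<in>J. cis (x \<bullet> (\<theta> + j)) * h (\<theta> + j)) * indicator unit_cell \<theta> * indicator ?Q x \<partial>lborel) =
      (\<integral>\<^sup>+x. (esq (\<Sum>j\<in>J. h (\<theta> + j) * cis (1 * (j \<bullet> x))) * indicator ?Q x) * indicator unit_cell \<theta> \<partial>lborel)"
      by (simp add: mult_ac)
    also have "\<dots> = (\<integral>\<^sup>+x\<in>?Q. esq (\<Sum>j\<in>J. h (\<theta> + j) * cis (1 * (j \<bullet> x))) \<partial>lborel) * indicator unit_cell \<theta>"
      by (rule nn_integral_multc) measurable
    also have "(\<integral>\<^sup>+x\<in>?Q. esq (\<Sum>j\<in>J. h (\<theta> + j) * cis (1 * (j \<bullet> x))) \<partial>lborel) =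
      ennreal ((2 * pi) ^ DIM('e)) * (\<Sum>j\<in>J. esq (h (\<theta> + j)))"
      using integral_cis_period(2)[of 1 "2 * pi" 0]
      by (intro parseval_finite_prod_cell_nn J bounded_half_open) auto
    finally show "(\<integral>\<^sup>+x. esq (\<Sum>j\<in>J. cis (x \<bullet> (\<theta> + j)) * h (\<theta> + j)) * indicator unit_cell \<theta> * indicator ?Q x \<partial>lborel) =
      ennreal ((2 * pi) ^ DIM('e)) * ((\<Sum>j\<in>J. esq (h (\<theta> + j))) * indicator unit_cell \<theta>)"
      by (simp only: mult.assoc)
  qed
  also have "\<dots> = ennreal ((2 * pi) ^ DIM('e)) * (\<integral>\<^sup>+\<xi>. esq (h \<xi>) \<partial>lborel)"
    by (subst nn_integral_cmult) (auto simp: nn_integral_sq_tiling simp del: sum_ennreal)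
  finally show ?thesis .
qed

end

section \<open>Limits of truncated isometries\<close>

text \<open>The weights \<open>4^k\<close> are beaten by \<open>8^(- k)\<close>, so the weighted sum
  of squared increments is integrable and finite almost everywhere. There the increments are at most
  a constant times \<open>2^(- k)\<close>, hence summable.\<close>

lemma AE_convergent_subsequence:
  fixes u :: "nat \<Rightarrow> 'a \<Rightarrow> complex"
  assumes [measurable]: "\<And>k. u k \<in> borel_measurable M"
    and small: "\<And>k. sq_norm M (\<lambda>x. u (Suc k) x - u k x) \<le> ennreal ((1/8) ^ k)"
  shows "AE x in M. convergent (\<lambda>k. u k x)"
proof -
  let ?d = "\<lambda>k x. esq (u (Suc k) x - u k x)"
  have "(\<integral>\<^sup>+x. (\<Sum>k. ennreal (4 ^ k) * ?d k x) \<partial>M) = (\<Sum>k. ennreal (4 ^ k) * sq_norm M (\<lambda>x. u (Suc k) x - u k x))"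
    by (simp add: nn_integral_suminf nn_integral_cmult sq_norm_def)
  also have "\<dots> \<le> (\<Sum>k. ennreal ((1/2) ^ k))"
  proof (rule suminf_le)
    fix k :: nat
    have "ennreal (4 ^ k) * sq_norm M (\<lambda>x. u (Suc k) x - u k x) \<le> ennreal (4 ^ k) * ennreal ((1/8) ^ k)"
      by (intro mult_left_mono small) simp
    also have "\<dots> = ennreal ((1/2) ^ k)"
      by (simp add: ennreal_mult[symmetric] power_mult_distrib[symmetric])
    finally show "ennreal (4 ^ k) * sq_norm M (\<lambda>x. u (Suc k) x - u k x) \<le> ennreal ((1/2) ^ k)" .
  qed auto
  also have "\<dots> = ennreal (\<Sum>k. (1/2) ^ k)"
    by (rule suminf_ennreal2) (auto intro: summable_geometric)
  finally have fin: "(\<integral>\<^sup>+x. (\<Sum>k. ennreal (4 ^ k) * ?d k x) \<partial>M) \<noteq> \<infinity>"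
    by (auto simp: top_unique)
  have "AE x in M. (\<Sum>k. ennreal (4 ^ k) * ?d k x) \<noteq> \<infinity>"
    by (rule nn_integral_PInf_AE[OF _ fin]) measurable
  then show ?thesis
  proof eventually_elim
    fix x assume "(\<Sum>k. ennreal (4 ^ k) * ?d k x) \<noteq> \<infinity>"
    then obtain S where S: "S \<ge> 0" "(\<Sum>k. ennreal (4 ^ k) * ?d k x) = ennreal S"
      by (cases "\<Sum>k. ennreal (4 ^ k) * ?d k x") auto
    have le: "cmod (u (Suc k) x - u k x) \<le> sqrt S * (1/2) ^ k" for k
    proof -
      have "ennreal (4 ^ k) * ?d k x \<le> (\<Sum>k. ennreal (4 ^ k) * ?d k x)"
        using sum_le_suminf[of "\<lambda>k. ennreal (4 ^ k) * ?d k x" "{k}"] by simp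
      then have "ennreal (4 ^ k * (cmod (u (Suc k) x - u k x))\<^sup>2) \<le> ennreal S" by (simp add: S(2) ennreal_mult)
      then have "4 ^ k * (cmod (u (Suc k) x - u k x))\<^sup>2 \<le> S" using S(1) by (simp add: ennreal_le_iff)
      then have "(2 ^ k * cmod (u (Suc k) x - u k x))\<^sup>2 \<le> S"
        by (simp add: power_mult_distrib power2_eq_square[of "2 ^ k"] flip: power_mult_distrib[of 2 2])
      then have "2 ^ k * cmod (u (Suc k) x - u k x) \<le> sqrt S" by (rule real_le_rsqrt)
      then show ?thesis by (simp add: field_simps power_one_over)
    qed
    have "summable (\<lambda>k. u (Suc k) x - u k x)"
      by (rule summable_comparison_test[of _ "\<lambda>k. sqrt S * (1/2) ^ k"])
        (auto intro!: exI[of _ 0] le summable_mult summable_geometric)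
    then have "convergent (\<lambda>n. \<Sum>k<n. u (Suc k) x - u k x)" by (simp add: summable_iff_convergent)
    then have "convergent (\<lambda>n. u n x - u 0 x)" using sum_lessThan_telescope[of "\<lambda>k. u k x"] by simp
    then have "convergent (\<lambda>n. (u n x - u 0 x) + u 0 x)" by (intro convergent_add convergent_const)
    then show "convergent (\<lambda>k. u k x)" by simp
  qed
qed

theorem riesz_fischer:
  fixes f :: "nat \<Rightarrow> 'a \<Rightarrow> complex"
  assumes f [measurable]: "\<And>n. f n \<in> borel_measurable M"
    and cauchy: "\<And>\<epsilon>::ennreal. 0 < \<epsilon> \<Longrightarrow> \<exists>N. \<forall>m\<ge>N. \<forall>n\<ge>N. sq_norm M (\<lambda>x. f m x - f n x) < \<epsilon>"
  shows "\<exists>g. g \<in> borel_measurable M \<and> (\<lambda>n. sq_norm M (\<lambda>x. f n x - g x)) \<longlonglongrightarrow> 0"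
proof -
  have "\<exists>N. \<forall>m\<ge>N. \<forall>n\<ge>N. sq_norm M (\<lambda>x. f m x - f n x) < ennreal ((1/8) ^ k)" for k :: nat
    by (rule cauchy) simp
  then obtain N where N: "\<And>k m n. m \<ge> N k \<Longrightarrow> n \<ge> N k \<Longrightarrow> sq_norm M (\<lambda>x. f m x - f n x) < ennreal ((1/8) ^ k)"
    by metis
  \<comment> \<open>An increasing index sequence that dominates \<open>N\<close> and tends to
    infinity.\<close>
  define r where "r k = (\<Sum>i\<le>k. N i) + k" for k
  have rN: "N k \<le> r k" for k
    using member_le_sum[of k "{..k}" N] by (simp add: r_def)
  have rk: "k \<le> r k" and rS: "r k \<le> r (Suc k)" for k by (auto simp: r_def)
  \<comment> \<open>Where the subsequence diverges the value of \<open>lim\<close> is arbitrary;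
    this happens only on a null set.\<close>
  define g where "g x = lim (\<lambda>k. f (r k) x)" for x
  have gm [measurable]: "g \<in> borel_measurable M" unfolding g_def by measurable
  have conv: "AE x in M. (\<lambda>k. f (r k) x) \<longlonglongrightarrow> g x"
  proof -
    have "AE x in M. convergent (\<lambda>k. f (r k) x)"
    proof (rule AE_convergent_subsequence)
      fix k
      show "sq_norm M (\<lambda>x. f (r (Suc k)) x - f (r k) x) \<le> ennreal ((1/8) ^ k)"
        by (rule less_imp_le[OF N]) (use rN[of k] rS[of k] in auto)
    qed measurable
    then show ?thesis by eventually_elim (simp add: g_def convergent_LIMSEQ_iff)
  qed
  have "(\<lambda>n. sq_norm M (\<lambda>x. f n x - g x)) \<longlonglongrightarrow> 0"
  proof (rule order_tendstoI)
    fix \<epsilon> :: ennreal assume "0 < \<epsilon>"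
    then obtain \<delta> where \<delta>: "0 < \<delta>" "\<delta> < \<epsilon>" using dense by blast
    then obtain n0 where n0: "\<And>m n. m \<ge> n0 \<Longrightarrow> n \<ge> n0 \<Longrightarrow> sq_norm M (\<lambda>x. f m x - f n x) < \<delta>"
      using cauchy by blast
    have "sq_norm M (\<lambda>x. f n x - g x) \<le> \<delta>" if n: "n \<ge> n0" for n
    proof -
      \<comment> \<open>Fatou's lemma transfers the Cauchy bound from the subsequence to its
        limit.\<close>
      have "sq_norm M (\<lambda>x. f n x - g x) = (\<integral>\<^sup>+x. liminf (\<lambda>k. esq (f n x - f (r k) x)) \<partial>M)"
        unfolding sq_norm_def
      proof (rule nn_integral_cong_AE, use conv in eventually_elim)
        fix x assume "(\<lambda>k. f (r k) x) \<longlonglongrightarrow> g x"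
        then have "(\<lambda>k. esq (f n x - f (r k) x)) \<longlonglongrightarrow> esq (f n x - g x)"
          by (intro tendsto_intros)
        then show "esq (f n x - g x) = liminf (\<lambda>k. esq (f n x - f (r k) x))"
          by (rule lim_imp_Liminf[OF trivial_limit_sequentially, symmetric])
      qed
      also have "\<dots> \<le> liminf (\<lambda>k. sq_norm M (\<lambda>x. f n x - f (r k) x))"
        unfolding sq_norm_def by (rule nn_integral_liminf) measurable
      also have "\<dots> \<le> limsup (\<lambda>k. sq_norm M (\<lambda>x. f n x - f (r k) x))"
        by (rule Liminf_le_Limsup) simp
      also have "\<dots> \<le> \<delta>"
      proof (rule Limsup_bounded)
        show "\<forall>\<^sub>F k in sequentially. sq_norm M (\<lambda>x. f n x - f (r k) x) \<le> \<delta>"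
        proof (rule eventually_sequentiallyI[of n0], rule less_imp_le[OF n0[OF n]])
          fix k assume "n0 \<le> k"
          then show "n0 \<le> r k" using rk order_trans by blast
        qed
      qed
      finally show ?thesis .
    qed
    then show "\<forall>\<^sub>F n in sequentially. sq_norm M (\<lambda>x. f n x - g x) < \<epsilon>"
      using \<delta> by (intro eventually_sequentiallyI[of n0]) (meson le_less_trans)
  qed simp
  then show ?thesis using gm by blast
qed

lemma L2_iff: "f \<in> L2 M \<longleftrightarrow> f \<in> borel_measurable M \<and> sq_norm M f < \<infinity>"
proof -
  have "integrable M (\<lambda>z. (cmod (f z))\<^sup>2) \<longleftrightarrow> sq_norm M f < \<infinity>" if [measurable]: "f \<in> borel_measurable M"
    by (simp add: integrable_iff_bounded sq_norm_def)
  then show ?thesis by (auto simp: L2_def)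
qed

lemma L2_norm_squared:
  assumes "f \<in> L2 M"
  shows "ennreal ((L2_norm M f)\<^sup>2) = sq_norm M f"
proof -
  have "integrable M (\<lambda>z. (cmod (f z))\<^sup>2)" using assms by (simp add: L2_def)
  then have "sq_norm M f = ennreal (LINT z|M. (cmod (f z))\<^sup>2)"
    unfolding sq_norm_def by (rule nn_integral_eq_integral) auto
  then show ?thesis by (simp add: L2_norm_def)
qed

lemma sq_norm_finite_add:
  assumes "f \<in> borel_measurable M" "g \<in> borel_measurable M" "sq_norm M f < \<infinity>" "sq_norm M g < \<infinity>"
  shows "sq_norm M (\<lambda>z. f z + g z) < \<infinity>"
  using le_less_trans[OF sq_norm_add_le[OF assms(1,2)]] assms(3,4) by (simp add: ennreal_mult_less_top)

text \<open>This legitimizes the choice in \<open>L2_lim\<close>. Completeness yields a limit along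
  the integers, and the Cauchy condition in the real parameter upgrades it to a limit as
  \<open>R\<close> tends to infinity.\<close>

theorem L2_lim_properties:
  assumes f [measurable]: "\<And>R. f R \<in> borel_measurable M" and fin: "\<And>R. sq_norm M (f R) < \<infinity>"
    and cauchy: "\<And>\<epsilon>::ennreal. 0 < \<epsilon> \<Longrightarrow> \<exists>R0::real. \<forall>R\<ge>R0. \<forall>R'\<ge>R0. sq_norm M (\<lambda>z. f R z - f R' z) < \<epsilon>"
  shows "L2_lim M f \<in> L2 M" and "((\<lambda>R. sq_norm M (\<lambda>z. f R z - L2_lim M f z)) \<longlongrightarrow> 0) at_top"
proof -
  have "\<exists>N. \<forall>m\<ge>N. \<forall>n\<ge>N. sq_norm M (\<lambda>x. f (real m) x - f (real n) x) < \<epsilon>" if "0 < \<epsilon>" for \<epsilon>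
  proof -
    obtain R0 where R0: "\<And>R R'. R0 \<le> R \<Longrightarrow> R0 \<le> R' \<Longrightarrow> sq_norm M (\<lambda>z. f R z - f R' z) < \<epsilon>" using cauchy[OF \<open>0 < \<epsilon>\<close>] by blast
    obtain N where "R0 \<le> real N" using real_arch_simple by blast
    then show ?thesis by (intro exI[of _ N] allI impI R0) auto
  qed
  from riesz_fischer[OF f this] obtain g where g [measurable]: "g \<in> borel_measurable M"
    and lim: "(\<lambda>n. sq_norm M (\<lambda>x. f (real n) x - g x)) \<longlonglongrightarrow> 0" by blast
  have limR: "((\<lambda>R. sq_norm M (\<lambda>z. f R z - g z)) \<longlongrightarrow> 0) at_top"
  proof (rule order_tendstoI)
    fix \<epsilon> :: ennreal assume \<epsilon>: "0 < \<epsilon>"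
    then have e4: "0 < \<epsilon> / 4" by (simp add: ennreal_zero_less_divide)
    obtain R0 where R0: "\<And>R R'. R0 \<le> R \<Longrightarrow> R0 \<le> R' \<Longrightarrow> sq_norm M (\<lambda>z. f R z - f R' z) < \<epsilon> / 4" using cauchy[OF e4] by blast
    obtain N where N: "\<And>n. N \<le> n \<Longrightarrow> sq_norm M (\<lambda>x. f (real n) x - g x) < \<epsilon> / 4"
      using order_tendstoD(2)[OF lim e4] by (auto simp: eventually_sequentially)
    obtain N' where N': "R0 \<le> real N'" using real_arch_simple by blast
    define n where "n = max N N'"
    have "sq_norm M (\<lambda>z. f R z - g z) < \<epsilon>" if R: "R0 \<le> R" for R
    proof -
      have "sq_norm M (\<lambda>z. f R z - g z) = sq_norm M (\<lambda>z. (f R z - f (real n) z) + (f (real n) z - g z))" by simp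
      also have "\<dots> \<le> 2 * sq_norm M (\<lambda>z. f R z - f (real n) z) + 2 * sq_norm M (\<lambda>z. f (real n) z - g z)"
        by (rule sq_norm_add_le) measurable
      also have "\<dots> < 2 * (\<epsilon> / 4) + 2 * (\<epsilon> / 4)"
        using R0[OF R, of "real n"] N[of n] N'
        by (intro add_strict_mono ennreal_mult_strict_left_mono) (auto simp: n_def)
      also have "\<dots> = \<epsilon>" by (rule ennreal_two_quarters)
      finally show ?thesis .
    qed
    then show "\<forall>\<^sub>F R in at_top. sq_norm M (\<lambda>z. f R z - g z) < \<epsilon>"
      by (auto simp: eventually_at_top_linorder)
  qed simp
  have "g \<in> L2 M"
  proof -
    obtain n where n: "sq_norm M (\<lambda>x. f (real n) x - g x) < 1"
      using order_tendstoD(2)[OF lim, of 1] by (auto simp: eventually_sequentially)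
    have "sq_norm M (\<lambda>x. f (real n) x + (g x - f (real n) x)) < \<infinity>"
    proof (rule sq_norm_finite_add)
      show "sq_norm M (\<lambda>x. g x - f (real n) x) < \<infinity>"
        using n by (subst sq_norm_minus) (auto intro: less_trans)
    qed (use fin in measurable)
    then show ?thesis by (simp add: L2_iff)
  qed
  then have "\<exists>g. g \<in> L2 M \<and> ((\<lambda>R. \<integral>\<^sup>+z. esq (f R z - g z) \<partial>M) \<longlongrightarrow> 0) at_top"
    using limR unfolding sq_norm_def by blast
  from someI_ex[OF this]
  show "L2_lim M f \<in> L2 M" "((\<lambda>R. sq_norm M (\<lambda>z. f R z - L2_lim M f z)) \<longlongrightarrow> 0) at_top"
    unfolding L2_lim_def sq_norm_def by auto
qed

section \<open>Rescaling Parseval's identity to the torus\<close>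

lemma nn_integral_scale:
  fixes f :: "'e::euclidean_space \<Rightarrow> ennreal"
  assumes [measurable]: "f \<in> borel_measurable borel" and a: "a > 0"
  shows "(\<integral>\<^sup>+x. f x \<partial>lborel) = ennreal (a ^ DIM('e)) * (\<integral>\<^sup>+x. f (a *\<^sub>R x) \<partial>lborel)"
  by (subst lborel_affine[of a 0]) (use a in \<open>auto simp: nn_integral_density nn_integral_distr nn_integral_cmult\<close>)

lemma integral_scale:
  fixes f :: "'e::euclidean_space \<Rightarrow> complex"
  assumes [measurable]: "f \<in> borel_measurable borel" and a: "a > 0"
  shows "(LINT x|lborel. f x) = of_real (a ^ DIM('e)) * (LINT x|lborel. f (a *\<^sub>R x))"
  by (subst lborel_affine[of a 0])
    (use a in \<open>auto simp: integral_density integral_distr scaleR_conv_of_real\<close>)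

lemma prod_cell_scale: "a > 0 \<Longrightarrow> a *\<^sub>R x \<in> prod_cell {0..<a} \<longleftrightarrow> x \<in> unit_cell"
  by (auto simp: prod_cell_def zero_le_mult_iff)

text \<open>Rescaling by \<open>2 * pi\<close> multiplies each coefficient by the volume of the
  cell, hence its square by the volume squared; one of the two factors is absorbed by rescaling the
  norm of \<open>v\<close>.\<close>

theorem parseval_torus:
  fixes v :: "'e::euclidean_space \<Rightarrow> complex"
  assumes v [measurable]: "v \<in> borel_measurable borel"
    and fin: "(\<integral>\<^sup>+y\<in>prod_cell {0..<2 * pi}. esq (v y) \<partial>lborel) < \<infinity>"
  shows "(\<integral>\<^sup>+k. esq (LINT y:prod_cell {0..<2 * pi}|lborel. cis (- (y \<bullet> k)) * v y) \<partial>count_space int_lattice)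
    = ennreal ((2 * pi) ^ DIM('e)) * (\<integral>\<^sup>+y\<in>prod_cell {0..<2 * pi}. esq (v y) \<partial>lborel)"
proof -
  let ?D = "(2 * pi) ^ DIM('e)" and ?v = "\<lambda>y. v ((2 * pi) *\<^sub>R y)"
  have ind: "indicator (prod_cell {0..<2 * pi}) ((2 * pi) *\<^sub>R y) = indicator unit_cell y" for y :: 'e
    by (simp add: indicator_def prod_cell_scale)
  have sq: "(\<integral>\<^sup>+y\<in>prod_cell {0..<2 * pi}. esq (v y) \<partial>lborel) =
    ennreal ?D * (\<integral>\<^sup>+y\<in>unit_cell. esq (?v y) \<partial>lborel)"
    by (subst nn_integral_scale[where a = "2 * pi"]) (auto simp: ind)
  have coef: "(LINT y:prod_cell {0..<2 * pi}|lborel. cis (- (y \<bullet> k)) * v y) =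
    of_real ?D * (LINT y:unit_cell|lborel. ?v y * cis (- (2 * pi * (k \<bullet> y))))" for k
  proof -
    have "(LINT y:prod_cell {0..<2 * pi}|lborel. cis (- (y \<bullet> k)) * v y) =
      of_real ?D * (LINT y|lborel. indicator unit_cell y *\<^sub>R (cis (- (((2 * pi) *\<^sub>R y) \<bullet> k)) * ?v y))"
      unfolding set_lebesgue_integral_def by (subst integral_scale[where a = "2 * pi"]) (simp_all add: ind)
    also have "(LINT y|lborel. indicator unit_cell y *\<^sub>R (cis (- (((2 * pi) *\<^sub>R y) \<bullet> k)) * ?v y)) =
      (LINT y:unit_cell|lborel. ?v y * cis (- (2 * pi * (k \<bullet> y))))"
      unfolding set_lebesgue_integral_def
    proof (intro Bochner_Integration.integral_cong refl)
      fix y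
      have "((2 * pi) *\<^sub>R y) \<bullet> k = 2 * pi * (k \<bullet> y)" by (simp add: inner_commute)
      then show "indicator unit_cell y *\<^sub>R (cis (- (((2 * pi) *\<^sub>R y) \<bullet> k)) * ?v y) =
        indicator unit_cell y *\<^sub>R (?v y * cis (- (2 * pi * (k \<bullet> y))))" by (simp only: mult.commute)
    qed
    finally show ?thesis .
  qed
  have fin': "(\<integral>\<^sup>+y\<in>unit_cell. esq (?v y) \<partial>lborel) < \<infinity>"
  proof -
    have "ennreal ?D \<noteq> 0" by (simp add: not_le)
    then show ?thesis using fin unfolding sq infinity_ennreal_def ennreal_mult_less_top by auto
  qed
  have "(\<integral>\<^sup>+k. esq (LINT y:prod_cell {0..<2 * pi}|lborel. cis (- (y \<bullet> k)) * v y) \<partial>count_space int_lattice) =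
    (\<integral>\<^sup>+k. ennreal (?D\<^sup>2) * esq (LINT y:unit_cell|lborel. ?v y * cis (- (2 * pi * (k \<bullet> y)))) \<partial>count_space int_lattice)"
    unfolding coef by (simp add: norm_mult power_mult_distrib ennreal_mult norm_power)
  also have "\<dots> = ennreal (?D\<^sup>2) * (\<integral>\<^sup>+y\<in>unit_cell. esq (?v y) \<partial>lborel)"
    by (subst nn_integral_cmult) (simp_all add: parseval_unit_cell(1)[OF _ fin'])
  also have "\<dots> = ennreal ?D * (ennreal ?D * (\<integral>\<^sup>+y\<in>unit_cell. esq (?v y) \<partial>lborel))"
    by (simp add: power2_eq_square ennreal_mult mult.assoc)
  finally show ?thesis unfolding sq .
qed

section \<open>Truncation and passage to the limit\<close>

lemma ennreal_le_epsilon': 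
  fixes x y :: ennreal
  assumes "\<And>\<epsilon>. 0 < \<epsilon> \<Longrightarrow> x \<le> y + \<epsilon>"
  shows "x \<le> y"
  by (rule ennreal_le_epsilon) (use assms in simp)

text \<open>The common pattern of the Fourier transform and its inverse. On functions supported in
  some \<open>B R\<close> both are honest integrals; the integral is additive only when both
  integrals converge, so \<open>T_diff\<close> asks for a common \<open>B R\<close>.\<close>

locale truncated_isometry =
  fixes M1 :: "'a measure" and M2 :: "'b measure" and B :: "real \<Rightarrow> 'a set" and T :: "('a \<Rightarrow> complex) \<Rightarrow> 'b \<Rightarrow> complex"
  assumes sets_B [measurable]: "\<And>R. B R \<in> sets M1"
    and mono_B: "\<And>R R'. R \<le> R' \<Longrightarrow> B R \<subseteq> B R'"
    and exhaust: "\<And>z. z \<in> space M1 \<Longrightarrow> \<exists>n::nat. z \<in> B (real n)"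
    and measurable_T: "\<And>w. w \<in> borel_measurable M1 \<Longrightarrow> T w \<in> borel_measurable M2"
    and isometry: "\<And>w R. w \<in> borel_measurable M1 \<Longrightarrow> sq_norm M1 w < \<infinity> \<Longrightarrow> (\<And>z. z \<notin> B R \<Longrightarrow> w z = 0) \<Longrightarrow>
      sq_norm M2 (T w) = sq_norm M1 w"
    and T_diff: "\<And>w w' R \<zeta>. w \<in> borel_measurable M1 \<Longrightarrow> sq_norm M1 w < \<infinity> \<Longrightarrow> (\<And>z. z \<notin> B R \<Longrightarrow> w z = 0) \<Longrightarrow>
      w' \<in> borel_measurable M1 \<Longrightarrow> sq_norm M1 w' < \<infinity> \<Longrightarrow> (\<And>z. z \<notin> B R \<Longrightarrow> w' z = 0) \<Longrightarrow>
      T (\<lambda>z. w z - w' z) \<zeta> = T w \<zeta> - T w' \<zeta>"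
begin

definition truncation :: "('a \<Rightarrow> complex) \<Rightarrow> real \<Rightarrow> 'b \<Rightarrow> complex" where
  "truncation u R = T (\<lambda>z. indicator (B R) z * u z)"

definition tail :: "('a \<Rightarrow> complex) \<Rightarrow> real \<Rightarrow> ennreal" where
  "tail u R = (\<integral>\<^sup>+z. esq (u z) * indicator (space M1 - B R) z \<partial>M1)"

lemma sq_norm_indicator_le: "sq_norm M (\<lambda>z. indicator A z * u z) \<le> sq_norm M u"
  unfolding sq_norm_def by (intro nn_integral_mono ennreal_leI) (auto simp: indicator_def)

lemma measurable_truncation: "u \<in> borel_measurable M1 \<Longrightarrow> truncation u R \<in> borel_measurable M2"
  unfolding truncation_def by (rule measurable_T) measurable

lemma sq_norm_truncation:
  assumes "u \<in> borel_measurable M1" "sq_norm M1 u < \<infinity>"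
  shows "sq_norm M2 (truncation u R) = sq_norm M1 (\<lambda>z. indicator (B R) z * u z)"
  unfolding truncation_def
  by (rule isometry[of _ R]) (use assms le_less_trans[OF sq_norm_indicator_le] in \<open>auto simp: indicator_def\<close>)

lemma sq_norm_truncation_diff:
  assumes u [measurable]: "u \<in> borel_measurable M1" and fin: "sq_norm M1 u < \<infinity>" and R: "R \<le> R'"
  shows "sq_norm M2 (\<lambda>\<zeta>. truncation u R \<zeta> - truncation u R' \<zeta>) \<le> tail u R"
proof -
  let ?w = "\<lambda>R z. indicator (B R) z * u z"
  have finR: "sq_norm M1 (?w R) < \<infinity>" for R by (rule le_less_trans[OF sq_norm_indicator_le fin])
  have supp: "z \<notin> B R' \<Longrightarrow> ?w R z = 0" "z \<notin> B R' \<Longrightarrow> ?w R' z = 0" for z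
    using mono_B[OF R] by (auto simp: indicator_def)
  have "sq_norm M2 (\<lambda>\<zeta>. truncation u R \<zeta> - truncation u R' \<zeta>) = sq_norm M2 (T (\<lambda>z. ?w R z - ?w R' z))"
    unfolding truncation_def
    by (subst T_diff[of "?w R" R' "?w R'", symmetric]) (use finR supp in \<open>auto simp: truncation_def\<close>)
  also have "\<dots> = sq_norm M1 (\<lambda>z. ?w R z - ?w R' z)"
  proof (rule isometry[of _ R'])
    have "sq_norm M1 (\<lambda>z. ?w R z - ?w R' z) \<le> 2 * sq_norm M1 (?w R) + 2 * sq_norm M1 (?w R')"
      by (rule sq_norm_diff_le) measurable
    then show "sq_norm M1 (\<lambda>z. ?w R z - ?w R' z) < \<infinity>"
      by (rule le_less_trans) (use finR in \<open>simp add: ennreal_mult_less_top\<close>)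
    show "z \<notin> B R' \<Longrightarrow> ?w R z - ?w R' z = 0" for z using supp by simp
  qed measurable
  also have "\<dots> \<le> tail u R"
    unfolding sq_norm_def tail_def
    by (intro nn_integral_mono) (use mono_B[OF R] in \<open>auto simp: indicator_def\<close>)
  finally show ?thesis .
qed

lemma tail_mono: "R \<le> R' \<Longrightarrow> tail u R' \<le> tail u R"
  unfolding tail_def using mono_B by (intro nn_integral_mono) (auto simp: indicator_def)

lemma tail_tendsto_0:
  assumes u [measurable]: "u \<in> borel_measurable M1" and fin: "sq_norm M1 u < \<infinity>"
  shows "(\<lambda>n. tail u (real n)) \<longlonglongrightarrow> 0"
proof -
  have "(\<lambda>n. tail u (real n)) \<longlonglongrightarrow> (\<integral>\<^sup>+z. 0 \<partial>M1)"
    unfolding tail_def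
  proof (rule nn_integral_dominated_convergence)
    show "(\<integral>\<^sup>+z. esq (u z) \<partial>M1) < \<infinity>" using fin by (simp add: sq_norm_def)
    show "AE z in M1. (\<lambda>n. esq (u z) * indicator (space M1 - B (real n)) z) \<longlonglongrightarrow> 0"
    proof (rule AE_I2)
      fix z assume "z \<in> space M1"
      then obtain n0 where n0: "z \<in> B (real n0)" using exhaust by blast
      have "esq (u z) * indicator (space M1 - B (real n)) z = 0" if "n0 \<le> n" for n
        using mono_B[of "real n0" "real n"] n0 that by (auto simp: indicator_def)
      then show "(\<lambda>n. esq (u z) * indicator (space M1 - B (real n)) z) \<longlonglongrightarrow> 0"
        by (intro tendsto_eventually eventually_sequentiallyI[of n0])
    qed
  qed (auto simp: indicator_def)
  then show ?thesis by simp
qed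

text \<open>The truncations form a Cauchy family because their differences are controlled by the
  mass of \<open>u\<close> outside \<open>B R\<close>. Exact constants would be 1; the factors 2
  come from \<open>sq_norm_add_le\<close> and only affect the final constant. The third claim says
  that the limit does not lose \<open>u\<close>.\<close>

lemma L2_lim_truncation:
  assumes u: "u \<in> L2 M1"
  shows "L2_lim M2 (truncation u) \<in> L2 M2"
    and "sq_norm M2 (\<lambda>\<zeta>. truncation u R \<zeta> - L2_lim M2 (truncation u) \<zeta>) \<le> 2 * tail u R"
    and "sq_norm M1 u \<le> 2 * sq_norm M2 (L2_lim M2 (truncation u))"
proof -
  have um [measurable]: "u \<in> borel_measurable M1" and fin: "sq_norm M1 u < \<infinity>" using u by (auto simp: L2_iff)
  have tm [measurable]: "truncation u R \<in> borel_measurable M2" for R by (rule measurable_truncation) measurable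
  have finR: "sq_norm M2 (truncation u R) < \<infinity>" for R
    unfolding sq_norm_truncation[OF um fin] by (rule le_less_trans[OF sq_norm_indicator_le fin])
  have cauchy: "\<exists>R0. \<forall>R\<ge>R0. \<forall>R'\<ge>R0. sq_norm M2 (\<lambda>z. truncation u R z - truncation u R' z) < \<epsilon>" if "0 < \<epsilon>" for \<epsilon>
  proof -
    obtain n where n: "tail u (real n) < \<epsilon>"
      using order_tendstoD(2)[OF tail_tendsto_0[OF um fin] \<open>0 < \<epsilon>\<close>] by (auto simp: eventually_sequentially)
    have "sq_norm M2 (\<lambda>z. truncation u R z - truncation u R' z) < \<epsilon>" if "real n \<le> R" "real n \<le> R'" for R R'
    proof (cases "R \<le> R'")
      case True
      have "sq_norm M2 (\<lambda>z. truncation u R z - truncation u R' z) \<le> tail u (real n)"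
        by (rule order_trans[OF sq_norm_truncation_diff[OF um fin True] tail_mono[OF that(1)]])
      then show ?thesis using n by (rule le_less_trans)
    next
      case False
      then have "sq_norm M2 (\<lambda>z. truncation u R' z - truncation u R z) \<le> tail u (real n)"
        by (intro order_trans[OF sq_norm_truncation_diff[OF um fin] tail_mono[OF that(2)]]) simp
      then show ?thesis using n unfolding sq_norm_minus[of M2 "truncation u R"] by (rule le_less_trans)
    qed
    then show ?thesis by blast
  qed
  let ?g = "L2_lim M2 (truncation u)"
  have lim: "?g \<in> L2 M2" "((\<lambda>R. sq_norm M2 (\<lambda>z. truncation u R z - ?g z)) \<longlongrightarrow> 0) at_top"
    using L2_lim_properties[OF tm finR cauchy] by blast+
  show "?g \<in> L2 M2" by (rule lim(1))
  then have gm [measurable]: "?g \<in> borel_measurable M2" by (simp add: L2_iff)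
  have close: "sq_norm M2 (\<lambda>\<zeta>. truncation u R \<zeta> - ?g \<zeta>) \<le> 2 * tail u R" for R
  proof (rule ennreal_le_epsilon')
    fix \<epsilon> :: ennreal assume "0 < \<epsilon>"
    then have e2: "0 < \<epsilon> / 2" by (simp add: ennreal_zero_less_divide)
    obtain R0 where R0: "\<And>R. R0 \<le> R \<Longrightarrow> sq_norm M2 (\<lambda>z. truncation u R z - ?g z) < \<epsilon> / 2"
      using order_tendstoD(2)[OF lim(2) e2] by (auto simp: eventually_at_top_linorder)
    define R' where "R' = max R R0"
    have "sq_norm M2 (\<lambda>\<zeta>. truncation u R \<zeta> - ?g \<zeta>) =
      sq_norm M2 (\<lambda>\<zeta>. (truncation u R \<zeta> - truncation u R' \<zeta>) + (truncation u R' \<zeta> - ?g \<zeta>))" by simp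
    also have "\<dots> \<le> 2 * sq_norm M2 (\<lambda>\<zeta>. truncation u R \<zeta> - truncation u R' \<zeta>) + 2 * sq_norm M2 (\<lambda>\<zeta>. truncation u R' \<zeta> - ?g \<zeta>)"
      by (rule sq_norm_add_le) measurable
    also have "\<dots> \<le> 2 * tail u R + 2 * (\<epsilon> / 2)"
    proof -
      have "sq_norm M2 (\<lambda>\<zeta>. truncation u R' \<zeta> - ?g \<zeta>) \<le> \<epsilon> / 2"
        by (rule less_imp_le[OF R0]) (simp add: R'_def)
      then show ?thesis
        by (intro add_mono mult_left_mono sq_norm_truncation_diff[OF um fin]) (auto simp: R'_def)
    qed
    also have "2 * (\<epsilon> / 2) = \<epsilon>"
      by (simp add: ennreal_times_divide mult.commute[of 2 \<epsilon>] ennreal_mult_divide_eq)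
    finally show "sq_norm M2 (\<lambda>\<zeta>. truncation u R \<zeta> - ?g \<zeta>) \<le> 2 * tail u R + \<epsilon>" .
  qed
  then show "sq_norm M2 (\<lambda>\<zeta>. truncation u R \<zeta> - ?g \<zeta>) \<le> 2 * tail u R" .
  have le: "sq_norm M1 (\<lambda>z. indicator (B R) z * u z) \<le> 2 * sq_norm M2 ?g + 4 * tail u R" for R
  proof -
    have "sq_norm M1 (\<lambda>z. indicator (B R) z * u z) = sq_norm M2 (\<lambda>\<zeta>. ?g \<zeta> + (truncation u R \<zeta> - ?g \<zeta>))"
      by (simp add: sq_norm_truncation[OF um fin])
    also have "\<dots> \<le> 2 * sq_norm M2 ?g + 2 * sq_norm M2 (\<lambda>\<zeta>. truncation u R \<zeta> - ?g \<zeta>)"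
      by (rule sq_norm_add_le) measurable
    also have "\<dots> \<le> 2 * sq_norm M2 ?g + 2 * (2 * tail u R)"
      by (intro add_left_mono mult_left_mono close) auto
    finally show ?thesis by (simp add: mult.assoc[symmetric])
  qed
  show "sq_norm M1 u \<le> 2 * sq_norm M2 ?g"
  proof (rule ennreal_le_epsilon')
    fix \<epsilon> :: ennreal assume "0 < \<epsilon>"
    \<comment> \<open>Fifths: four copies of the tail come from \<open>le\<close> and one from
      splitting \<open>u\<close>.\<close>
    then have e5: "0 < \<epsilon> / 5" by (simp add: ennreal_zero_less_divide)
    obtain n where n: "tail u (real n) < \<epsilon> / 5"
      using order_tendstoD(2)[OF tail_tendsto_0[OF um fin] e5] by (auto simp: eventually_sequentially)
    have "sq_norm M1 u = sq_norm M1 (\<lambda>z. indicator (B (real n)) z * u z) + tail u (real n)"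
      unfolding sq_norm_def tail_def
      by (subst nn_integral_add[symmetric]) (auto intro!: nn_integral_cong simp: indicator_def)
    also have "\<dots> \<le> (2 * sq_norm M2 ?g + 4 * tail u (real n)) + tail u (real n)"
      by (intro add_right_mono le)
    also have "\<dots> = 2 * sq_norm M2 ?g + (4 + 1) * tail u (real n)"
      unfolding distrib_right by (simp add: add.assoc)
    also have "\<dots> \<le> 2 * sq_norm M2 ?g + 5 * (\<epsilon> / 5)"
      using n by (intro add_left_mono mult_mono) auto
    also have "5 * (\<epsilon> / 5) = \<epsilon>"
      by (simp add: ennreal_times_divide mult.commute[of 5 \<epsilon>] ennreal_mult_divide_eq)
    finally show "sq_norm M1 u \<le> 2 * sq_norm M2 ?g + \<epsilon>" .
  qed
qed

end

text \<open>Young's inequality with weight \<open>s\<close>. The factor in front of the main term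
  tends to 1 as \<open>s\<close> tends to 0, which is what continuity of the norm needs and a fixed
  factor 2 cannot give.\<close>

lemma cmod_squared_le_weighted:
  assumes "s > 0"
  shows "(cmod a)\<^sup>2 \<le> (1 + s) * (cmod b)\<^sup>2 + (1 + 1 / s) * (cmod (a - b))\<^sup>2"
proof -
  have "(cmod a)\<^sup>2 \<le> (cmod b + cmod (a - b))\<^sup>2"
    using norm_triangle_ineq[of b "a - b"] by (intro power_mono) auto
  also have "\<dots> = (cmod b)\<^sup>2 + (cmod (a - b))\<^sup>2 + 2 * cmod b * cmod (a - b)"
    by (simp add: power2_sum)
  also have "2 * cmod b * cmod (a - b) \<le> s * (cmod b)\<^sup>2 + (cmod (a - b))\<^sup>2 / s"
  proof -
    have "0 \<le> (s * cmod b - cmod (a - b))\<^sup>2 / s" using assms by simp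
    also have "\<dots> = s * (cmod b)\<^sup>2 + (cmod (a - b))\<^sup>2 / s - 2 * cmod b * cmod (a - b)"
      using assms by (simp add: power2_eq_square field_simps)
    finally show ?thesis by simp
  qed
  finally show ?thesis by (simp add: algebra_simps)
qed

lemma sq_norm_weighted:
  assumes [measurable]: "f \<in> borel_measurable M" "g \<in> borel_measurable M" and s: "s > 0"
  shows "sq_norm M f \<le> ennreal (1 + s) * sq_norm M g + ennreal (1 + 1 / s) * sq_norm M (\<lambda>z. f z - g z)"
proof -
  have "sq_norm M f \<le> (\<integral>\<^sup>+z. ennreal (1 + s) * esq (g z) + ennreal (1 + 1 / s) * esq (f z - g z) \<partial>M)"
    unfolding sq_norm_def
  proof (rule nn_integral_mono)
    fix z
    have "esq (f z) \<le> ennreal ((1 + s) * (cmod (g z))\<^sup>2 + (1 + 1 / s) * (cmod (f z - g z))\<^sup>2)"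
      by (intro ennreal_leI cmod_squared_le_weighted s)
    then show "esq (f z) \<le> ennreal (1 + s) * esq (g z) + ennreal (1 + 1 / s) * esq (f z - g z)"
      using s by (simp add: ennreal_plus ennreal_mult)
  qed
  also have "\<dots> = ennreal (1 + s) * sq_norm M g + ennreal (1 + 1 / s) * sq_norm M (\<lambda>z. f z - g z)"
    unfolding sq_norm_def by (simp add: nn_integral_add nn_integral_cmult)
  finally show ?thesis .
qed

text \<open>Continuity of the squared norm. It will exhibit the observed energy as a pointwise limit
  of measurable functions of time.\<close>

lemma sq_norm_tendsto:
  fixes f :: "nat \<Rightarrow> 'a \<Rightarrow> complex"
  assumes fm: "\<And>n. f n \<in> borel_measurable M" and gm: "g \<in> borel_measurable M"
    and finf: "\<And>n. sq_norm M (f n) < \<infinity>" and fing: "sq_norm M g < \<infinity>"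
    and lim: "(\<lambda>n. sq_norm M (\<lambda>z. f n z - g z)) \<longlonglongrightarrow> 0"
  shows "(\<lambda>n. enn2real (sq_norm M (f n))) \<longlonglongrightarrow> enn2real (sq_norm M g)"
proof -
  define a where "a n = enn2real (sq_norm M (f n))" for n
  define b where "b = enn2real (sq_norm M g)"
  define e where "e n = enn2real (sq_norm M (\<lambda>z. f n z - g z))" for n
  have fd: "sq_norm M (\<lambda>z. f n z - g z) < \<infinity>" for n
    using le_less_trans[OF sq_norm_diff_le[OF fm gm]] finf fing by (simp add: ennreal_mult_less_top)
  have A: "sq_norm M (f n) = ennreal (a n)" and Bg: "sq_norm M g = ennreal b"
    and E: "sq_norm M (\<lambda>z. f n z - g z) = ennreal (e n)" "sq_norm M (\<lambda>z. g z - f n z) = ennreal (e n)" for n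
    using finf[of n] fing fd[of n] sq_norm_minus[of M g "f n"] by (auto simp: a_def b_def e_def)
  have nn: "a n \<ge> 0" "b \<ge> 0" "e n \<ge> 0" for n by (auto simp: a_def b_def e_def)
  have e0: "e \<longlonglongrightarrow> 0"
    using lim unfolding E by (subst (asm) ennreal_0[symmetric], subst (asm) tendsto_ennreal_iff) (auto simp: nn)
  \<comment> \<open>a positive weight for which both \<open>s n\<close> and \<open>e n / s n\<close> tend to \<open>0\<close>\<close>
  define s where "s n = sqrt (e n) + 1 / real (Suc n)" for n
  have s: "s n > 0" for n using nn by (simp add: s_def add_nonneg_pos)
  have es: "(1 + 1 / s n) * e n \<le> e n + sqrt (e n)" for n
  proof -
    have "e n = sqrt (e n) * sqrt (e n)" using nn by simp
    also have "\<dots> \<le> sqrt (e n) * s n" using nn by (intro mult_left_mono) (auto simp: s_def)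
    finally have "e n / s n \<le> sqrt (e n)" using s[of n] by (simp add: divide_le_eq)
    then show ?thesis by (simp add: distrib_right)
  qed
  have up: "a n \<le> (1 + s n) * b + (e n + sqrt (e n))" for n
  proof -
    have "ennreal (a n) \<le> ennreal ((1 + s n) * b + (1 + 1 / s n) * e n)"
      using sq_norm_weighted[OF fm gm s[of n], of n] s[of n] nn unfolding A Bg E
      by (simp add: ennreal_plus ennreal_mult)
    then have "a n \<le> (1 + s n) * b + (1 + 1 / s n) * e n"
      using s[of n] nn by (subst (asm) ennreal_le_iff) auto
    then show ?thesis using es[of n] by linarith
  qed
  have lo: "(b - (e n + sqrt (e n))) / (1 + s n) \<le> a n" for n
  proof -
    have "ennreal b \<le> ennreal ((1 + s n) * a n + (1 + 1 / s n) * e n)"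
      using sq_norm_weighted[OF gm fm s[of n], of n] s[of n] nn unfolding A Bg E
      by (simp add: ennreal_plus ennreal_mult)
    then have "b \<le> (1 + s n) * a n + (1 + 1 / s n) * e n"
      using s[of n] nn by (subst (asm) ennreal_le_iff) auto
    then have "b - (e n + sqrt (e n)) \<le> a n * (1 + s n)" using es[of n] by (simp add: mult.commute)
    then show ?thesis using s[of n] by (simp add: pos_divide_le_eq)
  qed
  have sq0: "(\<lambda>n. sqrt (e n)) \<longlonglongrightarrow> 0" using tendsto_real_sqrt[OF e0] by simp
  have s0: "s \<longlonglongrightarrow> 0"
    unfolding s_def using tendsto_add[OF sq0 LIMSEQ_Suc[OF lim_1_over_n]] by simp
  have "(\<lambda>n. (1 + s n) * b + (e n + sqrt (e n))) \<longlonglongrightarrow> (1 + 0) * b + (0 + 0)"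
    by (intro tendsto_intros s0 e0 sq0)
  moreover have "(\<lambda>n. (b - (e n + sqrt (e n))) / (1 + s n)) \<longlonglongrightarrow> (b - (0 + 0)) / (1 + 0)"
    by (intro tendsto_intros s0 e0 sq0) auto
  ultimately have "a \<longlonglongrightarrow> b"
    by (intro tendsto_sandwich[of "\<lambda>n. (b - (e n + sqrt (e n))) / (1 + s n)" a sequentially "\<lambda>n. (1 + s n) * b + (e n + sqrt (e n))"])
      (auto intro!: always_eventually up lo)
  then show ?thesis by (simp only: a_def[abs_def] b_def)
qed

section \<open>The Fourier transform on the cylinder\<close>

lemma torus_cell_eq: "torus_cell = (prod_cell {0..<2 * pi} :: (real ^ 'm) set)"
  by (auto simp: torus_cell_def prod_cell_def Basis_vec_def inner_axis)

lemma inj_int_vec: "inj (int_vec :: int ^ 'm \<Rightarrow> real ^ 'm)"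
  by (auto simp: inj_def int_vec_def vec_eq_iff)

lemma range_int_vec: "range int_vec = (int_lattice :: (real ^ 'm) set)"
proof (intro equalityI subsetI)
  fix x :: "real ^ 'm" assume "x \<in> int_lattice"
  then have "x $ i \<in> \<int>" for i by (auto simp: int_lattice_def Basis_vec_def inner_axis)
  then have "x = int_vec (\<chi> i. \<lfloor>x $ i\<rfloor>)" by (auto simp: int_vec_def vec_eq_iff elim: Ints_cases)
  then show "x \<in> range int_vec" by blast
qed (auto simp: int_lattice_def Basis_vec_def inner_axis int_vec_def)

lemma int_vec_in_lattice: "int_vec (k :: int ^ 'm) \<in> int_lattice"
  using range_int_vec by blast

lemma bij_int_vec: "bij_betw int_vec UNIV (int_lattice :: (real ^ 'm) set)"
  using inj_int_vec range_int_vec by (auto simp: bij_betw_def)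

lemma countable_UNIV_int_vec: "countable (UNIV :: (int ^ 'm) set)"
  using countable_image_inj_on[of int_vec "UNIV :: (int ^ 'm) set"] countable_int_lattice inj_int_vec
  by (simp add: range_int_vec)

lemma finite_int_vec_le: "finite {k :: int ^ 'm. norm (int_vec k) \<le> R}"
proof -
  have "int_vec ` {k :: int ^ 'm. norm (int_vec k) \<le> R} \<subseteq> {k \<in> int_lattice. norm k \<le> R}"
    using int_vec_in_lattice by auto
  then have "finite (int_vec ` {k :: int ^ 'm. norm (int_vec k) \<le> R})"
    using finite_int_lattice_bounded finite_subset by blast
  then show ?thesis by (rule finite_imageD) (rule inj_on_subset[OF inj_int_vec], auto)
qed

lemma sets_torus_cell [measurable]: "torus_cell \<in> sets borel"
  unfolding torus_cell_eq by measurable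

lemma emeasure_torus_cell_finite: "emeasure lborel (torus_cell :: (real ^ 'm) set) < \<infinity>"
  unfolding torus_cell_eq by (rule emeasure_prod_cell_finite[OF bounded_half_open])

section \<open>Measures on the cylinder and on its frequency space\<close>

interpretation cell: sigma_finite_measure "restrict_space lborel (torus_cell :: (real ^ 'm) set)"
  by (rule sigma_finite_measure_restrict_space) (auto intro: sigma_finite_lborel)

interpretation cyl: pair_sigma_finite "lborel :: (real ^ 'n) measure" "restrict_space lborel (torus_cell :: (real ^ 'm) set)" ..

interpretation freq_count: sigma_finite_measure "count_space (UNIV :: (int ^ 'm) set)"
  by (rule sigma_finite_measure_count_space_countable[OF countable_UNIV_int_vec])

interpretation freq: pair_sigma_finite "lborel :: (real ^ 'n) measure" "count_space (UNIV :: (int ^ 'm) set)" ..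

lemma space_cyl: "space (cyl_measure :: ((real ^ 'n) \<times> (real ^ 'm)) measure) = UNIV \<times> torus_cell"
  by (auto simp: cyl_measure_def space_pair_measure space_restrict_space)

lemma space_freq: "space (freq_measure :: ((real ^ 'n) \<times> (int ^ 'm)) measure) = UNIV"
  by (simp add: freq_measure_def space_pair_measure)

lemma measurable_fst_cyl [measurable]: "fst \<in> borel_measurable (cyl_measure :: ((real ^ 'n) \<times> (real ^ 'm)) measure)"
  unfolding cyl_measure_def by measurable

lemma measurable_snd_cyl [measurable]: "snd \<in> borel_measurable (cyl_measure :: ((real ^ 'n) \<times> (real ^ 'm)) measure)"
  unfolding cyl_measure_def
  by (rule measurable_compose[OF measurable_snd]) (auto intro: measurable_restrict_space1)

lemma measurable_freq_vec [measurable]: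
  "freq_vec \<in> borel_measurable (freq_measure :: ((real ^ 'n) \<times> (int ^ 'm)) measure)"
  unfolding freq_vec_def[abs_def] freq_measure_def
  by (intro borel_measurable_Pair measurable_compose[OF measurable_snd]) auto

lemma measurable_ident_cyl: "(\<lambda>z. z) \<in> borel_measurable (cyl_measure :: ((real ^ 'n) \<times> (real ^ 'm)) measure)"
  using borel_measurable_Pair[OF measurable_fst_cyl measurable_snd_cyl] by simp

lemma nn_integral_cyl:
  fixes f :: "(real ^ 'n) \<times> (real ^ 'm) \<Rightarrow> ennreal"
  assumes "f \<in> borel_measurable cyl_measure"
  shows "(\<integral>\<^sup>+z. f z \<partial>cyl_measure) = (\<integral>\<^sup>+x. (\<integral>\<^sup>+y\<in>torus_cell. f (x, y) \<partial>lborel) \<partial>lborel)"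
  using cell.nn_integral_fst[of f lborel] assms
  by (simp add: cyl_measure_def nn_integral_restrict_space)

lemma nn_integral_freq:
  fixes f :: "(real ^ 'n) \<times> (int ^ 'm) \<Rightarrow> ennreal"
  assumes "f \<in> borel_measurable freq_measure"
  shows "(\<integral>\<^sup>+\<zeta>. f \<zeta> \<partial>freq_measure) = (\<integral>\<^sup>+k. (\<integral>\<^sup>+\<xi>. f (\<xi>, k) \<partial>lborel) \<partial>count_space UNIV)"
  using freq.nn_integral_snd[of f] assms by (simp add: freq_measure_def)

lemma sigma_finite_cyl: "sigma_finite_measure (cyl_measure :: ((real ^ 'n) \<times> (real ^ 'm)) measure)"
  unfolding cyl_measure_def by (rule cyl.sigma_finite_measure_axioms)

lemma sigma_finite_freq: "sigma_finite_measure (freq_measure :: ((real ^ 'n) \<times> (int ^ 'm)) measure)"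
  unfolding freq_measure_def by (rule freq.sigma_finite_measure_axioms)

lemma measurable_indicator_cyl:
  assumes [measurable]: "A \<in> sets borel" "B \<in> sets borel"
  shows "(indicator (A \<times> B) :: (real ^ 'n) \<times> (real ^ 'm) \<Rightarrow> ennreal) \<in> borel_measurable cyl_measure"
proof -
  have "(\<lambda>z. indicator A (fst z) * indicator B (snd z) :: ennreal) \<in> borel_measurable (cyl_measure :: ((real ^ 'n) \<times> (real ^ 'm)) measure)"
    by measurable
  also have "(\<lambda>z. indicator A (fst z) * indicator B (snd z) :: ennreal) = indicator (A \<times> B)"
    by (auto simp: indicator_def)
  finally show ?thesis .
qed

text \<open>Intersected with the space, whose second factor is \<open>torus_cell\<close>; otherwise
  the set would not belong to the sigma algebra. Only the noncompact factor needs
  truncation.\<close>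

definition cyl_ball :: "real \<Rightarrow> ((real ^ 'n) \<times> (real ^ 'm)) set" where
  "cyl_ball R = {z \<in> space cyl_measure. norm (fst z) \<le> R}"

definition freq_ball :: "real \<Rightarrow> ((real ^ 'n) \<times> (int ^ 'm)) set" where
  "freq_ball R = {\<zeta>. norm (freq_vec \<zeta>) \<le> R}"

lemma sets_cyl_ball [measurable]: "cyl_ball R \<in> sets cyl_measure"
  unfolding cyl_ball_def by measurable

lemma sets_freq_ball [measurable]: "freq_ball R \<in> sets freq_measure"
proof -
  have "{\<zeta> \<in> space (freq_measure :: ((real ^ 'n) \<times> (int ^ 'm)) measure). norm (freq_vec \<zeta>) \<le> R} \<in> sets freq_measure" by measurable
  then show ?thesis by (simp add: freq_ball_def space_freq)
qed

lemma emeasure_cyl_ball: "emeasure cyl_measure (cyl_ball R :: ((real ^ 'n) \<times> (real ^ 'm)) set) < \<infinity>"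
proof -
  have "cyl_ball R = (cball 0 R :: (real ^ 'n) set) \<times> (torus_cell :: (real ^ 'm) set)" by (auto simp: cyl_ball_def space_cyl)
  moreover have "emeasure (restrict_space lborel torus_cell) (torus_cell :: (real ^ 'm) set) = emeasure lborel (torus_cell :: (real ^ 'm) set)"
    by (simp add: emeasure_restrict_space)
  moreover have "torus_cell \<in> sets (restrict_space lborel (torus_cell :: (real ^ 'm) set))"
    by (simp add: sets_restrict_space_iff)
  ultimately have "emeasure cyl_measure (cyl_ball R :: ((real ^ 'n) \<times> (real ^ 'm)) set) =
    emeasure lborel (cball 0 R :: (real ^ 'n) set) * emeasure lborel (torus_cell :: (real ^ 'm) set)"
    unfolding cyl_measure_def by (simp add: cell.emeasure_pair_measure_Times)
  then show ?thesis
    using emeasure_torus_cell_finite[where 'm = 'm] emeasure_bounded_finite[OF bounded_cball, of "0 :: real ^ 'n" R]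
    by (simp add: ennreal_mult_less_top)
qed

lemma emeasure_freq_ball: "emeasure freq_measure (freq_ball R :: ((real ^ 'n) \<times> (int ^ 'm)) set) < \<infinity>"
proof -
  let ?K = "{k :: int ^ 'm. norm (int_vec k) \<le> R}"
  have "norm (fst \<zeta>) \<le> R \<and> norm (int_vec (snd \<zeta>)) \<le> R" if "\<zeta> \<in> freq_ball R" for \<zeta> :: "(real ^ 'n) \<times> (int ^ 'm)"
    using that norm_fst_le[of "fst \<zeta>" "int_vec (snd \<zeta>)"] norm_snd_le[of "int_vec (snd \<zeta>)" "fst \<zeta>"]
    by (auto simp: freq_ball_def freq_vec_def)
  then have "(freq_ball R :: ((real ^ 'n) \<times> (int ^ 'm)) set) \<subseteq> cball 0 R \<times> ?K"
    by (force simp: subset_iff)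
  then have "emeasure freq_measure (freq_ball R :: ((real ^ 'n) \<times> (int ^ 'm)) set) \<le> emeasure freq_measure ((cball 0 R :: (real ^ 'n) set) \<times> ?K)"
    by (rule emeasure_mono) (simp add: freq_measure_def)
  also have "\<dots> = emeasure lborel (cball 0 R :: (real ^ 'n) set) * emeasure (count_space UNIV) ?K"
    unfolding freq_measure_def by (rule freq_count.emeasure_pair_measure_Times) auto
  also have "emeasure (count_space UNIV) ?K = of_nat (card ?K)"
    by (rule emeasure_count_space_finite) (auto intro: finite_int_vec_le)
  also have "emeasure lborel (cball 0 R :: (real ^ 'n) set) * of_nat (card ?K) < \<infinity>"
    using emeasure_bounded_finite[OF bounded_cball, of "0 :: real ^ 'n" R]
    by (simp add: ennreal_mult_less_top of_nat_less_top)
  finally show ?thesis .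
qed

section \<open>Fourier integrals of functions with bounded support\<close>

definition unitary_factor :: "nat \<Rightarrow> real" where
  "unitary_factor d = (1 / sqrt (2 * pi)) ^ d"

lemma unitary_factor_squared: "(unitary_factor d)\<^sup>2 * (2 * pi) ^ d = 1"
proof -
  have "(unitary_factor d)\<^sup>2 * (2 * pi) ^ d = ((1 / sqrt (2 * pi)) * (1 / sqrt (2 * pi)) * (2 * pi)) ^ d"
    unfolding unitary_factor_def power2_eq_square power_mult_distrib by (rule refl)
  also have "(1 / sqrt (2 * pi)) * (1 / sqrt (2 * pi)) * (2 * pi) = 1"
    by (simp add: real_sqrt_mult_self)
  finally show ?thesis by simp
qed

definition fourier_integral ::
    "((real ^ 'n) \<times> (real ^ 'm) \<Rightarrow> complex) \<Rightarrow> (real ^ 'n) \<times> (int ^ 'm) \<Rightarrow> complex" where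
  "fourier_integral w \<zeta> = of_real (unitary_factor (CARD('n) + CARD('m))) *
     (LINT z|cyl_measure. cis (- (z \<bullet> freq_vec \<zeta>)) * w z)"

definition inv_fourier_integral ::
    "((real ^ 'n) \<times> (int ^ 'm) \<Rightarrow> complex) \<Rightarrow> (real ^ 'n) \<times> (real ^ 'm) \<Rightarrow> complex" where
  "inv_fourier_integral g z = of_real (unitary_factor (CARD('n) + CARD('m))) *
     (LINT \<zeta>|freq_measure. cis (z \<bullet> freq_vec \<zeta>) * g \<zeta>)"

lemma measurable_fourier_integral:
  fixes w :: "(real ^ 'n) \<times> (real ^ 'm) \<Rightarrow> complex"
  assumes [measurable]: "w \<in> borel_measurable cyl_measure"
  shows "fourier_integral w \<in> borel_measurable freq_measure"
proof -
  interpret sigma_finite_measure "cyl_measure :: ((real ^ 'n) \<times> (real ^ 'm)) measure" by (rule sigma_finite_cyl)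
  show ?thesis
    unfolding fourier_integral_def[abs_def]
  proof (intro borel_measurable_times borel_measurable_const borel_measurable_lebesgue_integral)
    have "(\<lambda>p. cis (- (snd p \<bullet> freq_vec (fst p))) * w (snd p)) \<in>
      borel_measurable (freq_measure \<Otimes>\<^sub>M (cyl_measure :: ((real ^ 'n) \<times> (real ^ 'm)) measure))"
      by (intro borel_measurable_times borel_measurable_cis borel_measurable_uminus borel_measurable_inner
        measurable_compose[OF measurable_fst measurable_freq_vec] measurable_compose[OF measurable_snd measurable_ident_cyl]
        measurable_compose[OF measurable_snd assms])
    then show "(\<lambda>(\<zeta>, z). cis (- (z \<bullet> freq_vec \<zeta>)) * w z) \<in>
      borel_measurable (freq_measure \<Otimes>\<^sub>M (cyl_measure :: ((real ^ 'n) \<times> (real ^ 'm)) measure))"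
      by (simp add: split_beta')
  qed
qed

lemma measurable_inv_fourier_integral:
  fixes g :: "(real ^ 'n) \<times> (int ^ 'm) \<Rightarrow> complex"
  assumes [measurable]: "g \<in> borel_measurable freq_measure"
  shows "inv_fourier_integral g \<in> borel_measurable cyl_measure"
proof -
  interpret sigma_finite_measure "freq_measure :: ((real ^ 'n) \<times> (int ^ 'm)) measure" by (rule sigma_finite_freq)
  show ?thesis
    unfolding inv_fourier_integral_def[abs_def]
  proof (intro borel_measurable_times borel_measurable_const borel_measurable_lebesgue_integral)
    have "(\<lambda>p. cis (fst p \<bullet> freq_vec (snd p)) * g (snd p)) \<in>
      borel_measurable (cyl_measure \<Otimes>\<^sub>M (freq_measure :: ((real ^ 'n) \<times> (int ^ 'm)) measure))"
      by (intro borel_measurable_times borel_measurable_cis borel_measurable_inner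
        measurable_compose[OF measurable_snd measurable_freq_vec] measurable_compose[OF measurable_fst measurable_ident_cyl]
        measurable_compose[OF measurable_snd assms])
    then show "(\<lambda>(z, \<zeta>). cis (z \<bullet> freq_vec \<zeta>) * g \<zeta>) \<in>
      borel_measurable (cyl_measure \<Otimes>\<^sub>M (freq_measure :: ((real ^ 'n) \<times> (int ^ 'm)) measure))"
      by (simp add: split_beta')
  qed
qed

lemma measurable_cis_cyl: "(\<lambda>z. cis (- (z \<bullet> v))) \<in> borel_measurable (cyl_measure :: ((real ^ 'n) \<times> (real ^ 'm)) measure)"
  unfolding inner_prod_def by measurable

lemma measurable_cis_freq: "(\<lambda>\<zeta>. cis (z \<bullet> freq_vec \<zeta>)) \<in> borel_measurable (freq_measure :: ((real ^ 'n) \<times> (int ^ 'm)) measure)"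
  by measurable

lemma integrable_cyl:
  fixes w :: "(real ^ 'n) \<times> (real ^ 'm) \<Rightarrow> complex"
  assumes "w \<in> borel_measurable cyl_measure" "sq_norm cyl_measure w < \<infinity>" "\<And>z. z \<notin> cyl_ball R \<Longrightarrow> w z = 0"
  shows "integrable cyl_measure (\<lambda>z. cis (- (z \<bullet> v)) * w z)"
  by (rule integrable_mult_finite_support[OF assms(1) measurable_cis_cyl sets_cyl_ball assms(2) emeasure_cyl_ball])
    (use assms(3) in auto)

lemma integrable_freq:
  fixes g :: "(real ^ 'n) \<times> (int ^ 'm) \<Rightarrow> complex"
  assumes "g \<in> borel_measurable freq_measure" "sq_norm freq_measure g < \<infinity>" "\<And>\<zeta>. \<zeta> \<notin> freq_ball R \<Longrightarrow> g \<zeta> = 0"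
  shows "integrable freq_measure (\<lambda>\<zeta>. cis (z \<bullet> freq_vec \<zeta>) * g \<zeta>)"
  by (rule integrable_mult_finite_support[OF assms(1) measurable_cis_freq sets_freq_ball assms(2) emeasure_freq_ball])
    (use assms(3) in auto)

text \<open>The order of quantifiers matters: \<open>J\<close> depends on \<open>R\<close> alone, so
  that one \<open>J\<close> serves all slices and all times later on. If
  \<open>R + r < norm j\<close>, then \<theta> of norm at most \<open>r\<close> cannot bring
  \<open>\<theta> + j\<close> back into the ball of radius \<open>R\<close>.\<close>

lemma cell_supported_bounded_support:
  "\<exists>J. \<forall>h :: 'e::euclidean_space \<Rightarrow> complex. h \<in> borel_measurable borel \<longrightarrow> (\<forall>\<xi>. R < norm \<xi> \<longrightarrow> h \<xi> = 0) \<longrightarrow> cell_supported h J"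
proof -
  obtain r where r: "\<And>\<theta>::'e. \<theta> \<in> unit_cell \<Longrightarrow> norm \<theta> \<le> r"
    using bounded_prod_cell[OF bounded_half_open[of 0 1], where 'e = 'e] by (auto simp: bounded_iff)
  have "cell_supported h {j \<in> int_lattice. norm j \<le> R + r}"
    if h: "h \<in> borel_measurable borel" and supp: "\<And>\<xi>. R < norm \<xi> \<Longrightarrow> h \<xi> = 0" for h :: "'e \<Rightarrow> complex"
  proof
    fix \<theta> j :: 'e assume "\<theta> \<in> unit_cell" and j: "j \<in> int_lattice" "j \<notin> {j \<in> int_lattice. norm j \<le> R + r}"
    then have "norm \<theta> \<le> r" "R + r < norm j" using r by auto
    moreover have "norm j \<le> norm (\<theta> + j) + norm \<theta>" using norm_triangle_ineq4[of "\<theta> + j" \<theta>] by simp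
    ultimately show "h (\<theta> + j) = 0" by (intro supp) simp
  qed (use h finite_int_lattice_bounded in auto)
  then show ?thesis by blast
qed

text \<open>The version with the opposite sign is the first one applied to the complex conjugate of
  \<open>h\<close>.\<close>

lemma plancherel_bounded:
  fixes h :: "'e::euclidean_space \<Rightarrow> complex"
  assumes h: "h \<in> borel_measurable borel" and supp: "\<And>\<xi>. R < norm \<xi> \<Longrightarrow> h \<xi> = 0"
    and fin: "(\<integral>\<^sup>+\<xi>. esq (h \<xi>) \<partial>lborel) < \<infinity>"
  shows "(\<integral>\<^sup>+x. esq (LINT \<xi>|lborel. cis (x \<bullet> \<xi>) * h \<xi>) \<partial>lborel) =
      ennreal ((2 * pi) ^ DIM('e)) * (\<integral>\<^sup>+\<xi>. esq (h \<xi>) \<partial>lborel)" (is "?plus h")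
    and "(\<integral>\<^sup>+x. esq (LINT \<xi>|lborel. cis (- (x \<bullet> \<xi>)) * h \<xi>) \<partial>lborel) =
      ennreal ((2 * pi) ^ DIM('e)) * (\<integral>\<^sup>+\<xi>. esq (h \<xi>) \<partial>lborel)" (is ?minus)
proof -
  have *: "?plus h" if hm: "h \<in> borel_measurable borel" and hs: "\<And>\<xi>. R < norm \<xi> \<Longrightarrow> h \<xi> = 0"
    and hf: "(\<integral>\<^sup>+\<xi>. esq (h \<xi>) \<partial>lborel) < \<infinity>" for h :: "'e \<Rightarrow> complex"
  proof -
    obtain J where "cell_supported h J" using cell_supported_bounded_support[of R, where 'e = 'e] hm hs by blast
    then show ?thesis using cell_supported.plancherel hf by blast
  qed
  show "?plus h" by (rule *) (use assms in auto)
  have "cmod (LINT \<xi>|lborel. cis (- (x \<bullet> \<xi>)) * h \<xi>) = cmod (LINT \<xi>|lborel. cis (x \<bullet> \<xi>) * cnj (h \<xi>))" for x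
  proof -
    have "(LINT \<xi>|lborel. cis (- (x \<bullet> \<xi>)) * h \<xi>) = (LINT \<xi>|lborel. cnj (cis (x \<bullet> \<xi>) * cnj (h \<xi>)))"
      by (simp add: cis_cnj)
    also have "\<dots> = cnj (LINT \<xi>|lborel. cis (x \<bullet> \<xi>) * cnj (h \<xi>))" by (rule Bochner_Integration.integral_cnj)
    finally show ?thesis by simp
  qed
  moreover have "(\<lambda>\<xi>. cnj (h \<xi>)) \<in> borel_measurable borel"
    using h by (rule borel_measurable_continuous_on[rotated]) (intro continuous_intros)
  ultimately show ?minus using *[of "\<lambda>\<xi>. cnj (h \<xi>)"] assms by simp
qed

lemma parseval_torus_cell:
  fixes v :: "real ^ 'm \<Rightarrow> complex"
  assumes v: "v \<in> borel_measurable (restrict_space lborel torus_cell)"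
    and fin: "(\<integral>\<^sup>+y\<in>torus_cell. esq (v y) \<partial>lborel) < \<infinity>"
  shows "(\<integral>\<^sup>+k. esq (LINT y:torus_cell|lborel. cis (- (y \<bullet> int_vec k)) * v y) \<partial>count_space UNIV)
    = ennreal ((2 * pi) ^ CARD('m)) * (\<integral>\<^sup>+y\<in>torus_cell. esq (v y) \<partial>lborel)"
proof -
  \<comment> \<open>Extension by zero produces a Borel function on the whole space without changing
    any integral over the cell.\<close>
  define v' where "v' y = indicator torus_cell y *\<^sub>R v y" for y
  have v': "v' \<in> borel_measurable borel"
    using v unfolding v'_def[abs_def] by (subst (asm) borel_measurable_restrict_space_iff) auto
  have sq: "(\<integral>\<^sup>+y\<in>torus_cell. esq (v' y) \<partial>lborel) = (\<integral>\<^sup>+y\<in>torus_cell. esq (v y) \<partial>lborel)"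
    by (intro nn_integral_cong) (auto simp: v'_def indicator_def)
  have coef: "(LINT y:torus_cell|lborel. cis (- (y \<bullet> k)) * v' y) = (LINT y:torus_cell|lborel. cis (- (y \<bullet> k)) * v y)" for k
    unfolding set_lebesgue_integral_def by (intro Bochner_Integration.integral_cong) (auto simp: v'_def indicator_def)
  have "(\<integral>\<^sup>+k. esq (LINT y:torus_cell|lborel. cis (- (y \<bullet> int_vec k)) * v' y) \<partial>count_space UNIV)
    = ennreal ((2 * pi) ^ CARD('m)) * (\<integral>\<^sup>+y\<in>torus_cell. esq (v' y) \<partial>lborel)"
    using parseval_torus[OF v'] fin
    unfolding sq[symmetric] torus_cell_eq[symmetric] by (simp add: nn_integral_bij_count_space[OF bij_int_vec, symmetric])
  then show ?thesis by (simp only: sq coef)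
qed

text \<open>Fourier coefficients in \<open>y\<close> first, with Parseval for almost every
  \<open>x\<close>; then Plancherel in \<open>x\<close> for each \<open>k\<close>. The truncation in
  \<open>x\<close> supplies the bounded support that the Plancherel step needs.\<close>

theorem sq_norm_fourier_integral:
  fixes w :: "(real ^ 'n) \<times> (real ^ 'm) \<Rightarrow> complex"
  assumes w [measurable]: "w \<in> borel_measurable cyl_measure" and fin: "sq_norm cyl_measure w < \<infinity>"
    and supp: "\<And>z. z \<notin> cyl_ball R \<Longrightarrow> w z = 0"
  shows "sq_norm freq_measure (fourier_integral w) = sq_norm cyl_measure w"
proof -
  let ?c = "unitary_factor (CARD('n) + CARD('m))"
  define a where "a k x = (LINT y:torus_cell|lborel. cis (- (y \<bullet> int_vec k)) * w (x, y))" for k x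
  have w2: "w \<in> borel_measurable (lborel \<Otimes>\<^sub>M restrict_space lborel torus_cell)" using w by (simp add: cyl_measure_def)
  have wx: "(\<lambda>y. w (x, y)) \<in> borel_measurable (restrict_space lborel torus_cell)" for x
    using measurable_Pair2[OF w2, of x] by simp
  have a_eq: "a k x = (LINT y|restrict_space lborel torus_cell. cis (- (y \<bullet> int_vec k)) * w (x, y))" for k x
    unfolding a_def by (subst integral_restrict_space) (auto simp: set_lebesgue_integral_def)
  have cism: "(\<lambda>z. cis (- (snd z \<bullet> int_vec k))) \<in> borel_measurable ((lborel :: (real ^ 'n) measure) \<Otimes>\<^sub>M restrict_space lborel torus_cell)" for k :: "int ^ 'm"
    by (intro borel_measurable_cis borel_measurable_uminus borel_measurable_inner borel_measurable_const
      measurable_snd_cyl[unfolded cyl_measure_def])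
  have am [measurable]: "a k \<in> borel_measurable borel" for k
  proof -
    have "(\<lambda>x. LINT y|restrict_space lborel torus_cell. cis (- (y \<bullet> int_vec k)) * w (x, y)) \<in> borel_measurable lborel"
      by (rule cell.borel_measurable_lebesgue_integral) (use borel_measurable_times[OF cism[of k] w2] in \<open>simp add: split_beta'\<close>)
    then show ?thesis by (simp add: a_eq[abs_def])
  qed
  have coef: "fourier_integral w (\<xi>, k) = of_real ?c * (LINT x|lborel. cis (- (\<xi> \<bullet> x)) * a k x)" for \<xi> k
  proof -
    have "(LINT z|cyl_measure. cis (- (z \<bullet> freq_vec (\<xi>, k))) * w z) =
      (LINT x|lborel. LINT y|restrict_space lborel torus_cell. cis (- ((x, y) \<bullet> freq_vec (\<xi>, k))) * w (x, y))"
      using cyl.integral_fst'[OF integrable_cyl[OF w fin supp, of R "freq_vec (\<xi>, k)", unfolded cyl_measure_def]]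
      by (simp add: cyl_measure_def)
    also have "\<dots> = (LINT x|lborel. cis (- (\<xi> \<bullet> x)) * a k x)"
    proof (rule Bochner_Integration.integral_cong[OF refl])
      fix x :: "real ^ 'n"
      have "cis (- ((x, y) \<bullet> freq_vec (\<xi>, k))) * w (x, y) = cis (- (\<xi> \<bullet> x)) * (cis (- (y \<bullet> int_vec k)) * w (x, y))" for y
        by (simp add: freq_vec_def inner_commute cis_mult mult.assoc[symmetric] add.commute)
      then show "(LINT y|restrict_space lborel torus_cell. cis (- ((x, y) \<bullet> freq_vec (\<xi>, k))) * w (x, y)) = cis (- (\<xi> \<bullet> x)) * a k x"
        by (simp only: a_eq Bochner_Integration.integral_mult_right_zero)
    qed
    finally show ?thesis by (simp add: fourier_integral_def)
  qed
  have sq_w: "sq_norm cyl_measure w = (\<integral>\<^sup>+x. (\<integral>\<^sup>+y\<in>torus_cell. esq (w (x, y)) \<partial>lborel) \<partial>lborel)"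
    unfolding sq_norm_def by (rule nn_integral_cyl) measurable
  have meas_in: "(\<lambda>x. \<integral>\<^sup>+y\<in>torus_cell. esq (w (x, y)) \<partial>lborel) \<in> borel_measurable lborel"
  proof -
    have "(\<lambda>x. \<integral>\<^sup>+y. esq (w (x, y)) \<partial>restrict_space lborel torus_cell) \<in> borel_measurable lborel"
      by (rule cell.borel_measurable_nn_integral) (use w2 in \<open>simp add: split_beta'\<close>)
    then show ?thesis by (simp add: nn_integral_restrict_space)
  qed
  \<comment> \<open>A slice of a square-integrable function is square-integrable only for almost
    every \<open>x\<close>.\<close>
  have "AE x in lborel. (\<integral>\<^sup>+y\<in>torus_cell. esq (w (x, y)) \<partial>lborel) \<noteq> \<infinity>"
    by (rule nn_integral_PInf_AE[OF meas_in]) (use fin in \<open>simp add: sq_w\<close>)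
  then have pars: "AE x in lborel. (\<integral>\<^sup>+k. esq (a k x) \<partial>count_space UNIV) =
      ennreal ((2 * pi) ^ CARD('m)) * (\<integral>\<^sup>+y\<in>torus_cell. esq (w (x, y)) \<partial>lborel)"
    unfolding a_def by eventually_elim (rule parseval_torus_cell[OF wx], simp add: less_top)
  have sum_a: "(\<integral>\<^sup>+k. (\<integral>\<^sup>+x. esq (a k x) \<partial>lborel) \<partial>count_space UNIV) =
      ennreal ((2 * pi) ^ CARD('m)) * sq_norm cyl_measure w"
  proof -
    have "(\<integral>\<^sup>+k. (\<integral>\<^sup>+x. esq (a k x) \<partial>lborel) \<partial>count_space UNIV) =
      (\<integral>\<^sup>+x. (\<integral>\<^sup>+k. esq (a k x) \<partial>count_space UNIV) \<partial>lborel)"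
      by (rule nn_integral_count_space_nn_integral[OF countable_UNIV_int_vec, symmetric]) measurable
    also have "\<dots> = (\<integral>\<^sup>+x. ennreal ((2 * pi) ^ CARD('m)) * (\<integral>\<^sup>+y\<in>torus_cell. esq (w (x, y)) \<partial>lborel) \<partial>lborel)"
      by (rule nn_integral_cong_AE[OF pars])
    also have "\<dots> = ennreal ((2 * pi) ^ CARD('m)) * sq_norm cyl_measure w"
      unfolding sq_w by (rule nn_integral_cmult[OF meas_in])
    finally show ?thesis .
  qed
  have fin_a: "(\<integral>\<^sup>+x. esq (a k x) \<partial>lborel) < \<infinity>" for k
  proof -
    have "(\<integral>\<^sup>+x. esq (a k x) \<partial>lborel) \<le> (\<integral>\<^sup>+k. (\<integral>\<^sup>+x. esq (a k x) \<partial>lborel) \<partial>count_space UNIV)"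
      by (rule nn_integral_ge_point) simp
    also have "\<dots> < \<infinity>" unfolding sum_a using fin by (simp add: ennreal_mult_less_top)
    finally show ?thesis .
  qed
  have supp_a: "a k x = 0" if "R < norm x" for k x
  proof -
    have "w (x, y) = 0" for y using supp[of "(x, y)"] that by (auto simp: cyl_ball_def)
    then show ?thesis by (simp add: a_def)
  qed
  have "sq_norm freq_measure (fourier_integral w) =
    (\<integral>\<^sup>+k. (\<integral>\<^sup>+\<xi>. esq (fourier_integral w (\<xi>, k)) \<partial>lborel) \<partial>count_space UNIV)"
    unfolding sq_norm_def by (rule nn_integral_freq) (use measurable_fourier_integral[OF w] in measurable)
  also have "\<dots> = (\<integral>\<^sup>+k. ennreal (?c\<^sup>2) * (ennreal ((2 * pi) ^ CARD('n)) * (\<integral>\<^sup>+x. esq (a k x) \<partial>lborel)) \<partial>count_space UNIV)"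
  proof (rule nn_integral_cong)
    fix k :: "int ^ 'm"
    have "(\<integral>\<^sup>+\<xi>. esq (fourier_integral w (\<xi>, k)) \<partial>lborel) =
      (\<integral>\<^sup>+\<xi>. ennreal (?c\<^sup>2) * esq (LINT x|lborel. cis (- (\<xi> \<bullet> x)) * a k x) \<partial>lborel)"
      by (simp add: coef norm_mult power_mult_distrib ennreal_mult)
    also have "\<dots> = ennreal (?c\<^sup>2) * (\<integral>\<^sup>+\<xi>. esq (LINT x|lborel. cis (- (\<xi> \<bullet> x)) * a k x) \<partial>lborel)"
      by (rule nn_integral_cmult) measurable
    also have "(\<integral>\<^sup>+\<xi>. esq (LINT x|lborel. cis (- (\<xi> \<bullet> x)) * a k x) \<partial>lborel) =
      ennreal ((2 * pi) ^ CARD('n)) * (\<integral>\<^sup>+x. esq (a k x) \<partial>lborel)"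
      using plancherel_bounded(2)[OF am[of k] supp_a fin_a] by simp
    finally show "(\<integral>\<^sup>+\<xi>. esq (fourier_integral w (\<xi>, k)) \<partial>lborel) =
      ennreal (?c\<^sup>2) * (ennreal ((2 * pi) ^ CARD('n)) * (\<integral>\<^sup>+x. esq (a k x) \<partial>lborel))" .
  qed
  also have "\<dots> = ennreal (?c\<^sup>2) * (ennreal ((2 * pi) ^ CARD('n)) * (ennreal ((2 * pi) ^ CARD('m)) * sq_norm cyl_measure w))"
    by (simp add: nn_integral_cmult sum_a)
  also have "\<dots> = ennreal (?c\<^sup>2 * (2 * pi) ^ (CARD('n) + CARD('m))) * sq_norm cyl_measure w"
    by (simp add: power_add ennreal_mult mult.assoc)
  finally show ?thesis by (simp only: unitary_factor_squared ennreal_1 mult_1)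
qed

text \<open>Bounded frequency support leaves finitely many \<open>k\<close>, so the integral over
  frequencies becomes one integral in \<xi> of a finite sum.\<close>

lemma inv_fourier_integral_eq:
  fixes g :: "(real ^ 'n) \<times> (int ^ 'm) \<Rightarrow> complex"
  assumes g [measurable]: "g \<in> borel_measurable freq_measure" and fin: "sq_norm freq_measure g < \<infinity>"
    and supp: "\<And>\<zeta>. \<zeta> \<notin> freq_ball R \<Longrightarrow> g \<zeta> = 0"
    and K: "K = {k :: int ^ 'm. norm (int_vec k) \<le> R}"
  shows "inv_fourier_integral g (x, y) = of_real (unitary_factor (CARD('n) + CARD('m))) *
      (LINT \<xi>|lborel. cis (x \<bullet> \<xi>) * (\<Sum>k\<in>K. cis (y \<bullet> int_vec k) * g (\<xi>, k)))"
proof -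
  have finK: "finite K" unfolding K by (rule finite_int_vec_le)
  have g0: "g (\<xi>, k) = 0" if "k \<notin> K" for \<xi> k
    using that norm_snd_le[of "int_vec k" \<xi>] unfolding K by (intro supp) (auto simp: freq_ball_def freq_vec_def)
  have "(LINT \<zeta>|freq_measure. cis ((x, y) \<bullet> freq_vec \<zeta>) * g \<zeta>) =
    (LINT \<xi>|lborel. LINT k|count_space UNIV. cis ((x, y) \<bullet> freq_vec (\<xi>, k)) * g (\<xi>, k))"
    using freq.integral_fst'[OF integrable_freq[OF g fin supp, of R "(x, y)", unfolded freq_measure_def]]
    by (simp add: freq_measure_def)
  also have "\<dots> = (LINT \<xi>|lborel. cis (x \<bullet> \<xi>) * (\<Sum>k\<in>K. cis (y \<bullet> int_vec k) * g (\<xi>, k)))"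
  proof (rule Bochner_Integration.integral_cong[OF refl])
    fix \<xi> :: "real ^ 'n"
    have "(LINT k|count_space UNIV. cis ((x, y) \<bullet> freq_vec (\<xi>, k)) * g (\<xi>, k)) =
      (\<Sum>k\<in>{k. cis ((x, y) \<bullet> freq_vec (\<xi>, k)) * g (\<xi>, k) \<noteq> 0}. cis ((x, y) \<bullet> freq_vec (\<xi>, k)) * g (\<xi>, k))"
      using g0 finK by (subst lebesgue_integral_count_space_finite_support)
        (auto intro: finite_subset[of _ K])
    also have "\<dots> = (\<Sum>k\<in>K. cis ((x, y) \<bullet> freq_vec (\<xi>, k)) * g (\<xi>, k))"
      using g0 finK by (intro sum.mono_neutral_left) auto
    also have "\<dots> = cis (x \<bullet> \<xi>) * (\<Sum>k\<in>K. cis (y \<bullet> int_vec k) * g (\<xi>, k))"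
      by (simp add: freq_vec_def cis_mult[symmetric] sum_distrib_left mult_ac)
    finally show "(LINT k|count_space UNIV. cis ((x, y) \<bullet> freq_vec (\<xi>, k)) * g (\<xi>, k)) =
      cis (x \<bullet> \<xi>) * (\<Sum>k\<in>K. cis (y \<bullet> int_vec k) * g (\<xi>, k))" .
  qed
  finally show ?thesis by (simp add: inv_fourier_integral_def)
qed

lemma freq_slice:
  fixes g :: "(real ^ 'n) \<times> (int ^ 'm) \<Rightarrow> complex"
  assumes g: "g \<in> borel_measurable freq_measure" and fin: "sq_norm freq_measure g < \<infinity>"
    and supp: "\<And>\<zeta>. \<zeta> \<notin> freq_ball R \<Longrightarrow> g \<zeta> = 0"
  shows "(\<lambda>\<xi>. g (\<xi>, k)) \<in> borel_measurable borel"
    and "(\<integral>\<^sup>+\<xi>. esq (g (\<xi>, k)) \<partial>lborel) < \<infinity>"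
    and "R < norm \<xi> \<Longrightarrow> g (\<xi>, k) = 0"
    and "sq_norm freq_measure g = (\<Sum>k\<in>{k. norm (int_vec k) \<le> R}. (\<integral>\<^sup>+\<xi>. esq (g (\<xi>, k)) \<partial>lborel))"
proof -
  let ?I = "\<lambda>k. \<integral>\<^sup>+\<xi>. esq (g (\<xi>, k)) \<partial>lborel"
  show "(\<lambda>\<xi>. g (\<xi>, k)) \<in> borel_measurable borel"
    using measurable_Pair1[of g lborel "count_space UNIV" borel k] g by (simp add: freq_measure_def)
  have eq: "sq_norm freq_measure g = (\<integral>\<^sup>+k. ?I k \<partial>count_space UNIV)"
    unfolding sq_norm_def by (rule nn_integral_freq) (use g in measurable)
  have "?I k \<le> (\<integral>\<^sup>+k. ?I k \<partial>count_space UNIV)" by (rule nn_integral_ge_point) simp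
  then show "?I k < \<infinity>" using fin unfolding eq by (rule le_less_trans)
  show "g (\<xi>, k) = 0" if "R < norm \<xi>"
    using that norm_fst_le[of \<xi> "int_vec k"] by (intro supp) (auto simp: freq_ball_def freq_vec_def)
  have "?I k = 0" if "\<not> norm (int_vec k) \<le> R" for k
  proof -
    have "g (\<xi>, k) = 0" for \<xi>
      using that norm_snd_le[of "int_vec k" \<xi>] by (intro supp) (auto simp: freq_ball_def freq_vec_def)
    then show ?thesis by simp
  qed
  then show "sq_norm freq_measure g = (\<Sum>k\<in>{k. norm (int_vec k) \<le> R}. ?I k)"
    unfolding eq by (intro nn_integral_count_space') (auto intro: finite_int_vec_le)
qed

lemma parseval_finite_torus_cell:
  assumes "finite (K :: (int ^ 'm) set)"
  shows "(\<integral>\<^sup>+y\<in>torus_cell. esq (\<Sum>k\<in>K. cis (y \<bullet> int_vec k) * a k) \<partial>lborel) =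
    ennreal ((2 * pi) ^ CARD('m)) * (\<Sum>k\<in>K. esq (a k))"
proof -
  let ?a = "\<lambda>l. a (inv int_vec l)"
  have inj: "inj_on int_vec K" by (rule inj_on_subset[OF inj_int_vec]) auto
  have "(\<Sum>k\<in>K. cis (y \<bullet> int_vec k) * a k) = (\<Sum>l\<in>int_vec ` K. ?a l * cis (1 * (l \<bullet> y)))" for y
    by (subst sum.reindex[OF inj]) (simp add: inv_f_f[OF inj_int_vec] inner_commute mult.commute)
  moreover have "(\<Sum>k\<in>K. esq (a k)) = (\<Sum>l\<in>int_vec ` K. esq (?a l))"
    by (subst sum.reindex[OF inj]) (simp add: inv_f_f[OF inj_int_vec])
  moreover have "(\<integral>\<^sup>+y\<in>prod_cell {0..<2 * pi}. esq (\<Sum>l\<in>int_vec ` K. ?a l * cis (1 * (l \<bullet> y))) \<partial>lborel) =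
    ennreal ((2 * pi) ^ DIM(real ^ 'm)) * (\<Sum>l\<in>int_vec ` K. esq (?a l))"
    using integral_cis_period(2)[of 1 "2 * pi" 0] assms
    by (intro parseval_finite_prod_cell_nn bounded_half_open) (auto intro: int_vec_in_lattice)
  ultimately show ?thesis by (simp only: torus_cell_eq) simp
qed

text \<open>For fixed \<open>x\<close> the function is a finite trigonometric sum in
  \<open>y\<close>, to which Parseval on the cell applies; Plancherel in \<open>x\<close> then
  treats each coefficient \<open>G k\<close>.\<close>

theorem sq_norm_inv_fourier_integral:
  fixes g :: "(real ^ 'n) \<times> (int ^ 'm) \<Rightarrow> complex"
  assumes g [measurable]: "g \<in> borel_measurable freq_measure" and fin: "sq_norm freq_measure g < \<infinity>"
    and supp: "\<And>\<zeta>. \<zeta> \<notin> freq_ball R \<Longrightarrow> g \<zeta> = 0"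
  shows "sq_norm cyl_measure (inv_fourier_integral g) = sq_norm freq_measure g"
proof -
  let ?c = "unitary_factor (CARD('n) + CARD('m))" and ?K = "{k :: int ^ 'm. norm (int_vec k) \<le> R}"
  have slice1: "(\<lambda>\<xi>. g (\<xi>, k)) \<in> borel_measurable borel" for k using g fin supp by (rule freq_slice(1))
  have slice2: "(\<integral>\<^sup>+\<xi>. esq (g (\<xi>, k)) \<partial>lborel) < \<infinity>" for k using g fin supp by (rule freq_slice(2))
  have slice3: "R < norm \<xi> \<Longrightarrow> g (\<xi>, k) = 0" for \<xi> k using g fin supp by (rule freq_slice(3))
  have slice4: "sq_norm freq_measure g = (\<Sum>k\<in>?K. (\<integral>\<^sup>+\<xi>. esq (g (\<xi>, k)) \<partial>lborel))"
    using g fin supp by (rule freq_slice(4))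
  have finK: "finite ?K" by (rule finite_int_vec_le)
  define G where "G k x = (LINT \<xi>|lborel. cis (x \<bullet> \<xi>) * g (\<xi>, k))" for k x
  have gm [measurable]: "(\<lambda>\<xi>. g (\<xi>, k)) \<in> borel_measurable borel" for k by (rule slice1)
  have Gm [measurable]: "G k \<in> borel_measurable borel" for k unfolding G_def by measurable
  have int: "integrable lborel (\<lambda>\<xi>. cis (x \<bullet> \<xi>) * g (\<xi>, k))" for x k
  proof (rule integrable_mult_finite_support[of _ _ _ "cball 0 R"])
    show "emeasure lborel (cball 0 R :: (real ^ 'n) set) < \<infinity>" by (rule emeasure_bounded_finite) simp
    show "sq_norm lborel (\<lambda>\<xi>. g (\<xi>, k)) < \<infinity>" unfolding sq_norm_def by (rule slice2)
    show "\<xi> \<notin> cball 0 R \<Longrightarrow> g (\<xi>, k) = 0" for \<xi> using slice3 by simp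
  qed auto
  have coef: "inv_fourier_integral g (x, y) = of_real ?c * (\<Sum>k\<in>?K. cis (y \<bullet> int_vec k) * G k x)" for x y
  proof -
    have "(LINT \<xi>|lborel. cis (x \<bullet> \<xi>) * (\<Sum>k\<in>?K. cis (y \<bullet> int_vec k) * g (\<xi>, k))) =
      (LINT \<xi>|lborel. (\<Sum>k\<in>?K. cis (y \<bullet> int_vec k) * (cis (x \<bullet> \<xi>) * g (\<xi>, k))))"
      by (simp add: sum_distrib_left mult_ac)
    also have "\<dots> = (\<Sum>k\<in>?K. cis (y \<bullet> int_vec k) * G k x)"
      using int unfolding G_def by (subst Bochner_Integration.integral_sum) auto
    finally show ?thesis by (simp add: inv_fourier_integral_eq[OF g fin supp refl])
  qed
  have "sq_norm cyl_measure (inv_fourier_integral g) =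
    (\<integral>\<^sup>+x. (\<integral>\<^sup>+y\<in>torus_cell. esq (inv_fourier_integral g (x, y)) \<partial>lborel) \<partial>lborel)"
    unfolding sq_norm_def by (rule nn_integral_cyl) (use measurable_inv_fourier_integral[OF g] in measurable)
  also have "\<dots> = (\<integral>\<^sup>+x. ennreal (?c\<^sup>2) * (ennreal ((2 * pi) ^ CARD('m)) * (\<Sum>k\<in>?K. esq (G k x))) \<partial>lborel)"
  proof (rule nn_integral_cong)
    fix x :: "real ^ 'n"
    have "(\<integral>\<^sup>+y\<in>torus_cell. esq (inv_fourier_integral g (x, y)) \<partial>lborel) =
      (\<integral>\<^sup>+y. ennreal (?c\<^sup>2) * (esq (\<Sum>k\<in>?K. cis (y \<bullet> int_vec k) * G k x) * indicator torus_cell y) \<partial>lborel)"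
      by (simp add: coef norm_mult power_mult_distrib ennreal_mult mult.assoc)
    also have "\<dots> = ennreal (?c\<^sup>2) * (ennreal ((2 * pi) ^ CARD('m)) * (\<Sum>k\<in>?K. esq (G k x)))"
      unfolding parseval_finite_torus_cell[OF finK, symmetric] by (rule nn_integral_cmult) measurable
    finally show "(\<integral>\<^sup>+y\<in>torus_cell. esq (inv_fourier_integral g (x, y)) \<partial>lborel) =
      ennreal (?c\<^sup>2) * (ennreal ((2 * pi) ^ CARD('m)) * (\<Sum>k\<in>?K. esq (G k x)))" .
  qed
  also have "\<dots> = ennreal (?c\<^sup>2) * (ennreal ((2 * pi) ^ CARD('m)) * (\<Sum>k\<in>?K. (\<integral>\<^sup>+x. esq (G k x) \<partial>lborel)))"
    by (simp add: nn_integral_cmult nn_integral_sum del: sum_ennreal)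
  also have "(\<Sum>k\<in>?K. (\<integral>\<^sup>+x. esq (G k x) \<partial>lborel)) = ennreal ((2 * pi) ^ CARD('n)) * sq_norm freq_measure g"
    unfolding slice4 sum_distrib_left G_def
  proof (rule sum.cong[OF refl])
    fix k
    show "(\<integral>\<^sup>+x. esq (LINT \<xi>|lborel. cis (x \<bullet> \<xi>) * g (\<xi>, k)) \<partial>lborel) =
      ennreal ((2 * pi) ^ CARD('n)) * (\<integral>\<^sup>+\<xi>. esq (g (\<xi>, k)) \<partial>lborel)"
      using plancherel_bounded(1)[OF slice1[of k] slice3 slice2] by simp
  qed
  also have "ennreal (?c\<^sup>2) * (ennreal ((2 * pi) ^ CARD('m)) * (ennreal ((2 * pi) ^ CARD('n)) * sq_norm freq_measure g)) =
    ennreal (?c\<^sup>2 * (2 * pi) ^ (CARD('n) + CARD('m))) * sq_norm freq_measure g"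
    by (simp add: power_add ennreal_mult mult_ac)
  finally show ?thesis by (simp only: unitary_factor_squared ennreal_1 mult_1)
qed

section \<open>The transforms as limits of truncated isometries\<close>

lemma truncated_isometry_fourier:
  "truncated_isometry (cyl_measure :: ((real ^ 'n) \<times> (real ^ 'm)) measure) freq_measure cyl_ball fourier_integral"
proof
  fix z :: "(real ^ 'n) \<times> (real ^ 'm)"
  assume "z \<in> space cyl_measure"
  then show "\<exists>n::nat. z \<in> cyl_ball (real n)" using real_arch_simple by (auto simp: cyl_ball_def)
next
  fix w w' :: "(real ^ 'n) \<times> (real ^ 'm) \<Rightarrow> complex" and R \<zeta>
  assume w: "w \<in> borel_measurable cyl_measure" "sq_norm cyl_measure w < \<infinity>" "\<And>z. z \<notin> cyl_ball R \<Longrightarrow> w z = 0"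
    and w': "w' \<in> borel_measurable cyl_measure" "sq_norm cyl_measure w' < \<infinity>" "\<And>z. z \<notin> cyl_ball R \<Longrightarrow> w' z = 0"
  have "integrable cyl_measure (\<lambda>z. cis (- (z \<bullet> freq_vec \<zeta>)) * w z)"
    using w by (rule integrable_cyl)
  moreover have "integrable cyl_measure (\<lambda>z. cis (- (z \<bullet> freq_vec \<zeta>)) * w' z)"
    using w' by (rule integrable_cyl)
  ultimately show "fourier_integral (\<lambda>z. w z - w' z) \<zeta> = fourier_integral w \<zeta> - fourier_integral w' \<zeta>"
    unfolding fourier_integral_def by (simp only: right_diff_distrib Bochner_Integration.integral_diff)
next
  fix w :: "(real ^ 'n) \<times> (real ^ 'm) \<Rightarrow> complex" and R
  assume "w \<in> borel_measurable cyl_measure" "sq_norm cyl_measure w < \<infinity>" "\<And>z. z \<notin> cyl_ball R \<Longrightarrow> w z = 0"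
  then show "sq_norm freq_measure (fourier_integral w) = sq_norm cyl_measure w" by (rule sq_norm_fourier_integral)
qed (auto intro: measurable_fourier_integral simp: cyl_ball_def)

lemma truncated_isometry_inv_fourier:
  "truncated_isometry (freq_measure :: ((real ^ 'n) \<times> (int ^ 'm)) measure) cyl_measure freq_ball inv_fourier_integral"
proof
  fix \<zeta> :: "(real ^ 'n) \<times> (int ^ 'm)"
  show "\<exists>n::nat. \<zeta> \<in> freq_ball (real n)" using real_arch_simple by (auto simp: freq_ball_def)
next
  fix w w' :: "(real ^ 'n) \<times> (int ^ 'm) \<Rightarrow> complex" and R z
  assume w: "w \<in> borel_measurable freq_measure" "sq_norm freq_measure w < \<infinity>" "\<And>\<zeta>. \<zeta> \<notin> freq_ball R \<Longrightarrow> w \<zeta> = 0"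
    and w': "w' \<in> borel_measurable freq_measure" "sq_norm freq_measure w' < \<infinity>" "\<And>\<zeta>. \<zeta> \<notin> freq_ball R \<Longrightarrow> w' \<zeta> = 0"
  have "integrable freq_measure (\<lambda>\<zeta>. cis (z \<bullet> freq_vec \<zeta>) * w \<zeta>)"
    using w by (rule integrable_freq)
  moreover have "integrable freq_measure (\<lambda>\<zeta>. cis (z \<bullet> freq_vec \<zeta>) * w' \<zeta>)"
    using w' by (rule integrable_freq)
  ultimately show "inv_fourier_integral (\<lambda>z. w z - w' z) z = inv_fourier_integral w z - inv_fourier_integral w' z"
    unfolding inv_fourier_integral_def by (simp only: right_diff_distrib Bochner_Integration.integral_diff)
next
  fix w :: "(real ^ 'n) \<times> (int ^ 'm) \<Rightarrow> complex" and R
  assume "w \<in> borel_measurable freq_measure" "sq_norm freq_measure w < \<infinity>" "\<And>\<zeta>. \<zeta> \<notin> freq_ball R \<Longrightarrow> w \<zeta> = 0"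
  then show "sq_norm cyl_measure (inv_fourier_integral w) = sq_norm freq_measure w" by (rule sq_norm_inv_fourier_integral)
next
  show "freq_ball R \<in> sets (freq_measure :: ((real ^ 'n) \<times> (int ^ 'm)) measure)" for R by (rule sets_freq_ball)
qed (auto intro: measurable_inv_fourier_integral simp: freq_ball_def)

lemma fourier_eq_L2_lim:
  fixes u :: "(real ^ 'n) \<times> (real ^ 'm) \<Rightarrow> complex"
  shows "fourier u = L2_lim freq_measure (truncated_isometry.truncation cyl_ball fourier_integral u)"
proof -
  have "(LINT z:{z. norm (fst z) \<le> R}|cyl_measure. cis (- (z \<bullet> freq_vec \<zeta>)) * u z) =
    (LINT z|cyl_measure. cis (- (z \<bullet> freq_vec \<zeta>)) * (indicator (cyl_ball R) z * u z))" for R \<zeta>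
    unfolding set_lebesgue_integral_def
    by (intro Bochner_Integration.integral_cong refl) (auto simp: indicator_def cyl_ball_def)
  then have "truncated_isometry.truncation cyl_ball fourier_integral u = (\<lambda>R \<zeta>.
      complex_of_real ((1 / sqrt (2 * pi)) ^ (CARD('n) + CARD('m))) *
      (LINT z:{z. norm (fst z) \<le> R}|cyl_measure. cis (- (z \<bullet> freq_vec \<zeta>)) * u z))"
    by (intro ext) (simp only: truncated_isometry.truncation_def[OF truncated_isometry_fourier] fourier_integral_def unitary_factor_def)
  then show ?thesis by (simp only: fourier_def)
qed

lemma inv_fourier_eq_L2_lim:
  fixes g :: "(real ^ 'n) \<times> (int ^ 'm) \<Rightarrow> complex"
  shows "inv_fourier g = L2_lim cyl_measure (truncated_isometry.truncation freq_ball inv_fourier_integral g)"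
proof -
  have "(LINT \<zeta>:{\<zeta>. norm (freq_vec \<zeta>) \<le> R}|freq_measure. cis (z \<bullet> freq_vec \<zeta>) * g \<zeta>) =
    (LINT \<zeta>|freq_measure. cis (z \<bullet> freq_vec \<zeta>) * (indicator (freq_ball R) \<zeta> * g \<zeta>))" for R z
    unfolding set_lebesgue_integral_def
    by (intro Bochner_Integration.integral_cong refl) (auto simp: indicator_def freq_ball_def)
  then have "truncated_isometry.truncation freq_ball inv_fourier_integral g = (\<lambda>R z.
      complex_of_real ((1 / sqrt (2 * pi)) ^ (CARD('n) + CARD('m))) *
      (LINT \<zeta>:{\<zeta>. norm (freq_vec \<zeta>) \<le> R}|freq_measure. cis (z \<bullet> freq_vec \<zeta>) * g \<zeta>))"
    by (intro ext) (simp only: truncated_isometry.truncation_def[OF truncated_isometry_inv_fourier] inv_fourier_integral_def unitary_factor_def)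
  then show ?thesis by (simp only: inv_fourier_def)
qed

section \<open>The observability estimate\<close>

lemma energy_eq_nn_integral:
  fixes f :: "'e::euclidean_space \<Rightarrow> complex"
  assumes f: "continuous_on UNIV f"
  shows "ennreal (energy e f) = (\<integral>\<^sup>+X\<in>cube e. esq (f X) \<partial>lborel)"
proof -
  have "continuous_on (cube e) (\<lambda>X. (cmod (f X))\<^sup>2)"
    using f by (intro continuous_intros) (auto intro: continuous_on_subset)
  then have int: "integrable lborel (\<lambda>X. indicator (cube e) X *\<^sub>R (cmod (f X))\<^sup>2)"
    unfolding indicator_scaleR_eq_if by (intro borel_integrable_compact) (simp_all add: cube_def)
  then have "energy e f = (LINT X|lborel. indicator (cube e) X *\<^sub>R (cmod (f X))\<^sup>2)"
    unfolding energy_def using set_borel_integral_eq_integral(2)[of "cube e" "\<lambda>X. (cmod (f X))\<^sup>2"]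
    by (simp add: set_integrable_def set_lebesgue_integral_def)
  also have "ennreal \<dots> = (\<integral>\<^sup>+X. ennreal (indicator (cube e) X *\<^sub>R (cmod (f X))\<^sup>2) \<partial>lborel)"
    by (rule nn_integral_eq_integral[OF int, symmetric]) auto
  also have "\<dots> = (\<integral>\<^sup>+X\<in>cube e. esq (f X) \<partial>lborel)"
    by (intro nn_integral_cong) (auto simp: indicator_def)
  finally show ?thesis .
qed

text \<open>Expanding \<open>|k + \<Theta>|^2\<close> shows that, up to a unimodular factor, the
  solution is an exponential sum on the paraboloid with \<open>a = 2 \<Theta>\<close>. The constant
  is therefore independent of \<Theta>. Time enters the solution with a minus sign, so
  \<open>t = t0 - s\<close> is substituted.\<close>

lemma schroedinger_box_observable:
  fixes p :: "'e::euclidean_space" and t0 :: real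
  assumes e: "0 < e" "e \<le> pi"
  shows "\<exists>C\<ge>0. \<forall>K b \<Theta>. finite K \<longrightarrow> K \<subseteq> int_lattice \<longrightarrow>
    (\<Sum>k\<in>K. esq (b k)) \<le> ennreal C * (\<integral>\<^sup>+t\<in>{t0 - e..t0 + e}. (\<integral>\<^sup>+z\<in>cbox (p - e *\<^sub>R One) (p + e *\<^sub>R One).
      esq (\<Sum>k\<in>K. b k * cis (z \<bullet> (k + \<Theta>) - t * (norm (k + \<Theta>))\<^sup>2)) \<partial>lborel) \<partial>lborel)"
proof -
  obtain C where C: "C \<ge> 0" and obs: "\<And>(S::'e set) a. finite S \<Longrightarrow> S \<subseteq> int_lattice \<Longrightarrow> observable (paraboloid_point a ` S) e C"
    using observable_paraboloid[OF e, where 'e = 'e] by blast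
  show ?thesis
  proof (rule exI[of _ C], intro conjI C allI impI)
    fix K :: "'e set" and b :: "'e \<Rightarrow> complex" and \<Theta> :: 'e
    assume K: "finite K" "K \<subseteq> int_lattice"
    let ?g = "paraboloid_point (2 *\<^sub>R \<Theta>)"
    let ?F = "\<lambda>t z. (cmod (\<Sum>k\<in>K. b k * cis (z \<bullet> (k + \<Theta>) - t * (norm (k + \<Theta>))\<^sup>2)))\<^sup>2"
    \<comment> \<open>Moving the box centre \<open>p\<close> and the time centre \<open>t0\<close>
      to the origin costs a phase for each frequency, which is put into the coefficients without
      changing their modulus.\<close>
    define c where "c X = b (fst X) * cis (p \<bullet> fst X - t0 * (norm (fst X + \<Theta>))\<^sup>2)" for X :: "'e \<times> real"
    have inj: "inj_on ?g K" by (rule inj_on_subset[OF inj_paraboloid_point]) auto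
    have cg: "cmod (c (?g k)) = cmod (b k)" for k by (simp add: c_def paraboloid_point_def norm_mult)
    have eq: "(cmod (trig_sum (?g ` K) c (z, s)))\<^sup>2 = ?F (t0 - s) (p + z)" for z s
    proof -
      have "(\<Sum>k\<in>K. b k * cis ((p + z) \<bullet> (k + \<Theta>) - (t0 - s) * (norm (k + \<Theta>))\<^sup>2)) =
        cis ((p + z) \<bullet> \<Theta> + s * (norm \<Theta>)\<^sup>2) * trig_sum (?g ` K) c (z, s)"
        unfolding trig_sum_def sum.reindex[OF inj] sum_distrib_left o_def
      proof (rule sum.cong[OF refl])
        fix k
        have "(p + z) \<bullet> (k + \<Theta>) - (t0 - s) * (norm (k + \<Theta>))\<^sup>2 =
          ((p + z) \<bullet> \<Theta> + s * (norm \<Theta>)\<^sup>2) + (p \<bullet> k - t0 * (norm (k + \<Theta>))\<^sup>2) + (?g k \<bullet> (z, s))"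
          unfolding paraboloid_point_def power2_norm_eq_inner
          by (simp add: inner_add_left inner_add_right inner_commute algebra_simps)
        then show "b k * cis ((p + z) \<bullet> (k + \<Theta>) - (t0 - s) * (norm (k + \<Theta>))\<^sup>2) =
          cis ((p + z) \<bullet> \<Theta> + s * (norm \<Theta>)\<^sup>2) * (c (?g k) * cis (?g k \<bullet> (z, s)))"
          unfolding c_def by (simp only: cis_mult[symmetric]) (simp add: paraboloid_point_def mult_ac)
      qed
      then show ?thesis by (simp add: norm_mult)
    qed
    have meas [measurable]: "(\<lambda>(t, z). ennreal (?F t z)) \<in> borel_measurable (borel \<Otimes>\<^sub>M borel)" by measurable
    have "ennreal (\<Sum>k\<in>K. (cmod (b k))\<^sup>2) \<le> ennreal (C * energy e (trig_sum (?g ` K) c))"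
      using obs[OF K, of "2 *\<^sub>R \<Theta>"] unfolding observable_def
      by (intro ennreal_leI) (auto simp: sum.reindex[OF inj] cg dest: spec[of _ c])
    also have "\<dots> = ennreal C * (\<integral>\<^sup>+X\<in>cube e. esq (trig_sum (?g ` K) c X) \<partial>lborel)"
      using C by (simp add: ennreal_mult energy_nonneg energy_eq_nn_integral continuous_intros)
    also have "(\<integral>\<^sup>+X\<in>cube e. esq (trig_sum (?g ` K) c X) \<partial>lborel) =
      (\<integral>\<^sup>+s. (\<integral>\<^sup>+z. esq (trig_sum (?g ` K) c (z, s)) * indicator (cube e) (z, s) \<partial>lborel) \<partial>lborel)"
    proof -
      have "(\<lambda>X. esq (trig_sum (?g ` K) c X) * indicator (cube e) X) \<in> borel_measurable (lborel \<Otimes>\<^sub>M lborel)"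
      proof -
        have [measurable]: "trig_sum (?g ` K) c \<in> borel_measurable borel"
          by (intro borel_measurable_continuous_onI continuous_intros)
        have [measurable]: "(cube e :: ('e \<times> real) set) \<in> sets borel" by (simp add: cube_def)
        show ?thesis unfolding lborel_prod by measurable
      qed
      from lborel_pair.nn_integral_snd[OF this] show ?thesis by (simp add: lborel_prod)
    qed
    also have "\<dots> = (\<integral>\<^sup>+s. (\<integral>\<^sup>+z. ennreal (?F (t0 - s) (p + z)) * indicator (cbox (p - e *\<^sub>R One) (p + e *\<^sub>R One)) (p + z) \<partial>lborel)
        * indicator {t0 - e..t0 + e} (t0 - s) \<partial>lborel)"
    proof (rule nn_integral_cong)
      fix s :: real
      have "indicator (cube e) (z, s) = indicator (cbox (p - e *\<^sub>R One) (p + e *\<^sub>R One)) (p + z) * (indicator {t0 - e..t0 + e} (t0 - s) :: ennreal)" for z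
        by (auto simp: cube_prod cbox_Pair_eq indicator_def mem_box inner_diff_left inner_add_left)
      then have "(\<integral>\<^sup>+z. esq (trig_sum (?g ` K) c (z, s)) * indicator (cube e) (z, s) \<partial>lborel) =
        (\<integral>\<^sup>+z. ennreal (?F (t0 - s) (p + z)) * indicator (cbox (p - e *\<^sub>R One) (p + e *\<^sub>R One)) (p + z) * indicator {t0 - e..t0 + e} (t0 - s) \<partial>lborel)"
        by (simp only: eq mult.assoc)
      also have "\<dots> = (\<integral>\<^sup>+z. ennreal (?F (t0 - s) (p + z)) * indicator (cbox (p - e *\<^sub>R One) (p + e *\<^sub>R One)) (p + z) \<partial>lborel) * indicator {t0 - e..t0 + e} (t0 - s)"
        by (rule nn_integral_multc) measurable
      finally show "(\<integral>\<^sup>+z. esq (trig_sum (?g ` K) c (z, s)) * indicator (cube e) (z, s) \<partial>lborel) = \<dots>" .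
    qed
    also have "\<dots> = (\<integral>\<^sup>+s. (\<integral>\<^sup>+z\<in>cbox (p - e *\<^sub>R One) (p + e *\<^sub>R One). ennreal (?F (t0 - s) z) \<partial>lborel) * indicator {t0 - e..t0 + e} (t0 - s) \<partial>lborel)"
    proof -
      have "(\<integral>\<^sup>+z. ennreal (?F (t0 - s) (p + z)) * indicator (cbox (p - e *\<^sub>R One) (p + e *\<^sub>R One)) (p + z) \<partial>lborel) =
        (\<integral>\<^sup>+z\<in>cbox (p - e *\<^sub>R One) (p + e *\<^sub>R One). ennreal (?F (t0 - s) z) \<partial>lborel)" for s
        by (rule nn_integral_translate) measurable
      then show ?thesis by simp
    qed
    \<comment> \<open>The substitution \<open>t = t0 - s\<close>, under which the time interval is
      symmetric.\<close>
    also have "\<dots> = (\<integral>\<^sup>+t\<in>{t0 - e..t0 + e}. (\<integral>\<^sup>+z\<in>cbox (p - e *\<^sub>R One) (p + e *\<^sub>R One). ennreal (?F t z) \<partial>lborel) \<partial>lborel)"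
      by (subst (2) nn_integral_real_affine[where c = "-1" and t = t0]) auto
    finally show "(\<Sum>k\<in>K. esq (b k)) \<le> ennreal C * (\<integral>\<^sup>+t\<in>{t0 - e..t0 + e}.
       (\<integral>\<^sup>+z\<in>cbox (p - e *\<^sub>R One) (p + e *\<^sub>R One). ennreal (?F t z) \<partial>lborel) \<partial>lborel)"
      by simp
  qed
qed

section \<open>Boxes inside periodic open sets\<close>

lemma two_pi_invariant_iff:
  fixes S :: "(real ^ 'm) set"
  assumes "two_pi_invariant S" "q \<in> int_lattice"
  shows "x + (2 * pi) *\<^sub>R q \<in> S \<longleftrightarrow> x \<in> S"
proof -
  obtain k where "q = int_vec k" using assms(2) range_int_vec by blast
  then have img: "(\<lambda>x. x + (2 * pi) *\<^sub>R q) ` S = S" using assms(1) by (simp add: two_pi_invariant_def)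
  show ?thesis
  proof
    assume "x + (2 * pi) *\<^sub>R q \<in> S"
    then obtain y where "y \<in> S" "x + (2 * pi) *\<^sub>R q = y + (2 * pi) *\<^sub>R q" using img by blast
    then show "x \<in> S" by simp
  qed (use img in blast)
qed

text \<open>Periodicity moves a point of \<open>S\<close> into the half-open cell. It may lie on a
  face, but it is in the closure of the open cell, so the open set \<open>S\<close> meets the open
  cell.\<close>

lemma box_in_cell:
  fixes S :: "(real ^ 'm) set"
  assumes S: "S \<noteq> {}" "open S" "two_pi_invariant S"
  shows "\<exists>p \<delta>. 0 < \<delta> \<and> (\<forall>e\<le>\<delta>. cbox (p - e *\<^sub>R One) (p + e *\<^sub>R One) \<subseteq> S \<inter> prod_cell {0..<2 * pi})"
proof -
  obtain x where x: "x \<in> S" using S by auto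
  obtain q where q: "q \<in> int_lattice" "x - (2 * pi) *\<^sub>R q \<in> prod_cell {0..<2 * pi}"
    using prod_cell_translate_unique[of "2 * pi" x] by auto
  have y: "x - (2 * pi) *\<^sub>R q \<in> S" using two_pi_invariant_iff[OF S(3) q(1), of "x - (2 * pi) *\<^sub>R q"] x by simp
  let ?B = "box 0 ((2 * pi) *\<^sub>R One) :: (real ^ 'm) set"
  have ne: "?B \<noteq> {}" by (simp add: box_ne_empty)
  have "x - (2 * pi) *\<^sub>R q \<in> closure ?B"
    using q(2) ne by (auto simp: closure_box prod_cell_def mem_box intro: less_imp_le)
  then have "S \<inter> ?B \<noteq> {}" using y open_Int_closure_eq_empty[OF S(2), of ?B] by blast
  then obtain p where p: "p \<in> S \<inter> ?B" by blast
  have "open (S \<inter> ?B)" using S(2) by (intro open_Int open_box)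
  then obtain r where r: "0 < r" "ball p r \<subseteq> S \<inter> ?B" using p openE by blast
  \<comment> \<open>The norm is at most the sum of the coordinates, so a box of half-width \<delta>
    has radius at most \<open>r / 2\<close> and stays strictly inside the ball.\<close>
  define \<delta> where "\<delta> = r / (2 * real (DIM(real ^ 'm)))"
  have D: "0 < real (DIM(real ^ 'm))" by (simp add: DIM_positive del: DIM_cart)
  have \<delta>: "0 < \<delta>" using r(1) D unfolding \<delta>_def by (intro divide_pos_pos) auto
  have "cbox (p - e *\<^sub>R One) (p + e *\<^sub>R One) \<subseteq> S \<inter> prod_cell {0..<2 * pi}" if e: "e \<le> \<delta>" for e
  proof
    fix z assume z: "z \<in> cbox (p - e *\<^sub>R One) (p + e *\<^sub>R One)"
    have "norm (z - p) \<le> (\<Sum>b\<in>Basis. \<bar>(z - p) \<bullet> b\<bar>)" by (rule norm_le_l1)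
    also have "\<dots> \<le> (\<Sum>b\<in>(Basis :: (real ^ 'm) set). \<delta>)"
    proof (rule sum_mono)
      fix b :: "real ^ 'm" assume b: "b \<in> Basis"
      then have "(p - e *\<^sub>R One) \<bullet> b \<le> z \<bullet> b" "z \<bullet> b \<le> (p + e *\<^sub>R One) \<bullet> b" using z by (auto simp: mem_box)
      then show "\<bar>(z - p) \<bullet> b\<bar> \<le> \<delta>" using e b by (simp add: inner_diff_left inner_add_left abs_le_iff)
    qed
    also have "\<dots> = r / 2" using D unfolding \<delta>_def by simp
    also have "\<dots> < r" using r by simp
    finally have "z \<in> ball p r" by (simp add: dist_norm norm_minus_commute)
    then have "z \<in> S \<inter> ?B" using r by blast
    then show "z \<in> S \<inter> prod_cell {0..<2 * pi}" by (auto simp: prod_cell_def mem_box less_imp_le)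
  qed
  then show ?thesis using \<delta> by blast
qed

lemma mem_cbox_centered:
  "z \<in> cbox (p - e *\<^sub>R One) (p + e *\<^sub>R One) \<longleftrightarrow> (\<forall>b\<in>Basis. \<bar>z \<bullet> b - p \<bullet> b\<bar> \<le> e)"
  for z :: "'e::euclidean_space"
proof -
  have "p \<bullet> b - e \<le> z \<bullet> b \<and> z \<bullet> b \<le> p \<bullet> b + e \<longleftrightarrow> \<bar>z \<bullet> b - p \<bullet> b\<bar> \<le> e" for b by auto
  then show ?thesis by (auto simp: mem_box inner_diff_left inner_add_left)
qed

section \<open>Observability for bounded frequencies\<close>

definition evolved :: "real \<Rightarrow> ((real ^ 'n) \<times> (int ^ 'm) \<Rightarrow> complex) \<Rightarrow> (real ^ 'n) \<times> (int ^ 'm) \<Rightarrow> complex" where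
  "evolved t g \<zeta> = cis (- t * (norm (freq_vec \<zeta>))\<^sup>2) * g \<zeta>"

lemma cmod_evolved [simp]: "cmod (evolved t g \<zeta>) = cmod (g \<zeta>)"
  by (simp add: evolved_def norm_mult)

lemma sq_norm_evolved [simp]: "sq_norm M (evolved t g) = sq_norm M g"
  by (simp add: sq_norm_def)

lemma measurable_evolved: "g \<in> borel_measurable freq_measure \<Longrightarrow> evolved t g \<in> borel_measurable freq_measure"
  unfolding evolved_def[abs_def] by measurable

lemma evolved_indicator: "indicator A \<zeta> * evolved t g \<zeta> = evolved t (\<lambda>\<zeta>. indicator A \<zeta> * g \<zeta>) \<zeta>"
  by (simp add: evolved_def)

text \<open>The constant must not depend on \<open>R\<close>, since \<open>R\<close> tends to
  infinity afterwards. Although \<open>J\<close> and the set of \<open>k\<close> grow with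
  \<open>R\<close>, for each \<theta> they only form a finite frequency set, and the box estimate is
  uniform over such sets and over the shift \<open>(\<theta>, 0)\<close>.\<close>

theorem observable_bounded_frequency:
  fixes \<Omega>1 :: "(real ^ 'n) set" and \<Omega>2 :: "(real ^ 'm) set" and T :: real
  assumes \<Omega>1: "\<Omega>1 \<noteq> {}" "open \<Omega>1" "two_pi_invariant \<Omega>1"
    and \<Omega>2: "\<Omega>2 \<noteq> {}" "open \<Omega>2" "two_pi_invariant \<Omega>2" and T: "T > 0"
  shows "\<exists>C::real. 0 \<le> C \<and> (\<forall>R. \<forall>g \<in> borel_measurable (freq_measure :: ((real ^ 'n) \<times> (int ^ 'm)) measure).
    sq_norm freq_measure g < \<infinity> \<longrightarrow> (\<forall>\<zeta>. \<zeta> \<notin> freq_ball R \<longrightarrow> g \<zeta> = 0) \<longrightarrow>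
    sq_norm freq_measure g \<le> ennreal C * (\<integral>\<^sup>+t\<in>{0..T}.
      (\<integral>\<^sup>+z\<in>\<Omega>1 \<times> \<Omega>2. esq (inv_fourier_integral (evolved t g) z) \<partial>cyl_measure) \<partial>lborel))"
proof -
  obtain p1 \<delta>1 where p1: "0 < \<delta>1" "\<And>e. e \<le> \<delta>1 \<Longrightarrow> cbox (p1 - e *\<^sub>R One) (p1 + e *\<^sub>R One) \<subseteq> \<Omega>1 \<inter> prod_cell {0..<2 * pi}"
    using box_in_cell[OF \<Omega>1] by blast
  obtain p2 \<delta>2 where p2: "0 < \<delta>2" "\<And>e. e \<le> \<delta>2 \<Longrightarrow> cbox (p2 - e *\<^sub>R One) (p2 + e *\<^sub>R One) \<subseteq> \<Omega>2 \<inter> prod_cell {0..<2 * pi}"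
    using box_in_cell[OF \<Omega>2] by blast
  \<comment> \<open>Small enough for both boxes, for the time interval around \<open>T / 2\<close>
    to stay within \<open>[0, T]\<close>, and for the box estimate, which asks for
    \<open>e \<le> pi\<close>.\<close>
  define e where "e = min (min \<delta>1 \<delta>2) (min (T / 2) pi)"
  have e: "0 < e" "e \<le> pi" "e \<le> \<delta>1" "e \<le> \<delta>2" "e \<le> T / 2" using p1(1) p2(1) T by (auto simp: e_def)
  let ?W1 = "cbox (p1 - e *\<^sub>R One) (p1 + e *\<^sub>R One)" and ?W2 = "cbox (p2 - e *\<^sub>R One) (p2 + e *\<^sub>R One)"
  let ?I = "{T / 2 - e..T / 2 + e}"
  have W1: "?W1 \<subseteq> \<Omega>1" "?W1 \<subseteq> prod_cell {0..<2 * pi}" using p1(2)[OF e(3)] by auto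
  have W2: "?W2 \<subseteq> \<Omega>2" "?W2 \<subseteq> torus_cell" using p2(2)[OF e(4)] by (auto simp: torus_cell_eq)
  have I: "?I \<subseteq> {0..T}" using e by auto
  have W12: "cbox ((p1, p2) - e *\<^sub>R One) ((p1, p2) + e *\<^sub>R One) = ?W1 \<times> ?W2"
  proof -
    have "z \<in> cbox ((p1, p2) - e *\<^sub>R One) ((p1, p2) + e *\<^sub>R One) \<longleftrightarrow> z \<in> ?W1 \<times> ?W2" for z
      unfolding mem_Times_iff mem_cbox_centered by (cases z) (simp add: Basis_prod_def ball_Un)
    then show ?thesis by blast
  qed
  have [measurable]: "?W1 \<times> ?W2 \<in> sets borel" unfolding W12[symmetric] by simp
  obtain C where C: "C \<ge> 0" and obs: "\<And>K b \<Theta>. finite K \<Longrightarrow> K \<subseteq> int_lattice \<Longrightarrow>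
    (\<Sum>k\<in>K. esq (b k)) \<le> ennreal C * (\<integral>\<^sup>+t\<in>?I. (\<integral>\<^sup>+z\<in>?W1 \<times> ?W2.
      esq (\<Sum>k\<in>K. b k * cis (z \<bullet> (k + \<Theta>) - t * (norm (k + \<Theta>))\<^sup>2)) \<partial>lborel) \<partial>lborel)"
    using schroedinger_box_observable[OF e(1,2), of "(p1, p2)" "T / 2"] unfolding W12 by blast
  let ?c = "unitary_factor (CARD('n) + CARD('m))"
  have c: "0 < ?c" by (simp add: unitary_factor_def)
  have main: "ennreal (?c\<^sup>2) * sq_norm freq_measure g \<le> ennreal C * (\<integral>\<^sup>+t\<in>{0..T}.
      (\<integral>\<^sup>+z\<in>\<Omega>1 \<times> \<Omega>2. esq (inv_fourier_integral (evolved t g) z) \<partial>cyl_measure) \<partial>lborel)"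
    if g [measurable]: "g \<in> borel_measurable freq_measure" and fin: "sq_norm freq_measure g < \<infinity>"
      and supp: "\<And>\<zeta>. \<zeta> \<notin> freq_ball R \<Longrightarrow> g \<zeta> = 0" for R and g :: "(real ^ 'n) \<times> (int ^ 'm) \<Rightarrow> complex"
  proof -
    let ?K = "{k :: int ^ 'm. norm (int_vec k) \<le> R}"
    have finK: "finite ?K" by (rule finite_int_vec_le)
    have slice1 [measurable]: "(\<lambda>\<xi>. g (\<xi>, k)) \<in> borel_measurable borel" for k using g fin supp by (rule freq_slice(1))
    have slice2: "(\<integral>\<^sup>+\<xi>. esq (g (\<xi>, k)) \<partial>lborel) < \<infinity>" for k using g fin supp by (rule freq_slice(2))
    have slice3: "R < norm \<xi> \<Longrightarrow> g (\<xi>, k) = 0" for \<xi> k using g fin supp by (rule freq_slice(3))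
    have slice4: "sq_norm freq_measure g = (\<Sum>k\<in>?K. (\<integral>\<^sup>+\<xi>. esq (g (\<xi>, k)) \<partial>lborel))"
      using g fin supp by (rule freq_slice(4))
    obtain J where J: "\<And>h :: real ^ 'n \<Rightarrow> complex. h \<in> borel_measurable borel \<Longrightarrow> (\<And>\<xi>. R < norm \<xi> \<Longrightarrow> h \<xi> = 0) \<Longrightarrow> cell_supported h J"
      using cell_supported_bounded_support[of R, where 'e = "real ^ 'n"] by blast
    have cs0: "cell_supported (\<lambda>\<xi>. g (\<xi>, k)) J" for k by (intro J slice1 slice3)
    have Jfin: "finite J" "J \<subseteq> int_lattice"
      using cell_supported.J[OF cs0[of 0]] by auto
    \<comment> \<open>The inverse transform in the torus variable only; \<open>y\<close> and
      \<open>t\<close> are parameters and \<xi> remains.\<close>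
    define h where "h t y \<xi> = (\<Sum>k\<in>?K. cis (y \<bullet> int_vec k) * evolved t g (\<xi>, k))" for t y \<xi>
    have h_eq: "h t y \<xi> = (\<Sum>k\<in>?K. cis (y \<bullet> int_vec k) * (cis (- t * ((norm \<xi>)\<^sup>2 + (norm (int_vec k :: real ^ 'm))\<^sup>2)) * g (\<xi>, k)))" for t y \<xi>
      unfolding h_def evolved_def freq_vec_def norm_Pair by simp
    have hm [measurable]: "h t y \<in> borel_measurable borel" for t y unfolding h_eq[abs_def] by measurable
    have hsupp: "R < norm \<xi> \<Longrightarrow> h t y \<xi> = 0" for t y \<xi> by (simp add: h_eq slice3)
    have hfin: "(\<integral>\<^sup>+\<xi>. esq (h t y \<xi>) \<partial>lborel) < \<infinity>" for t y
    proof -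
      have "sq_norm lborel (\<lambda>\<xi>. \<Sum>k\<in>A. cis (y \<bullet> int_vec k) * (cis (- t * ((norm \<xi>)\<^sup>2 + (norm (int_vec k :: real ^ 'm))\<^sup>2)) * g (\<xi>, k))) < \<infinity>"
        if "finite A" for A
        using that
      proof induction
        case empty
        then show ?case by (simp add: sq_norm_def)
      next
        case (insert k A)
        have "sq_norm lborel (\<lambda>\<xi>. cis (y \<bullet> int_vec k) * (cis (- t * ((norm \<xi>)\<^sup>2 + (norm (int_vec k :: real ^ 'm))\<^sup>2)) * g (\<xi>, k))) < \<infinity>"
          using slice2[of k] by (simp add: sq_norm_def norm_mult)
        then show ?case
          unfolding sum.insert[OF insert.hyps] by (intro sq_norm_finite_add insert.IH) measurable
      qed
      from this[OF finK] show ?thesis by (simp add: sq_norm_def h_eq)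
    qed
    have cs: "cell_supported (h t y) J" for t y by (intro J hm hsupp)
    define V where "V t x y = (LINT \<xi>|lborel. cis (x \<bullet> \<xi>) * h t y \<xi>)" for t x y
    have Vm [measurable]: "(\<lambda>(x, y). V t x y) \<in> borel_measurable (borel \<Otimes>\<^sub>M borel)" for t
      unfolding V_def h_eq by measurable
    have inv: "inv_fourier_integral (evolved t g) (x, y) = of_real ?c * V t x y" for t x y
      unfolding V_def h_def
      by (rule inv_fourier_integral_eq[where R = R, OF measurable_evolved[OF g]]) (use fin supp in \<open>auto simp: evolved_def\<close>)
    \<comment> \<open>The squared modulus of the torus solution in the fibre over \<theta>, as one
      function of all variables so that its joint measurability can serve every exchange of
      integrals.\<close>
    define \<Phi> where "\<Phi> = (\<lambda>(\<theta>, t, z :: (real ^ 'n) \<times> (real ^ 'm)).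
      esq (\<Sum>j\<in>J. cis (fst z \<bullet> (\<theta> + j)) * h t (snd z) (\<theta> + j)))"
    have \<Phi>m [measurable]: "\<Phi> \<in> borel_measurable (borel \<Otimes>\<^sub>M borel \<Otimes>\<^sub>M borel)"
    proof -
      have "\<Phi> \<in> borel_measurable (borel \<Otimes>\<^sub>M borel \<Otimes>\<^sub>M (borel \<Otimes>\<^sub>M borel))"
        unfolding \<Phi>_def h_eq by measurable
      then show ?thesis by (simp add: borel_prod)
    qed
    have zak: "(\<integral>\<^sup>+q. esq (V t (x + (2 * pi) *\<^sub>R q) y) \<partial>count_space int_lattice) = (\<integral>\<^sup>+\<theta>\<in>unit_cell. \<Phi> (\<theta>, t, x, y) \<partial>lborel)" for t x y
      unfolding V_def \<Phi>_def prod.case fst_conv snd_conv by (rule cell_supported.nn_integral_zak[OF cs hfin])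
    define G where "G t z = (\<integral>\<^sup>+\<theta>\<in>unit_cell. \<Phi> (\<theta>, t, z) \<partial>lborel)" for t z
    have Gm [measurable]: "(\<lambda>(t, z). G t z) \<in> borel_measurable (borel \<Otimes>\<^sub>M borel)"
      unfolding G_def by measurable
    define A where "A t = (\<integral>\<^sup>+z\<in>\<Omega>1 \<times> \<Omega>2. esq (inv_fourier_integral (evolved t g) z) \<partial>cyl_measure)" for t
    have [measurable]: "\<Omega>1 \<in> sets borel" "\<Omega>2 \<in> sets borel" using \<Omega>1(2) \<Omega>2(2) by auto
    \<comment> \<open>Tiling the \<open>x\<close>-integral over \<Omega>1 and keeping only base
      points in \<open>?W1\<close> leaves the sum over all translates, each of which lies in
      \<Omega>1 by periodicity. The Zak identity evaluates this sum as \<open>G\<close>. In the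
      \<open>y\<close> variable the integral is simply restricted to \<open>?W2\<close>.\<close>
    have lower: "ennreal (?c\<^sup>2) * (\<integral>\<^sup>+z\<in>?W1 \<times> ?W2. G t z \<partial>lborel) \<le> A t" for t
    proof -
      let ?H = "\<lambda>x y. ennreal (?c\<^sup>2) * (esq (V t x y) * (indicator \<Omega>1 x * indicator ?W2 y))"
      let ?L = "\<lambda>z. ennreal (?c\<^sup>2) * (G t z * indicator (?W1 \<times> ?W2) z)"
      have Lm: "?L \<in> borel_measurable borel" by measurable
      have "ennreal (?c\<^sup>2) * (\<integral>\<^sup>+z\<in>?W1 \<times> ?W2. G t z \<partial>lborel) = (\<integral>\<^sup>+z. ?L z \<partial>lborel)"
        by (rule nn_integral_cmult[symmetric]) measurable
      also have "\<dots> = (\<integral>\<^sup>+y. (\<integral>\<^sup>+x. ?L (x, y) \<partial>lborel) \<partial>lborel)"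
        using lborel_pair.nn_integral_snd[of ?L] Lm by (simp add: lborel_prod)
      also have "\<dots> \<le> (\<integral>\<^sup>+y. (\<integral>\<^sup>+x. ?H x y \<partial>lborel) \<partial>lborel)"
      proof (rule nn_integral_mono)
        fix y :: "real ^ 'm"
        have "(\<integral>\<^sup>+x. ?L (x, y) \<partial>lborel) \<le> (\<integral>\<^sup>+x\<in>prod_cell {0..<2 * pi}. (\<integral>\<^sup>+q. ?H (x + (2 * pi) *\<^sub>R q) y \<partial>count_space int_lattice) \<partial>lborel)"
        proof (rule nn_integral_mono)
          fix x :: "real ^ 'n"
          show "?L (x, y) \<le> (\<integral>\<^sup>+q. ?H (x + (2 * pi) *\<^sub>R q) y \<partial>count_space int_lattice) * indicator (prod_cell {0..<2 * pi}) x"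
          proof (cases "x \<in> ?W1 \<and> y \<in> ?W2")
            case True
            have "?L (x, y) = ennreal (?c\<^sup>2) * (\<integral>\<^sup>+q. esq (V t (x + (2 * pi) *\<^sub>R q) y) \<partial>count_space int_lattice)"
              using True by (simp add: zak G_def)
            also have "\<dots> = (\<integral>\<^sup>+q. ennreal (?c\<^sup>2) * esq (V t (x + (2 * pi) *\<^sub>R q) y) \<partial>count_space int_lattice)"
              by (rule nn_integral_cmult[symmetric]) simp
            also have "\<dots> = (\<integral>\<^sup>+q. ?H (x + (2 * pi) *\<^sub>R q) y \<partial>count_space int_lattice)"
            proof (rule nn_integral_cong)
              fix q :: "real ^ 'n" assume "q \<in> space (count_space int_lattice)"
              then have "x + (2 * pi) *\<^sub>R q \<in> \<Omega>1" using two_pi_invariant_iff[OF \<Omega>1(3)] True W1(1) by auto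
              then show "ennreal (?c\<^sup>2) * esq (V t (x + (2 * pi) *\<^sub>R q) y) = ?H (x + (2 * pi) *\<^sub>R q) y"
                using True by simp
            qed
            finally show ?thesis using True W1(2) by (auto simp: indicator_def)
          qed auto
        qed
        also have "\<dots> = (\<integral>\<^sup>+x. ?H x y \<partial>lborel)"
          by (rule nn_integral_tiling[symmetric]) auto
        finally show "(\<integral>\<^sup>+x. ?L (x, y) \<partial>lborel) \<le> (\<integral>\<^sup>+x. ?H x y \<partial>lborel)" .
      qed
      also have "\<dots> = (\<integral>\<^sup>+x. (\<integral>\<^sup>+y. ?H x y \<partial>lborel) \<partial>lborel)"
        by (rule lborel_pair.Fubini') measurable
      also have "\<dots> \<le> (\<integral>\<^sup>+x. (\<integral>\<^sup>+y\<in>torus_cell. esq (inv_fourier_integral (evolved t g) (x, y)) * indicator (\<Omega>1 \<times> \<Omega>2) (x, y) \<partial>lborel) \<partial>lborel)"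
      proof (intro nn_integral_mono)
        fix x :: "real ^ 'n" and y :: "real ^ 'm"
        show "?H x y \<le> esq (inv_fourier_integral (evolved t g) (x, y)) * indicator (\<Omega>1 \<times> \<Omega>2) (x, y) * indicator torus_cell y"
          using W2 by (auto simp: inv norm_mult power_mult_distrib ennreal_mult indicator_def)
      qed
      also have "\<dots> = A t"
        unfolding A_def
      proof (rule nn_integral_cyl[symmetric])
        have [measurable]: "(indicator (\<Omega>1 \<times> \<Omega>2) :: (real ^ 'n) \<times> (real ^ 'm) \<Rightarrow> ennreal) \<in> borel_measurable cyl_measure"
          by (rule measurable_indicator_cyl) measurable
        show "(\<lambda>z. esq (inv_fourier_integral (evolved t g) z) * indicator (\<Omega>1 \<times> \<Omega>2) z) \<in> borel_measurable cyl_measure"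
          using measurable_inv_fourier_integral[OF measurable_evolved[OF g], of t] by measurable
      qed
      finally show ?thesis .
    qed
    have fibre: "(\<Sum>k\<in>?K. \<Sum>j\<in>J. esq (g (\<theta> + j, k))) \<le>
      ennreal C * (\<integral>\<^sup>+t\<in>?I. (\<integral>\<^sup>+z\<in>?W1 \<times> ?W2. \<Phi> (\<theta>, t, z) \<partial>lborel) \<partial>lborel)" for \<theta>
    proof -
      \<comment> \<open>The frequencies of the fibre solution are the points
        \<open>(j, int_vec k)\<close> shifted by \<open>(\<theta>, 0)\<close>; inverting
        \<open>int_vec\<close> makes the coefficients a function on this lattice set.\<close>
      let ?P = "J \<times> (int_vec ` ?K :: (real ^ 'm) set)" and ?b = "\<lambda>k. g (\<theta> + fst k, inv int_vec (snd k))"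
      have inj: "inj_on int_vec ?K" by (rule inj_on_subset[OF inj_int_vec]) auto
      have P: "finite ?P" "?P \<subseteq> int_lattice"
        using Jfin finK int_vec_in_lattice[where 'm = 'm] by (auto simp: int_lattice_def Basis_prod_def)
      have form: "(\<Sum>k\<in>?P. ?b k * cis (z \<bullet> (k + (\<theta>, 0)) - t * (norm (k + (\<theta>, 0)))\<^sup>2)) =
        (\<Sum>j\<in>J. cis (fst z \<bullet> (\<theta> + j)) * h t (snd z) (\<theta> + j))" for z t
      proof -
        have "(\<Sum>k\<in>?P. ?b k * cis (z \<bullet> (k + (\<theta>, 0)) - t * (norm (k + (\<theta>, 0)))\<^sup>2)) =
          (\<Sum>j\<in>J. \<Sum>l\<in>int_vec ` ?K. ?b (j, l) * cis (z \<bullet> ((j, l) + (\<theta>, 0)) - t * (norm ((j, l) + (\<theta>, 0)))\<^sup>2))"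
          by (simp only: sum.cartesian_product split_beta' prod.collapse)
        also have "\<dots> = (\<Sum>j\<in>J. \<Sum>k\<in>?K. g (\<theta> + j, k) * cis (z \<bullet> (\<theta> + j, int_vec k) - t * (norm (\<theta> + j, int_vec k :: real ^ 'm))\<^sup>2))"
          by (subst sum.reindex[OF inj]) (simp add: inv_f_f[OF inj_int_vec] add.commute)
        also have "\<dots> = (\<Sum>j\<in>J. cis (fst z \<bullet> (\<theta> + j)) * h t (snd z) (\<theta> + j))"
        proof (rule sum.cong[OF refl])
          fix j
          have "g (\<theta> + j, k) * cis (z \<bullet> (\<theta> + j, int_vec k) - t * (norm (\<theta> + j, int_vec k :: real ^ 'm))\<^sup>2) =
            cis (fst z \<bullet> (\<theta> + j)) * (cis (snd z \<bullet> int_vec k) * evolved t g (\<theta> + j, k))" for k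
          proof -
            have "z \<bullet> (\<theta> + j, int_vec k) - t * (norm (\<theta> + j, int_vec k :: real ^ 'm))\<^sup>2 =
              fst z \<bullet> (\<theta> + j) + snd z \<bullet> int_vec k + - t * (norm (freq_vec (\<theta> + j, k)))\<^sup>2"
              by (simp add: inner_prod_def freq_vec_def)
            then show ?thesis unfolding evolved_def by (simp only: cis_mult[symmetric] mult_ac)
          qed
          then show "(\<Sum>k\<in>?K. g (\<theta> + j, k) * cis (z \<bullet> (\<theta> + j, int_vec k) - t * (norm (\<theta> + j, int_vec k :: real ^ 'm))\<^sup>2)) =
            cis (fst z \<bullet> (\<theta> + j)) * h t (snd z) (\<theta> + j)"
            by (simp only: h_def sum_distrib_left)
        qed
        finally show ?thesis .
      qed
      have "(\<Sum>k\<in>?K. \<Sum>j\<in>J. esq (g (\<theta> + j, k))) = (\<Sum>j\<in>J. \<Sum>l\<in>int_vec ` ?K. esq (?b (j, l)))"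
        by (subst sum.swap, subst sum.reindex[OF inj]) (simp add: inv_f_f[OF inj_int_vec])
      also have "\<dots> = (\<Sum>k\<in>?P. esq (?b k))"
        by (simp only: sum.cartesian_product split_beta' prod.collapse)
      also have "\<dots> \<le> ennreal C * (\<integral>\<^sup>+t\<in>?I. (\<integral>\<^sup>+z\<in>?W1 \<times> ?W2.
        esq (\<Sum>k\<in>?P. ?b k * cis (z \<bullet> (k + (\<theta>, 0)) - t * (norm (k + (\<theta>, 0)))\<^sup>2)) \<partial>lborel) \<partial>lborel)"
        by (rule obs[OF P])
      finally show ?thesis by (simp only: form \<Phi>_def prod.case)
    qed
    have "sq_norm freq_measure g = (\<Sum>k\<in>?K. (\<integral>\<^sup>+\<theta>\<in>unit_cell. (\<Sum>j\<in>J. esq (g (\<theta> + j, k))) \<partial>lborel))"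
      unfolding slice4 by (simp only: cell_supported.nn_integral_sq_tiling[OF cs0])
    also have "\<dots> = (\<integral>\<^sup>+\<theta>\<in>unit_cell. (\<Sum>k\<in>?K. \<Sum>j\<in>J. esq (g (\<theta> + j, k))) \<partial>lborel)"
      unfolding sum_distrib_right by (rule nn_integral_sum[symmetric]) measurable
    also have "\<dots> \<le> (\<integral>\<^sup>+\<theta>\<in>unit_cell. ennreal C * (\<integral>\<^sup>+t\<in>?I. (\<integral>\<^sup>+z\<in>?W1 \<times> ?W2. \<Phi> (\<theta>, t, z) \<partial>lborel) \<partial>lborel) \<partial>lborel)"
      by (intro nn_integral_mono mult_right_mono fibre) auto
    \<comment> \<open>All indicators go inside, so that Tonelli applies to one jointly measurable
      integrand and \<theta> can become the innermost variable.\<close>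
    also have "\<dots> = ennreal C * (\<integral>\<^sup>+\<theta>. (\<integral>\<^sup>+t. (\<integral>\<^sup>+z. \<Phi> (\<theta>, t, z) * indicator (?W1 \<times> ?W2) z * indicator ?I t * indicator unit_cell \<theta> \<partial>lborel) \<partial>lborel) \<partial>lborel)"
    proof -
      have "(\<integral>\<^sup>+t. (\<integral>\<^sup>+z. \<Phi> (\<theta>, t, z) * indicator (?W1 \<times> ?W2) z * indicator ?I t * indicator unit_cell \<theta> \<partial>lborel) \<partial>lborel) =
        (\<integral>\<^sup>+t\<in>?I. (\<integral>\<^sup>+z\<in>?W1 \<times> ?W2. \<Phi> (\<theta>, t, z) \<partial>lborel) \<partial>lborel) * indicator unit_cell \<theta>" for \<theta>
      proof (cases "\<theta> \<in> unit_cell")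
        case True
        have "(\<integral>\<^sup>+z. \<Phi> (\<theta>, t, z) * indicator (?W1 \<times> ?W2) z * indicator ?I t \<partial>lborel) =
          (\<integral>\<^sup>+z\<in>?W1 \<times> ?W2. \<Phi> (\<theta>, t, z) \<partial>lborel) * indicator ?I t" for t
          by (cases "t \<in> ?I") (simp_all del: atLeastAtMost_iff)
        then show ?thesis using True by simp
      qed simp
      then show ?thesis by (simp only: mult.assoc[of "ennreal C"]) (rule nn_integral_cmult, measurable)
    qed
    also have "(\<integral>\<^sup>+\<theta>. (\<integral>\<^sup>+t. (\<integral>\<^sup>+z. \<Phi> (\<theta>, t, z) * indicator (?W1 \<times> ?W2) z * indicator ?I t * indicator unit_cell \<theta> \<partial>lborel) \<partial>lborel) \<partial>lborel) =
      (\<integral>\<^sup>+t. (\<integral>\<^sup>+\<theta>. (\<integral>\<^sup>+z. \<Phi> (\<theta>, t, z) * indicator (?W1 \<times> ?W2) z * indicator ?I t * indicator unit_cell \<theta> \<partial>lborel) \<partial>lborel) \<partial>lborel)"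
      by (intro lborel_pair.Fubini') measurable
    also have "\<dots> = (\<integral>\<^sup>+t. (\<integral>\<^sup>+z. (\<integral>\<^sup>+\<theta>. \<Phi> (\<theta>, t, z) * indicator (?W1 \<times> ?W2) z * indicator ?I t * indicator unit_cell \<theta> \<partial>lborel) \<partial>lborel) \<partial>lborel)"
      by (intro nn_integral_cong lborel_pair.Fubini') measurable
    also have "\<dots> = (\<integral>\<^sup>+t\<in>?I. (\<integral>\<^sup>+z\<in>?W1 \<times> ?W2. G t z \<partial>lborel) \<partial>lborel)"
    proof (rule nn_integral_cong)
      fix t :: real
      have "(\<integral>\<^sup>+\<theta>. \<Phi> (\<theta>, t, z) * indicator (?W1 \<times> ?W2) z * indicator ?I t * indicator unit_cell \<theta> \<partial>lborel) =
        G t z * indicator (?W1 \<times> ?W2) z * indicator ?I t" for z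
        unfolding G_def by (auto simp: indicator_def)
      then show "(\<integral>\<^sup>+z. (\<integral>\<^sup>+\<theta>. \<Phi> (\<theta>, t, z) * indicator (?W1 \<times> ?W2) z * indicator ?I t * indicator unit_cell \<theta> \<partial>lborel) \<partial>lborel) =
        (\<integral>\<^sup>+z\<in>?W1 \<times> ?W2. G t z \<partial>lborel) * indicator ?I t"
        by (simp add: nn_integral_multc)
    qed
    finally have "ennreal (?c\<^sup>2) * sq_norm freq_measure g \<le>
      ennreal (?c\<^sup>2) * (ennreal C * (\<integral>\<^sup>+t\<in>?I. (\<integral>\<^sup>+z\<in>?W1 \<times> ?W2. G t z \<partial>lborel) \<partial>lborel))"
      by (rule mult_left_mono) simp
    also have "\<dots> = ennreal C * (ennreal (?c\<^sup>2) * (\<integral>\<^sup>+t\<in>?I. (\<integral>\<^sup>+z\<in>?W1 \<times> ?W2. G t z \<partial>lborel) \<partial>lborel))"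
      by (simp only: mult.left_commute)
    also have "ennreal (?c\<^sup>2) * (\<integral>\<^sup>+t\<in>?I. (\<integral>\<^sup>+z\<in>?W1 \<times> ?W2. G t z \<partial>lborel) \<partial>lborel) =
      (\<integral>\<^sup>+t\<in>?I. ennreal (?c\<^sup>2) * (\<integral>\<^sup>+z\<in>?W1 \<times> ?W2. G t z \<partial>lborel) \<partial>lborel)"
      by (subst nn_integral_cmult[symmetric]) (auto simp: mult.assoc)
    also have "\<dots> \<le> (\<integral>\<^sup>+t\<in>{0..T}. A t \<partial>lborel)"
      by (intro nn_integral_mono mult_mono lower) (use I in \<open>auto simp: indicator_def\<close>)
    finally show ?thesis unfolding A_def by (simp add: mult_left_mono)
  qed
  show ?thesis
  \<comment> \<open>The division removes the normalization of the inverse transform, which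
    \<open>main\<close> carries on its left-hand side.\<close>
  proof (rule exI[of _ "C / ?c\<^sup>2"], intro conjI allI ballI impI)
    show "0 \<le> C / ?c\<^sup>2" using C by simp
    fix R and g :: "(real ^ 'n) \<times> (int ^ 'm) \<Rightarrow> complex"
    assume g: "g \<in> borel_measurable freq_measure" "sq_norm freq_measure g < \<infinity>" "\<forall>\<zeta>. \<zeta> \<notin> freq_ball R \<longrightarrow> g \<zeta> = 0"
    let ?E = "\<integral>\<^sup>+t\<in>{0..T}. (\<integral>\<^sup>+z\<in>\<Omega>1 \<times> \<Omega>2. esq (inv_fourier_integral (evolved t g) z) \<partial>cyl_measure) \<partial>lborel"
    have "sq_norm freq_measure g = ennreal (1 / ?c\<^sup>2) * (ennreal (?c\<^sup>2) * sq_norm freq_measure g)"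
      using c by (simp add: mult.assoc[symmetric] ennreal_mult[symmetric])
    also have "\<dots> \<le> ennreal (1 / ?c\<^sup>2) * (ennreal C * ?E)"
      using main[OF g(1,2), of R] g(3) by (intro mult_left_mono) auto
    also have "\<dots> = ennreal (C / ?c\<^sup>2) * ?E"
      using c C by (simp add: mult.assoc[symmetric] ennreal_mult[symmetric])
    finally show "sq_norm freq_measure g \<le> ennreal (C / ?c\<^sup>2) * ?E" .
  qed
qed

section \<open>Passage to arbitrary square-integrable data\<close>

lemma measurable_inv_fourier_integral_evolved:
  fixes g :: "(real ^ 'n) \<times> (int ^ 'm) \<Rightarrow> complex"
  assumes g: "g \<in> borel_measurable freq_measure"
  shows "(\<lambda>(t, z). inv_fourier_integral (evolved t g) z) \<in> borel_measurable (lborel \<Otimes>\<^sub>M cyl_measure)"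
proof -
  interpret sigma_finite_measure "freq_measure :: ((real ^ 'n) \<times> (int ^ 'm)) measure" by (rule sigma_finite_freq)
  let ?N = "(lborel :: real measure) \<Otimes>\<^sub>M (cyl_measure :: ((real ^ 'n) \<times> (real ^ 'm)) measure)"
  let ?F = "freq_measure :: ((real ^ 'n) \<times> (int ^ 'm)) measure"
  have t: "(\<lambda>p. fst (fst p)) \<in> borel_measurable (?N \<Otimes>\<^sub>M ?F)" by measurable
  have z: "(\<lambda>p. snd (fst p)) \<in> borel_measurable (?N \<Otimes>\<^sub>M ?F)"
    by (intro measurable_compose[OF measurable_fst] measurable_compose[OF measurable_snd measurable_ident_cyl])
  have f: "(\<lambda>p. freq_vec (snd p)) \<in> borel_measurable (?N \<Otimes>\<^sub>M ?F)"
    by (rule measurable_compose[OF measurable_snd measurable_freq_vec])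
  then have nf: "(\<lambda>p. norm (freq_vec (snd p))) \<in> borel_measurable (?N \<Otimes>\<^sub>M ?F)"
    by (rule measurable_compose) measurable
  have gs: "(\<lambda>p. g (snd p)) \<in> borel_measurable (?N \<Otimes>\<^sub>M ?F)" by (rule measurable_compose[OF measurable_snd g])
  have "(\<lambda>p. cis (snd (fst p) \<bullet> freq_vec (snd p)) * evolved (fst (fst p)) g (snd p)) \<in> borel_measurable (?N \<Otimes>\<^sub>M ?F)"
    unfolding evolved_def using t z f nf gs
    by (intro borel_measurable_times borel_measurable_cis borel_measurable_inner borel_measurable_uminus
        borel_measurable_power)
  then have "(\<lambda>p. LINT \<zeta>|?F. cis (snd p \<bullet> freq_vec \<zeta>) * evolved (fst p) g \<zeta>) \<in> borel_measurable ?N"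
    by (intro borel_measurable_lebesgue_integral) (simp add: split_beta')
  then show ?thesis
    unfolding inv_fourier_integral_def split_beta' by (intro borel_measurable_times borel_measurable_const)
qed

theorem theorem1p5:
  fixes \<Omega>1 :: "(real ^ 'n) set" and \<Omega>2 :: "(real ^ 'm) set" and T :: real
  assumes "\<Omega>1 \<noteq> {}" and "open \<Omega>1" and "two_pi_invariant \<Omega>1"
    and "\<Omega>2 \<noteq> {}" and "open \<Omega>2" and "two_pi_invariant \<Omega>2"
    and "T > 0"
  shows "\<exists>C :: real. \<forall>u0 \<in> L2 (cyl_measure :: ((real ^ 'n) \<times> (real ^ 'm)) measure).
    (L2_norm cyl_measure u0)\<^sup>2 \<le>
      C * (LBINT t:{0..T}.
        (L2_norm (restrict_space cyl_measure (\<Omega>1 \<times> \<Omega>2)) (schroedinger t u0))\<^sup>2)"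
proof -
  let ?cyl = "cyl_measure :: ((real ^ 'n) \<times> (real ^ 'm)) measure"
  let ?M = "restrict_space ?cyl (\<Omega>1 \<times> \<Omega>2)"
  obtain C where C: "0 \<le> C" and obs: "\<And>R g. g \<in> borel_measurable (freq_measure :: ((real ^ 'n) \<times> (int ^ 'm)) measure) \<Longrightarrow>
    sq_norm freq_measure g < \<infinity> \<Longrightarrow> \<forall>\<zeta>. \<zeta> \<notin> freq_ball R \<longrightarrow> g \<zeta> = 0 \<Longrightarrow>
    sq_norm freq_measure g \<le> ennreal C * (\<integral>\<^sup>+t\<in>{0..T}.
      (\<integral>\<^sup>+z\<in>\<Omega>1 \<times> \<Omega>2. esq (inv_fourier_integral (evolved t g) z) \<partial>cyl_measure) \<partial>lborel)"
    using observable_bounded_frequency[OF assms] by blast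
  interpret cyl: sigma_finite_measure ?cyl by (rule sigma_finite_cyl)
  interpret F: truncated_isometry ?cyl freq_measure cyl_ball fourier_integral by (rule truncated_isometry_fourier)
  interpret G: truncated_isometry freq_measure ?cyl freq_ball inv_fourier_integral by (rule truncated_isometry_inv_fourier)
  have [measurable]: "\<Omega>1 \<in> sets borel" "\<Omega>2 \<in> sets borel" using assms by auto
  have "{z \<in> space ?cyl. fst z \<in> \<Omega>1 \<and> snd z \<in> \<Omega>2} \<in> sets ?cyl" by measurable
  also have "{z \<in> space ?cyl. fst z \<in> \<Omega>1 \<and> snd z \<in> \<Omega>2} = \<Omega>1 \<times> \<Omega>2 \<inter> space ?cyl" by auto
  finally have sqM: "sq_norm ?M h = (\<integral>\<^sup>+z\<in>\<Omega>1 \<times> \<Omega>2. esq (h z) \<partial>cyl_measure)" for h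
    unfolding sq_norm_def by (rule nn_integral_restrict_space)
  have sqM_le: "sq_norm ?M h \<le> sq_norm ?cyl h" for h
    unfolding sqM unfolding sq_norm_def by (intro nn_integral_mono) (auto simp: indicator_def)
  have measM: "h \<in> borel_measurable ?M" if "h \<in> borel_measurable ?cyl" for h :: "_ \<Rightarrow> complex"
    using that by (rule measurable_restrict_space1)
  show ?thesis
  \<comment> \<open>One factor 2 bounds \<open>u0\<close> by its transform; the other arises when
    the truncated solutions are replaced by the limit.\<close>
  proof (intro exI[of _ "4 * C"] ballI)
    fix u0 assume u0: "u0 \<in> L2 ?cyl"
    define g where "g = fourier u0"
    have gL2: "g \<in> L2 freq_measure" and u0_le: "sq_norm ?cyl u0 \<le> 2 * sq_norm freq_measure g"
      using F.L2_lim_truncation(1,3)[OF u0] by (auto simp: g_def fourier_eq_L2_lim)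
    then have gm [measurable]: "g \<in> borel_measurable freq_measure" and gfin: "sq_norm freq_measure g < \<infinity>"
      by (auto simp: L2_iff)
    have egL2: "evolved t g \<in> L2 freq_measure" for t
      using gfin measurable_evolved[OF gm] by (simp add: L2_iff)
    define v where "v t = schroedinger t u0" for t
    have v_eq: "v t = L2_lim ?cyl (G.truncation (evolved t g))" for t
    proof -
      have "(\<lambda>\<zeta>. cis (- t * (norm (freq_vec \<zeta>))\<^sup>2) * fourier u0 \<zeta>) = evolved t g"
        by (auto simp: evolved_def g_def)
      then show ?thesis by (simp only: v_def schroedinger_def inv_fourier_eq_L2_lim)
    qed
    have tail_evolved: "G.tail (evolved t g) R = G.tail g R" for t R by (simp add: G.tail_def)
    define \<tau> where "\<tau> n = G.tail g (real n)" for n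
    \<comment> \<open>Frequency truncation commutes with the evolution, so the truncated solutions
      have data \<open>gn n\<close> independent of time, and their distance from the solution is
      bounded uniformly in \<open>t\<close>.\<close>
    define gn where "gn n \<zeta> = indicator (freq_ball (real n)) \<zeta> * g \<zeta>" for n \<zeta>
    define f where "f n t = inv_fourier_integral (evolved t (gn n))" for n t
    have f_eq: "f n t = G.truncation (evolved t g) (real n)" for n t
      by (simp add: f_def G.truncation_def evolved_indicator gn_def[abs_def])
    have gnm [measurable]: "gn n \<in> borel_measurable freq_measure" for n unfolding gn_def[abs_def] by measurable
    have gn_le: "sq_norm freq_measure (gn n) \<le> sq_norm freq_measure g" for n
      unfolding gn_def[abs_def] by (rule G.sq_norm_indicator_le)
    have gn_fin: "sq_norm freq_measure (gn n) < \<infinity>" for n by (rule le_less_trans[OF gn_le gfin])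
    have vL2: "v t \<in> L2 ?cyl" for t unfolding v_eq by (rule G.L2_lim_truncation(1)[OF egL2])
    then have vm: "v t \<in> borel_measurable ?cyl" and vfin: "sq_norm ?cyl (v t) < \<infinity>" for t by (auto simp: L2_iff)
    have close: "sq_norm ?cyl (\<lambda>z. f n t z - v t z) \<le> 2 * \<tau> n" for n t
      unfolding f_eq v_eq \<tau>_def using G.L2_lim_truncation(2)[OF egL2] by (simp only: tail_evolved)
    have fm: "f n t \<in> borel_measurable ?cyl" for n t
      unfolding f_def by (intro measurable_inv_fourier_integral measurable_evolved gnm)
    have f_sq: "sq_norm ?cyl (f n t) = sq_norm freq_measure (gn n)" for n t
      unfolding f_def
      by (subst sq_norm_inv_fourier_integral[of _ "real n"])
        (use gn_fin measurable_evolved[OF gnm] in \<open>auto simp: evolved_def gn_def\<close>)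
    have \<tau>0: "\<tau> \<longlonglongrightarrow> 0" unfolding \<tau>_def by (rule G.tail_tendsto_0[OF gm gfin])
    define S where "S t = (L2_norm ?M (v t))\<^sup>2" for t
    have S_eq: "ennreal (S t) = sq_norm ?M (v t)" for t
    proof -
      have "v t \<in> L2 ?M" using measM[OF vm] le_less_trans[OF sqM_le vfin] by (simp add: L2_iff)
      then show ?thesis unfolding S_def by (rule L2_norm_squared)
    qed
    have S_eq': "S t = enn2real (sq_norm ?M (v t))" for t by (simp add: S_eq[symmetric] S_def)
    \<comment> \<open>The representative of the solution is chosen separately at each time, so
      \<open>S\<close> has no evident measurability. It is the pointwise limit of the energies of
      the truncated solutions, which are jointly measurable in time and space.\<close>
    have Sm [measurable]: "S \<in> borel_measurable lborel"
    proof (rule borel_measurable_LIMSEQ_real)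
      fix t
      show "(\<lambda>n. enn2real (sq_norm ?M (f n t))) \<longlonglongrightarrow> S t"
        unfolding S_eq'
      proof (rule sq_norm_tendsto)
        show "sq_norm ?M (f n t) < \<infinity>" for n by (rule le_less_trans[OF sqM_le]) (simp only: f_sq gn_fin)
        show "sq_norm ?M (v t) < \<infinity>" by (rule le_less_trans[OF sqM_le vfin])
        have "(\<lambda>n. 2 * \<tau> n) \<longlonglongrightarrow> 2 * 0" by (rule ennreal_tendsto_cmult[OF _ \<tau>0]) simp
        then have lim: "(\<lambda>n. 2 * \<tau> n) \<longlonglongrightarrow> 0" by simp
        show "(\<lambda>n. sq_norm ?M (\<lambda>z. f n t z - v t z)) \<longlonglongrightarrow> 0"
          by (rule tendsto_sandwich[OF _ _ tendsto_const lim])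
            (auto intro!: always_eventually order_trans[OF sqM_le close])
      qed (auto intro: measM fm vm)
    next
      fix n
      have "(\<lambda>p. f n (fst p) (snd p)) \<in> borel_measurable (lborel \<Otimes>\<^sub>M ?cyl)"
        using measurable_inv_fourier_integral_evolved[OF gnm] unfolding f_def split_beta' .
      then have "(\<lambda>p. esq (f n (fst p) (snd p))) \<in> borel_measurable (lborel \<Otimes>\<^sub>M ?cyl)"
        by (rule measurable_compose) measurable
      then have "(\<lambda>(t, z). esq (f n t z) * indicator (\<Omega>1 \<times> \<Omega>2) z) \<in> borel_measurable (lborel \<Otimes>\<^sub>M ?cyl)"
        unfolding split_beta'
        by (intro borel_measurable_times_ennreal measurable_compose[OF measurable_snd measurable_indicator_cyl])
          (use assms in auto)
      from cyl.borel_measurable_nn_integral[OF this]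
      have "(\<lambda>t. sq_norm ?M (f n t)) \<in> borel_measurable lborel" unfolding sqM .
      then show "(\<lambda>t. enn2real (sq_norm ?M (f n t))) \<in> borel_measurable lborel"
        by (rule borel_measurable_enn2real)
    qed
    define I where "I = (\<integral>\<^sup>+t\<in>{0..T}. ennreal (S t) \<partial>lborel)"
    have f_le: "sq_norm ?M (f n t) \<le> 2 * ennreal (S t) + 4 * \<tau> n" for n t
    proof -
      have "sq_norm ?M (f n t) = sq_norm ?M (\<lambda>z. v t z + (f n t z - v t z))" by simp
      also have "\<dots> \<le> 2 * sq_norm ?M (v t) + 2 * sq_norm ?M (\<lambda>z. f n t z - v t z)"
        by (intro sq_norm_add_le borel_measurable_diff measM fm vm)
      also have "\<dots> \<le> 2 * sq_norm ?M (v t) + 2 * (2 * \<tau> n)"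
        by (intro add_left_mono mult_left_mono order_trans[OF sqM_le close]) auto
      finally show ?thesis by (simp add: S_eq mult.assoc[symmetric])
    qed
    \<comment> \<open>The first summand collects the error \<open>4 * \<tau> n\<close> integrated
      over \<open>[0, T]\<close>; the 1 is the mass of \<open>g\<close> outside the frequency
      ball.\<close>
    define L where "L = ennreal C * (4 * ennreal T) + 1"
    \<comment> \<open>The estimate for bounded frequencies applies to \<open>gn n\<close> with the
      same \<open>C\<close> for every \<open>n\<close>, so letting \<open>n\<close> tend to infinity
      removes the error.\<close>
    have g_le: "sq_norm freq_measure g \<le> ennreal C * (2 * I) + L * \<tau> n" for n
    proof -
      have "sq_norm freq_measure g = sq_norm freq_measure (gn n) + \<tau> n"
        unfolding sq_norm_def \<tau>_def G.tail_def gn_def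
        by (subst nn_integral_add[symmetric]) (auto intro!: nn_integral_cong simp: indicator_def)
      also have "sq_norm freq_measure (gn n) \<le> ennreal C * (\<integral>\<^sup>+t\<in>{0..T}. sq_norm ?M (f n t) \<partial>lborel)"
        unfolding sqM f_def by (rule obs[where R = "real n", OF gnm gn_fin]) (simp add: gn_def)
      also have "(\<integral>\<^sup>+t\<in>{0..T}. sq_norm ?M (f n t) \<partial>lborel) \<le>
        (\<integral>\<^sup>+t. 2 * (ennreal (S t) * indicator {0..T} t) + 4 * \<tau> n * indicator {0..T} t \<partial>lborel)"
        by (intro nn_integral_mono) (use f_le in \<open>auto simp: indicator_def\<close>)
      also have "\<dots> = 2 * I + 4 * \<tau> n * ennreal T"
        using assms(7) unfolding I_def by (simp add: nn_integral_add nn_integral_cmult)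
      finally have "sq_norm freq_measure g \<le> ennreal C * (2 * I + 4 * \<tau> n * ennreal T) + \<tau> n"
        by (simp add: mult_left_mono)
      also have "\<dots> = ennreal C * (2 * I) + L * \<tau> n"
        unfolding L_def by (simp add: distrib_left distrib_right mult_ac add.assoc)
      finally show ?thesis .
    qed
    have g_le': "sq_norm freq_measure g \<le> ennreal C * (2 * I)"
    proof (rule LIMSEQ_le_const)
      have "L < top" using assms(7) by (simp add: L_def ennreal_mult_less_top)
      then have "(\<lambda>n. ennreal C * (2 * I) + L * \<tau> n) \<longlonglongrightarrow> ennreal C * (2 * I) + L * 0"
        by (intro tendsto_add tendsto_const ennreal_tendsto_cmult \<tau>0)
      then show "(\<lambda>n. ennreal C * (2 * I) + L * \<tau> n) \<longlonglongrightarrow> ennreal C * (2 * I)" by simp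
    qed (use g_le in blast)
    \<comment> \<open>The integral in the statement is a Bochner integral, with value 0 on
      non-integrable functions. This bound makes \<open>S\<close> integrable on
      \<open>[0, T]\<close>, so that it agrees with \<open>I\<close>. The 6 is 2 for the truncation
      at radius 0 plus 4 for its distance from the solution.\<close>
    have S_bound: "\<bar>S t\<bar> \<le> enn2real (6 * sq_norm freq_measure g)" for t
    proof -
      have "ennreal (S t) \<le> sq_norm ?cyl (v t)" unfolding S_eq by (rule sqM_le)
      also have "\<dots> = sq_norm ?cyl (\<lambda>z. f 0 t z - (f 0 t z - v t z))" by simp
      also have "\<dots> \<le> 2 * sq_norm ?cyl (f 0 t) + 2 * sq_norm ?cyl (\<lambda>z. f 0 t z - v t z)"
        by (intro sq_norm_diff_le borel_measurable_diff fm vm)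
      also have "\<dots> \<le> 2 * sq_norm freq_measure g + 2 * (2 * sq_norm freq_measure g)"
      proof (intro add_mono mult_left_mono order_trans[OF close])
        show "sq_norm ?cyl (f 0 t) \<le> sq_norm freq_measure g" by (simp only: f_sq gn_le)
        show "\<tau> 0 \<le> sq_norm freq_measure g"
          unfolding \<tau>_def G.tail_def sq_norm_def by (intro nn_integral_mono) (auto simp: indicator_def)
      qed auto
      also have "\<dots> = (2 + 4) * sq_norm freq_measure g" unfolding distrib_right by (simp add: mult.assoc[symmetric])
      finally have "ennreal (S t) \<le> 6 * sq_norm freq_measure g" by simp
      then have "enn2real (ennreal (S t)) \<le> enn2real (6 * sq_norm freq_measure g)"
        by (rule enn2real_mono) (use gfin in \<open>simp add: ennreal_mult_less_top\<close>)
      then show ?thesis by (simp add: S_def)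
    qed
    have int: "integrable lborel (\<lambda>t. indicator {0..T} t *\<^sub>R S t)"
      using S_bound by (intro integrableI_bounded_set_indicator[where B = "enn2real (6 * sq_norm freq_measure g)"])
        (use Sm in \<open>auto simp: emeasure_lborel_Icc_eq\<close>)
    have I_eq: "I = ennreal (LBINT t:{0..T}. S t)"
    proof -
      have "I = (\<integral>\<^sup>+t. ennreal (indicator {0..T} t *\<^sub>R S t) \<partial>lborel)"
        unfolding I_def by (intro nn_integral_cong) (auto simp: indicator_def)
      also have "\<dots> = ennreal (LBINT t:{0..T}. S t)"
        unfolding set_lebesgue_integral_def by (rule nn_integral_eq_integral[OF int]) (auto simp: S_def)
      finally show ?thesis .
    qed
    have S0: "0 \<le> (LBINT t:{0..T}. S t)"
      unfolding set_lebesgue_integral_def by (intro Bochner_Integration.integral_nonneg) (simp add: S_def)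
    have "ennreal ((L2_norm ?cyl u0)\<^sup>2) = sq_norm ?cyl u0" by (rule L2_norm_squared[OF u0])
    also have "\<dots> \<le> 2 * sq_norm freq_measure g" by (rule u0_le)
    also have "\<dots> \<le> 2 * (ennreal C * (2 * I))" by (intro mult_left_mono g_le') simp
    also have "\<dots> = ennreal (4 * C * (LBINT t:{0..T}. S t))"
      unfolding I_eq using C S0 by (simp add: ennreal_mult mult_ac)
    finally have "(L2_norm ?cyl u0)\<^sup>2 \<le> 4 * C * (LBINT t:{0..T}. S t)"
      using C S0 by (subst (asm) ennreal_le_iff) auto
    then show "(L2_norm ?cyl u0)\<^sup>2 \<le> 4 * C * (LBINT t:{0..T}. (L2_norm ?M (schroedinger t u0))\<^sup>2)"
      by (simp only: S_def v_def)
  qed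
qed

end
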